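(* Let $\mu=\sum_{\lambda\in\Lambda}c_\lambda\delta_\lambda$ with $\Lambda\subset\mathbb R$ locally finite and $c_\lambda$ positive integers, be a temperate distribution whose Fourier transform is a measure $\hat\mu=\sum_{\gamma\in\Gamma}b_\gamma\delta_\gamma$ ($\Gamma\subset\mathbb R$ countable) such that $|\hat\mu|$ is also a temperate distribution. Let $A=\{a_n\}_{n\in\mathbb Z}$ be the multiset in which each $\lambda\in\Lambda$ occurs $c_\lambda$ times, enumerated so that $a_n\le a_{n+1}$, and assume $0\notin A$. Let $$f(z)=(1-z/a_0)\prod_{n=1}^\infty(1-z/a_n)(1-z/a_{-n}),\qquad g(z)=\sum_{\gamma\in\Gamma,\ 0<\gamma<1}b_\gamma\frac{e^{2\pi i\gamma z}-1}{\gamma}.$$ Then $F(z)=e^{g(z)}f(z)$ is an almost periodic entire function.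
   Context: The Fourier transform is taken in the sense of tempered distributions with the convention $\hat\varphi(\lambda)=\int_{\mathbb R}\varphi(t)e^{-2\pi i\lambda t}\,dt$. An entire function $F$ is almost periodic if it is almost periodic in the strip $\mathbb C$: for every $-\infty<\alpha\le\beta<\infty$ and every $\varepsilon>0$ the set $\{\tau\in\mathbb R:\ \sup_{x\in\mathbb R,\ \alpha\le y\le\beta}|F(x+\tau+iy)-F(x+iy)|<\varepsilon\}$ is relatively dense in $\mathbb R$ (meets every interval of some length $L$ depending on $\varepsilon,\alpha,\beta$). *)

theory Defs
  imports "HOL-Analysis.Analysis"
begin

fun vderiv :: "nat \<Rightarrow> (real \<Rightarrow> complex) \<Rightarrow> real \<Rightarrow> complex" where
  "vderiv 0 \<phi> = \<phi>"
| "vderiv (Suc m) \<phi> = (\<lambda>t. vector_derivative (vderiv m \<phi>) (at t))"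

definition schwartz :: "(real \<Rightarrow> complex) \<Rightarrow> bool" where
  "schwartz \<phi> \<longleftrightarrow>
     (\<forall>m t. vderiv m \<phi> differentiable (at t)) \<and>
     (\<forall>k m. bounded (range (\<lambda>t. \<bar>t\<bar> ^ k * norm (vderiv m \<phi> t))))"

definition schwartz_seminorm :: "nat \<Rightarrow> nat \<Rightarrow> (real \<Rightarrow> complex) \<Rightarrow> real" where
  "schwartz_seminorm k m \<phi> = (SUP t. \<bar>t\<bar> ^ k * norm (vderiv m \<phi> t))"

definition fourier :: "(real \<Rightarrow> complex) \<Rightarrow> real \<Rightarrow> complex" where
  "fourier \<phi> \<xi> = (LINT t|lborel. \<phi> t * exp (- (2 * pi * \<i>) * complex_of_real (\<xi> * t)))"

definition pair_discrete :: "real set \<Rightarrow> (real \<Rightarrow> complex) \<Rightarrow> (real \<Rightarrow> complex) \<Rightarrow> complex" where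
  "pair_discrete S w \<phi> = (\<Sum>\<^sub>\<infinity>x\<in>S. w x * \<phi> x)"

text \<open>The discrete measure \<open>\<Sum>_{x\<in>S} w x \<delta>_x\<close> is a temperate distribution:
  it acts on every Schwartz function (the integral converges absolutely) and the
  resulting linear functional is continuous, i.e. bounded by finitely many Schwartz seminorms.\<close>
definition tempered_discrete :: "real set \<Rightarrow> (real \<Rightarrow> complex) \<Rightarrow> bool" where
  "tempered_discrete S w \<longleftrightarrow>
     (\<forall>\<phi>. schwartz \<phi> \<longrightarrow> ((\<lambda>x. norm (w x * \<phi> x)) summable_on S)) \<and>
     (\<exists>(C::real) (K::nat). \<forall>\<phi>. schwartz \<phi> \<longrightarrow>
        norm (pair_discrete S w \<phi>) \<le> C * (\<Sum>k\<in>{..K}. \<Sum>m\<in>{..K}. schwartz_seminorm k m \<phi>))"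

definition almost_periodic_entire :: "(complex \<Rightarrow> complex) \<Rightarrow> bool" where
  "almost_periodic_entire F \<longleftrightarrow>
     F holomorphic_on UNIV \<and>
     (\<forall>\<alpha> \<beta> \<epsilon>. \<alpha> \<le> \<beta> \<longrightarrow> \<epsilon> > 0 \<longrightarrow>
        (\<exists>L>0. \<forall>x0. \<exists>\<tau>\<in>{x0..x0+L}.
           (\<exists>\<delta><\<epsilon>. \<forall>x y. \<alpha> \<le> y \<longrightarrow> y \<le> \<beta> \<longrightarrow>
              norm (F (Complex (x + \<tau>) y) - F (Complex x y)) \<le> \<delta>)))"

end

theory Submission
  imports Defs "HOL-Complex_Analysis.Complex_Analysis" "HOL-Probability.Probability"
begin

text \<open>
  Testing \<open>\<mu>\<close> against mollified one-sided exponentials shows that, for \<open>Im z > 0\<close>, the sum of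
  \<open>1 / (z - a n)\<close> (up to a constant) equals \<open>- 2 \<pi> i \<Sum> b \<gamma> exp (2 \<pi> i \<gamma> z)\<close> over the frequencies \<open>\<gamma> > 0\<close>.
  Its imaginary part is a Poisson sum with relatively dense almost periods. Since the masses are
  integers, these almost periods preserve the number of points in suitable cells exactly, so that the
  number of points in an interval depends, up to a bounded error, only on its length. Hence
  \<open>a n + a (- n)\<close> is bounded, and the symmetric product \<open>f\<close> converges. Integrating its logarithmic
  derivative, the factor \<open>exp g\<close> cancels exactly the small frequencies, whose primitives need not
  converge absolutely: in the upper half plane \<open>F z = C exp (K z - \<Sum> (b \<gamma> / \<gamma>) exp (2 \<pi> i \<gamma> z))\<close>
  with \<open>\<gamma> \<ge> 1\<close> and \<open>K\<close> purely imaginary, which is almost periodic on every horizontal line.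
  The zeros of \<open>f\<close> are real, so \<open>|f (x + i y)|\<close> grows with \<open>|y|\<close> and \<open>F\<close> is bounded on
  horizontal strips; a three lines argument carries almost periodicity over to all strips.
\<close>

subsection \<open>Almost periods and dominated sums\<close>

text \<open>\<open>\<Gamma>\<close> may be dense, so its frequencies cannot be summed in their
  natural order. Temperateness of \<open>norm (b \<gamma>)\<close> takes the place of an order:
  every sum over \<open>\<Gamma>\<close> is dominated by a pairing with a Schwartz function and is
  unordered. On the side of the points the difficulty is conditional convergence: the product and
  the Cauchy sum make sense only if positive and negative points balance, and this balance has to be
  derived from quantities that converge absolutely, namely differences of Cauchy sums and Poisson
  sums. Neither \<open>exp g\<close> nor \<open>f\<close> need be almost periodic alone. Integrating
  the exponential series divides the coefficients by \<open>\<gamma>\<close>; near 0 only the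
  subtracted 1 in \<open>g\<close> restores convergence, at the price of possible growth in
  \<open>z\<close>, which \<open>f\<close> compensates. The explicit formula is available only above
  the real axis, so values below are reached by comparing points on the same vertical line, without
  any second formula.\<close>

lemma norm_cis_diff_le: "norm (cis s - cis t) \<le> \<bar>s - t\<bar>"
proof -
  have "norm (cis s - cis t) = norm (cis t * (cis (s - t) - 1))"
    by (simp add: algebra_simps cis_mult)
  also have "\<dots> = 2 * \<bar>sin ((s - t) / 2)\<bar>"
    using dist_exp_i_1[of "s - t"] by (simp add: norm_mult cis_conv_exp dist_norm mult.commute)
  also have "\<dots> \<le> 2 * \<bar>(s - t) / 2\<bar>"
    using abs_sin_x_le_abs_x[of "(s - t) / 2"] by simp
  finally show ?thesis by simp
qed

text \<open>Pigeonhole on the torus: \<open>q t\<close> records which of finitely many small cells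
  contains the point with coordinates \<open>\<theta> * t / (2 * pi)\<close> modulo 1. Finitely many
  times \<open>T\<close> represent all occupied cells, so every \<open>t\<close> has a partner
  \<open>s\<close> in \<open>T\<close> in the same cell, and \<open>t - s\<close> is an almost
  period at distance at most \<open>B\<close> from \<open>t\<close>. This bound on \<open>s\<close>
  is what makes the almost periods relatively dense.\<close>

lemma common_almost_periods_finite:
  fixes S :: "real set"
  assumes "finite S" "\<eta> > 0"
  shows "\<exists>L>0. \<forall>x0. \<exists>\<tau>\<in>{x0..x0+L}. \<forall>\<theta>\<in>S. norm (cis (\<theta> * \<tau>) - 1) < \<eta>"
proof -
  obtain K :: nat where K: "2 * pi / \<eta> < real K"
    using reals_Archimedean2 by blast
  have Kpos: "real K > 0"
    using K assms(2) by (smt (verit) divide_pos_pos pi_gt_zero)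
  define q where "q t = restrict (\<lambda>\<theta>. \<lfloor>real K * frac (\<theta> * t / (2 * pi))\<rfloor>) S" for t :: real
  have "q t \<in> PiE S (\<lambda>_. {0..int K})" for t
  proof -
    have "\<lfloor>real K * frac u\<rfloor> \<in> {0..int K}" for u :: real
    proof -
      have "0 \<le> real K * frac u" "real K * frac u \<le> real K * 1"
        using Kpos frac_lt_1[of u] by (auto intro!: mult_left_mono simp: less_imp_le)
      then show ?thesis by (auto simp: floor_le_iff)
    qed
    then show ?thesis by (auto simp: q_def)
  qed
  then have "finite (range q)"
    by (intro finite_subset[OF _ finite_PiE[OF assms(1), of "\<lambda>_. {0..int K}"]]) auto
  then obtain T where T: "finite T" "range q = q ` T"
    by (metis finite_subset_image subset_refl)
  define B where "B = Max (insert 0 (abs ` T))"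
  have B: "\<bar>t\<bar> \<le> B" if "t \<in> T" for t
    using that T(1) unfolding B_def by (intro Max_ge) auto
  have B0: "B \<ge> 0" using T(1) unfolding B_def by (intro Max_ge) auto
  show ?thesis
  proof (intro exI[of _ "2 * B + 1"] conjI allI)
    fix x0 :: real
    define t where "t = x0 + B"
    obtain s where s: "s \<in> T" "q t = q s" using T(2) by (metis rangeI imageE)
    have "norm (cis (\<theta> * (t - s)) - 1) < \<eta>" if "\<theta> \<in> S" for \<theta>
    proof -
      define u v where "u = \<theta> * t / (2 * pi)" and "v = \<theta> * s / (2 * pi)"
      have "\<lfloor>real K * frac u\<rfloor> = \<lfloor>real K * frac v\<rfloor>"
        using fun_cong[OF s(2), of \<theta>] that by (simp add: q_def u_def v_def)
      then have "\<bar>real K * frac u - real K * frac v\<bar> < 1" by linarith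
      then have d: "\<bar>frac u - frac v\<bar> < 1 / real K"
        using Kpos abs_mult[of "real K" "frac u - frac v"] by (simp add: right_diff_distrib field_simps)
      have cf: "cis (2 * pi * u) = cis (2 * pi * frac u)" for u :: real
      proof -
        have "2 * pi * u = 2 * pi * frac u + 2 * pi * of_int \<lfloor>u\<rfloor>"
          by (simp add: frac_def algebra_simps)
        then have "cis (2 * pi * u) = cis (2 * pi * frac u) * cis (2 * pi * of_int \<lfloor>u\<rfloor>)"
          by (simp only: cis_mult)
        then show ?thesis by (simp add: cis_multiple_2pi)
      qed
      then have eq: "cis (\<theta> * t) = cis (2 * pi * frac u)" "cis (\<theta> * s) = cis (2 * pi * frac v)"
        using cf[of u] cf[of v] by (simp_all add: u_def v_def)
      have "norm (cis (\<theta> * (t - s)) - 1) = norm (cis (\<theta> * s) * (cis (\<theta> * (t - s)) - 1))"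
        by (simp add: norm_mult)
      also have "\<dots> = norm (cis (\<theta> * t) - cis (\<theta> * s))"
        by (simp add: algebra_simps cis_mult)
      also have "\<dots> \<le> \<bar>2 * pi * frac u - 2 * pi * frac v\<bar>"
        unfolding eq by (rule norm_cis_diff_le)
      also have "\<dots> = 2 * pi * \<bar>frac u - frac v\<bar>"
        by (simp add: abs_mult flip: right_diff_distrib)
      also have "\<dots> < 2 * pi * (1 / real K)"
        using d by (intro mult_strict_left_mono) auto
      also have "\<dots> < \<eta>" using K assms(2) Kpos by (simp add: field_simps)
      finally show ?thesis .
    qed
    then show "\<exists>\<tau>\<in>{x0..x0 + (2 * B + 1)}. \<forall>\<theta>\<in>S. norm (cis (\<theta> * \<tau>) - 1) < \<eta>"
      using B[OF s(1)] by (intro bexI[of _ "t - s"]) (auto simp: t_def)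
  qed (use B0 in auto)
qed

lemma norm_cis_minus_1_le: "norm (cis x - 1) \<le> 2"
  using norm_triangle_ineq4[of "cis x" 1] by simp

text \<open>Finitely many indices carry all but \<open>\<eta> / 4\<close> of the mass. As
  \<open>norm (cis x - 1)\<close> is at most 2, the rest contributes less than
  \<open>\<eta> / 2\<close> whatever \<open>\<tau>\<close> is, and the finite lemma handles the
  frequencies that remain. The extra frequency \<open>\<kappa>\<close> carries no weight; it is
  there for the rotation \<open>exp (exponent * z)\<close> of the final formula.\<close>

lemma common_almost_periods_weighted:
  fixes w \<theta> :: "'i \<Rightarrow> real"
  assumes w: "w summable_on I" "\<And>i. i \<in> I \<Longrightarrow> w i \<ge> 0" and "\<eta> > 0"
  shows "\<exists>L>0. \<forall>x0. \<exists>\<tau>\<in>{x0..x0+L}.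
           (\<Sum>\<^sub>\<infinity>i\<in>I. w i * norm (cis (\<theta> i * \<tau>) - 1)) < \<eta> \<and> norm (cis (\<kappa> * \<tau>) - 1) < \<eta>"
proof -
  have "eventually (\<lambda>S. dist (sum w S) (infsum w I) < \<eta> / 4) (finite_subsets_at_top I)"
    using has_sum_infsum[OF w(1)] \<open>\<eta> > 0\<close> unfolding has_sum_def by (intro tendstoD) auto
  then obtain S where S: "finite S" "S \<subseteq> I" "dist (sum w S) (infsum w I) < \<eta> / 4"
    unfolding eventually_finite_subsets_at_top by blast
  define W where "W = sum w S + 1"
  have W: "W > 0" using w(2) S(2) unfolding W_def by (intro add_nonneg_pos sum_nonneg) auto
  define \<eta>' where "\<eta>' = min \<eta> (\<eta> / (2 * W))"
  have "\<eta>' > 0" using \<open>\<eta> > 0\<close> W by (simp add: \<eta>'_def)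
  then obtain L where L: "L > 0" "\<And>x0. \<exists>\<tau>\<in>{x0..x0+L}. \<forall>t\<in>insert \<kappa> (\<theta> ` S). norm (cis (t * \<tau>) - 1) < \<eta>'"
    using common_almost_periods_finite[of "insert \<kappa> (\<theta> ` S)" \<eta>'] S(1) by auto
  have "(\<Sum>\<^sub>\<infinity>i\<in>I. w i * norm (cis (\<theta> i * \<tau>) - 1)) < \<eta>"
    if \<tau>: "\<forall>t\<in>insert \<kappa> (\<theta> ` S). norm (cis (t * \<tau>) - 1) < \<eta>'" for \<tau>
  proof -
    let ?h = "\<lambda>i. w i * norm (cis (\<theta> i * \<tau>) - 1)"
    have le2: "?h i \<le> 2 * w i" if "i \<in> I" for i
      using mult_left_mono[OF norm_cis_minus_1_le w(2)[OF that], of "\<theta> i * \<tau>"] by simp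
    have sI: "?h summable_on I"
      by (rule summable_on_comparison_test[OF summable_on_cmult_right[OF w(1), of 2] le2])
         (use w(2) in auto)
    have sD: "w summable_on (I - S)" "?h summable_on (I - S)"
      by (rule summable_on_subset_banach[OF w(1)], simp, rule summable_on_subset_banach[OF sI], simp)
    have "infsum ?h I = infsum ?h (I - S) + sum ?h S"
      using infsum_Un_disjoint[OF sD(2) summable_on_finite[OF S(1), of ?h]] S
      by (simp add: Un_absorb2 infsum_finite Un_commute Int_commute)
    also have "infsum ?h (I - S) \<le> infsum (\<lambda>i. 2 * w i) (I - S)"
      by (rule infsum_mono[OF sD(2) summable_on_cmult_right[OF sD(1)]]) (use le2 in auto)
    also have "\<dots> = 2 * infsum w (I - S)" by (rule infsum_cmult_right') 
    also have "infsum w (I - S) = infsum w I - sum w S"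
      using infsum_Diff[OF w(1) summable_on_finite[OF S(1), of w] S(2)] S(1) by simp
    also have "sum ?h S \<le> sum (\<lambda>i. w i * \<eta>') S"
      using \<tau> w(2) S(2) by (intro sum_mono mult_left_mono) (auto intro: less_imp_le)
    also have "\<dots> \<le> W * (\<eta> / (2 * W))"
      using w(2) S(2) \<open>\<eta> > 0\<close> W \<open>\<eta>' > 0\<close>
      unfolding sum_distrib_right[symmetric]
      by (intro mult_mono) (auto simp: W_def \<eta>'_def sum_nonneg subset_iff)
    also have "\<dots> = \<eta> / 2" using W by simp
    finally have le: "infsum ?h I \<le> 2 * (infsum w I - sum w S) + \<eta> / 2" by simp
    have "infsum w I - sum w S < \<eta> / 4"
      using S(3) abs_ge_self[of "infsum w I - sum w S"] by (simp add: dist_real_def abs_minus_commute)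
    with le show ?thesis by simp
  qed
  moreover have "\<eta>' \<le> \<eta>" by (simp add: \<eta>'_def)
  ultimately have "\<forall>x0. \<exists>\<tau>\<in>{x0..x0+L}. (\<Sum>\<^sub>\<infinity>i\<in>I. w i * norm (cis (\<theta> i * \<tau>) - 1)) < \<eta> \<and> norm (cis (\<kappa> * \<tau>) - 1) < \<eta>"
    using L(2) by (meson insertI1 order_less_le_trans)
  then show ?thesis using L(1) by blast
qed

text \<open>Domination by \<open>M\<close> makes the finite partial sums converge uniformly on
  \<open>Y\<close>, so the limit along \<open>F\<close> and the limit over finite subsets of
  \<open>I\<close> may be exchanged. The index set is arbitrary because \<open>\<Gamma>\<close>
  comes without an enumeration.\<close>

lemma infsum_dominated_convergence:
  fixes f :: "'b \<Rightarrow> 'i \<Rightarrow> 'c :: banach"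
  assumes le: "\<And>i y. i \<in> I \<Longrightarrow> y \<in> Y \<Longrightarrow> norm (f y i) \<le> M i"
    and M: "M summable_on I"
    and lim: "\<And>i. i \<in> I \<Longrightarrow> ((\<lambda>y. f y i) \<longlongrightarrow> l i) F"
    and Y: "eventually (\<lambda>y. y \<in> Y) F" and F: "F \<noteq> bot"
  shows "((\<lambda>y. infsum (f y) I) \<longlongrightarrow> infsum l I) F"
proof -
  have u: "uniform_limit Y (\<lambda>X y. \<Sum>i\<in>X. f y i) (\<lambda>y. \<Sum>\<^sub>\<infinity>i\<in>I. f y i) (finite_subsets_at_top I)"
    by (rule Weierstrass_m_test_general[OF le M]) 
  have lM: "norm (l i) \<le> M i" if "i \<in> I" for i
    by (rule tendsto_upperbound[OF tendsto_norm[OF lim[OF that]] eventually_mono[OF Y] F])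
       (use le that in auto)
  have sl: "l summable_on I"
    by (rule abs_summable_summable, rule summable_on_comparison_test[OF M lM]) auto
  show ?thesis
  proof (rule swap_uniform_limit'[where S = Y and F = "finite_subsets_at_top I" and f = "\<lambda>X. \<lambda>y. \<Sum>i\<in>X. f y i" and g = "\<lambda>X. sum l X"])
    show "\<forall>\<^sub>F X in finite_subsets_at_top I. ((\<lambda>y. \<Sum>i\<in>X. f y i) \<longlongrightarrow> sum l X) F"
      unfolding eventually_finite_subsets_at_top
      by (intro exI[of _ "{}"]) (auto intro!: tendsto_sum lim)
    show "(sum l \<longlongrightarrow> infsum l I) (finite_subsets_at_top I)"
      using has_sum_infsum[OF sl] by (simp add: has_sum_def)
    show "uniform_limit Y (\<lambda>X y. \<Sum>i\<in>X. f y i) (\<lambda>y. infsum (f y) I) (finite_subsets_at_top I)"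
      using u by simp
    show "eventually (\<lambda>y. y \<in> Y) F" by fact
  qed auto
qed

text \<open>The terms are dominated on a whole disc, which gives uniform convergence and thus
  differentiability of the sum. The derivatives need a majorant only at the centre, where it
  identifies the limit of their finite sums with the unordered sum.\<close>

lemma has_field_derivative_infsum_dominated:
  fixes f f' :: "'i \<Rightarrow> complex \<Rightarrow> complex"
  assumes der: "\<And>i w. i \<in> I \<Longrightarrow> w \<in> cball z r \<Longrightarrow> (f i has_field_derivative f' i w) (at w)"
    and le: "\<And>i w. i \<in> I \<Longrightarrow> w \<in> cball z r \<Longrightarrow> norm (f i w) \<le> M i"
    and le': "\<And>i. i \<in> I \<Longrightarrow> norm (f' i z) \<le> M' i"
    and M: "M summable_on I" "M' summable_on I" and r: "r > 0"
  shows "((\<lambda>w. \<Sum>\<^sub>\<infinity>i\<in>I. f i w) has_field_derivative (\<Sum>\<^sub>\<infinity>i\<in>I. f' i z)) (at z)"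
proof -
  let ?F = "finite_subsets_at_top I"
  have u: "uniform_limit (cball z r) (\<lambda>X w. \<Sum>i\<in>X. f i w) (\<lambda>w. \<Sum>\<^sub>\<infinity>i\<in>I. f i w) ?F"
    by (rule Weierstrass_m_test_general[OF le M(1)])
  obtain g' where g': "\<And>w. w \<in> ball z r \<Longrightarrow> ((\<lambda>w. \<Sum>\<^sub>\<infinity>i\<in>I. f i w) has_field_derivative (g' w)) (at w) \<and>
      ((\<lambda>X. \<Sum>i\<in>X. f' i w) \<longlongrightarrow> g' w) ?F"
  proof (rule has_complex_derivative_uniform_limit[OF _ u _ r, of "\<lambda>X w. \<Sum>i\<in>X. f' i w"])
    show "\<forall>\<^sub>F X in ?F. continuous_on (cball z r) (\<lambda>w. \<Sum>i\<in>X. f i w) \<and>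
         (\<forall>w\<in>ball z r. ((\<lambda>w. \<Sum>i\<in>X. f i w) has_field_derivative (\<Sum>i\<in>X. f' i w)) (at w))"
      unfolding eventually_finite_subsets_at_top
    proof (rule exI[of _ "{}"], intro conjI allI impI)
      fix X assume X: "finite X \<and> {} \<subseteq> X \<and> X \<subseteq> I"
      have d: "((\<lambda>w. \<Sum>i\<in>X. f i w) has_field_derivative (\<Sum>i\<in>X. f' i w)) (at w)" if "w \<in> cball z r" for w
        using X that by (intro DERIV_sum der) auto
      show "continuous_on (cball z r) (\<lambda>w. \<Sum>i\<in>X. f i w)"
        by (rule DERIV_continuous_on, rule has_field_derivative_at_within, erule d)
      show "\<forall>w\<in>ball z r. ((\<lambda>w. \<Sum>i\<in>X. f i w) has_field_derivative (\<Sum>i\<in>X. f' i w)) (at w)"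
        using d by simp
    qed simp_all
  qed (auto)
  have "(\<lambda>i. f' i z) summable_on I"
    by (rule abs_summable_summable, rule summable_on_comparison_test[OF M(2) le']) auto
  from has_sum_infsum[OF this] have "((\<lambda>X. \<Sum>i\<in>X. f' i z) \<longlongrightarrow> (\<Sum>\<^sub>\<infinity>i\<in>I. f' i z)) ?F"
    by (simp add: has_sum_def)
  with g'[of z] r have "g' z = (\<Sum>\<^sub>\<infinity>i\<in>I. f' i z)"
    by (intro tendsto_unique[of ?F]) auto
  then show ?thesis using g'[of z] r by simp
qed

subsection \<open>Schwartz functions and Gaussians\<close>

text \<open>Since \<open>vderiv\<close> is iterated, explicit formulas for all derivatives would be
  needed; a class closed under differentiation, all of whose members decay rapidly, replaces
  them.\<close>

lemma schwartz_of_derivative_closed: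
  assumes der: "\<And>\<phi>. \<phi> \<in> P \<Longrightarrow> \<exists>\<psi>\<in>P. \<forall>t. (\<phi> has_vector_derivative \<psi> t) (at t)"
    and bdd: "\<And>\<phi> k. \<phi> \<in> P \<Longrightarrow> bounded (range (\<lambda>t. \<bar>t\<bar> ^ k * norm (\<phi> t)))"
    and "\<phi> \<in> P"
  shows "schwartz \<phi>"
proof -
  have "vderiv m \<phi> \<in> P" for m
  proof (induction m)
    case (Suc m)
    then obtain \<psi> where \<psi>: "\<psi> \<in> P" "\<And>t. (vderiv m \<phi> has_vector_derivative \<psi> t) (at t)"
      using der by blast
    then have "vderiv (Suc m) \<phi> = \<psi>"
      by (auto intro!: ext vector_derivative_at)
    then show ?case using \<psi> by simp
  qed (simp add: assms(3))
  moreover have "\<psi> differentiable (at t)" if "\<psi> \<in> P" for \<psi> t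
    using der[OF that] differentiableI_vector by blast
  ultimately show ?thesis unfolding schwartz_def using bdd by blast
qed

lemma bounded_range_mult_le:
  fixes f :: "real \<Rightarrow> complex"
  assumes "\<And>t. \<bar>t\<bar> ^ k * norm (f t) \<le> C"
  shows "bounded (range (\<lambda>t. \<bar>t\<bar> ^ k * norm (f t)))"
  using assms by (intro boundedI[where B = C]) (auto simp: abs_mult)

lemma power_le_fact_exp:
  fixes x :: real
  assumes "x \<ge> 0"
  shows "x ^ n \<le> fact n * exp x"
proof -
  have "(\<Sum>k\<in>{n}. x ^ k /\<^sub>R fact k) \<le> (\<Sum>k. x ^ k /\<^sub>R fact k)"
    by (rule sum_le_suminf[OF summable_exp_generic]) (use assms in auto)
  then have "x ^ n / fact n \<le> exp x"
    by (simp add: exp_def divide_inverse_commute)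
  then show ?thesis by (simp add: field_simps)
qed

text \<open>The complex linear term puts several functions into one family: a purely imaginary
  \<open>\<kappa>\<close> is a modulation, a real one a translation up to a constant factor.\<close>

definition gaussian :: "real \<Rightarrow> complex \<Rightarrow> real \<Rightarrow> complex" where
  "gaussian q \<kappa> t = exp (- of_real (q * t\<^sup>2) + \<kappa> * of_real t)"

lemma norm_gaussian: "norm (gaussian q \<kappa> t) = exp (- q * t\<^sup>2 + Re \<kappa> * t)"
  by (simp add: gaussian_def norm_exp_eq_Re)

lemma gaussian_decay:
  assumes "q > 0"
  shows "\<bar>t\<bar> ^ k * norm (gaussian q \<kappa> t) \<le> fact k * exp ((1 + \<bar>Re \<kappa>\<bar>)\<^sup>2 / (4 * q))"
proof -
  define c where "c = 1 + \<bar>Re \<kappa>\<bar>"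
  have "\<bar>t\<bar> ^ k * norm (gaussian q \<kappa> t) \<le> (fact k * exp \<bar>t\<bar>) * exp (- q * t\<^sup>2 + \<bar>Re \<kappa>\<bar> * \<bar>t\<bar>)"
    unfolding norm_gaussian
    by (intro mult_mono power_le_fact_exp) (auto simp flip: abs_mult)
  also have "\<dots> = fact k * exp (- q * t\<^sup>2 + c * \<bar>t\<bar>)"
    by (simp add: c_def algebra_simps flip: exp_add)
  also have "\<dots> \<le> fact k * exp (c\<^sup>2 / (4 * q))"
  proof -
    have "0 \<le> (2 * q * \<bar>t\<bar> - c)\<^sup>2 / (4 * q)" using assms by simp
    also have "\<dots> = c\<^sup>2 / (4 * q) - (- q * t\<^sup>2 + c * \<bar>t\<bar>)"
      using assms by (simp add: field_simps power2_eq_square)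
    finally show ?thesis by simp
  qed
  finally show ?thesis by (simp add: c_def)
qed

text \<open>Multiplication by \<open>t\<close> moves one power into the weight, so the induction on
  \<open>p\<close> has to hold for all \<open>k\<close> at once.\<close>

lemma poly_gaussian_bounded:
  assumes "q > 0"
  shows "bounded (range (\<lambda>t. \<bar>t\<bar> ^ k * norm (poly p (of_real t) * gaussian q \<kappa> t)))"
proof -
  have "\<exists>C. \<forall>t. \<bar>t\<bar> ^ k * norm (poly p (of_real t) * gaussian q \<kappa> t) \<le> C"
  proof (induction p arbitrary: k)
    case 0
    then show ?case by (intro exI[of _ 0]) simp
  next
    case (pCons a p)
    obtain C where C: "\<And>t. \<bar>t\<bar> ^ Suc k * norm (poly p (of_real t) * gaussian q \<kappa> t) \<le> C"
      using pCons.IH by blast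
    show ?case
    proof (intro exI allI)
      fix t :: real
      have "norm (poly (pCons a p) (of_real t) * gaussian q \<kappa> t)
          \<le> norm a * norm (gaussian q \<kappa> t) + \<bar>t\<bar> * norm (poly p (of_real t) * gaussian q \<kappa> t)"
        using norm_triangle_ineq[of "a * gaussian q \<kappa> t" "of_real t * poly p (of_real t) * gaussian q \<kappa> t"]
        by (simp add: algebra_simps norm_mult)
      then have "\<bar>t\<bar> ^ k * norm (poly (pCons a p) (of_real t) * gaussian q \<kappa> t)
          \<le> \<bar>t\<bar> ^ k * (norm a * norm (gaussian q \<kappa> t) + \<bar>t\<bar> * norm (poly p (of_real t) * gaussian q \<kappa> t))"
        by (intro mult_left_mono) auto
      also have "\<dots> = norm a * (\<bar>t\<bar> ^ k * norm (gaussian q \<kappa> t)) + \<bar>t\<bar> ^ Suc k * norm (poly p (of_real t) * gaussian q \<kappa> t)"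
        by (simp add: algebra_simps)
      also have "\<dots> \<le> norm a * (fact k * exp ((1 + \<bar>Re \<kappa>\<bar>)\<^sup>2 / (4 * q))) + C"
        by (intro add_mono C mult_left_mono gaussian_decay assms) auto
      finally show "\<bar>t\<bar> ^ k * norm (poly (pCons a p) (of_real t) * gaussian q \<kappa> t)
          \<le> norm a * (fact k * exp ((1 + \<bar>Re \<kappa>\<bar>)\<^sup>2 / (4 * q))) + C" .
    qed
  qed
  then obtain C where "\<And>t. \<bar>t\<bar> ^ k * norm (poly p (of_real t) * gaussian q \<kappa> t) \<le> C" by blast
  then show ?thesis by (rule bounded_range_mult_le)
qed

lemma poly_gaussian_has_vector_derivative:
  "((\<lambda>t. poly p (of_real t) * gaussian q \<kappa> t) has_vector_derivative
     poly (pderiv p + p * [:\<kappa>, - 2 * of_real q:]) (of_real t) * gaussian q \<kappa> t) (at t)"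
proof -
  have "((\<lambda>z. poly p z * exp (- of_real q * z\<^sup>2 + \<kappa> * z)) has_field_derivative
     poly (pderiv p + p * [:\<kappa>, - 2 * of_real q:]) z * exp (- of_real q * z\<^sup>2 + \<kappa> * z)) (at z)" for z
    by (auto intro!: derivative_eq_intros poly_DERIV simp: algebra_simps)
  from has_vector_derivative_real_field[OF this[of "of_real t"]]
  show ?thesis by (simp add: gaussian_def o_def)
qed

lemma schwartz_poly_gaussian:
  assumes "q > 0"
  shows "schwartz (\<lambda>t. poly p (of_real t) * gaussian q \<kappa> t)"
proof (rule schwartz_of_derivative_closed[where P = "range (\<lambda>p t. poly p (of_real t) * gaussian q \<kappa> t)"])
  fix \<phi> k assume "\<phi> \<in> range (\<lambda>p t. poly p (complex_of_real t) * gaussian q \<kappa> t)"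
  then obtain p where \<phi>: "\<phi> = (\<lambda>t. poly p (of_real t) * gaussian q \<kappa> t)" by auto
  show "\<exists>\<psi>\<in>range (\<lambda>p t. poly p (of_real t) * gaussian q \<kappa> t). \<forall>t. (\<phi> has_vector_derivative \<psi> t) (at t)"
    unfolding \<phi>
    by (intro bexI[OF _ rangeI[of _ "pderiv p + p * [:\<kappa>, - 2 * of_real q:]"]] allI
        poly_gaussian_has_vector_derivative)
  show "bounded (range (\<lambda>t. \<bar>t\<bar> ^ k * norm (\<phi> t)))"
    unfolding \<phi> by (rule poly_gaussian_bounded[OF assms])
qed (rule rangeI)

lemma schwartz_gaussian:
  assumes "q > 0"
  shows "schwartz (gaussian q \<kappa>)"
proof -
  have "(\<lambda>t. poly [:1:] (of_real t) * gaussian q \<kappa> t) = gaussian q \<kappa>"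
    by (rule ext) simp
  then show ?thesis using schwartz_poly_gaussian[OF assms, of "[:1:]" \<kappa>] by (simp only:)
qed

section \<open>Integrability and Fourier transforms of Schwartz functions\<close>

lemma integrable_inverse_1_plus_square_UNIV: "integrable lborel (\<lambda>x::real. inverse (1 + x\<^sup>2))"
  using integrable_inverse_1_plus_square unfolding set_integrable_def einterval_eq_UNIV indicator_UNIV by simp

lemma schwartz_imp_continuous:
  assumes "schwartz \<phi>"
  shows "continuous_on UNIV \<phi>"
proof (rule continuous_at_imp_continuous_on, rule ballI)
  fix t
  have "vderiv 0 \<phi> differentiable (at t)" using assms unfolding schwartz_def by blast
  then show "isCont \<phi> t" by (simp add: differentiable_imp_continuous_within)
qed

lemma schwartz_decay_2:
  assumes "schwartz \<phi>"
  obtains C where "\<And>t. norm (\<phi> t) \<le> C * inverse (1 + t\<^sup>2)"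
proof -
  have "bounded (range (\<lambda>t. \<bar>t\<bar> ^ k * norm (\<phi> t)))" for k
    using assms[unfolded schwartz_def, THEN conjunct2, rule_format, of k 0] by simp
  from this[of 0] this[of 2] obtain C1 C2 where
    C: "\<And>t. norm (\<phi> t) \<le> C1" "\<And>t. t\<^sup>2 * norm (\<phi> t) \<le> C2"
    unfolding bounded_iff by fastforce
  have "norm (\<phi> t) \<le> (C1 + C2) * inverse (1 + t\<^sup>2)" for t
  proof -
    have "norm (\<phi> t) * (1 + t\<^sup>2) \<le> C1 + C2"
      using add_mono[OF C[of t]] by (simp add: algebra_simps)
    moreover have "1 + t\<^sup>2 > 0" by (simp add: add_pos_nonneg)
    ultimately show ?thesis by (simp add: field_simps)
  qed
  then show ?thesis using that by blast
qed

lemma schwartz_imp_integrable: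
  assumes "schwartz \<phi>"
  shows "integrable lborel \<phi>"
proof -
  obtain C where C: "\<And>t. norm (\<phi> t) \<le> C * inverse (1 + t\<^sup>2)"
    using schwartz_decay_2[OF assms] by blast
  have "\<phi> \<in> borel_measurable borel"
    by (rule borel_measurable_continuous_onI[OF schwartz_imp_continuous[OF assms]])
  then show ?thesis
    by (intro Bochner_Integration.integrable_bound[OF integrable_mult_right[OF integrable_inverse_1_plus_square_UNIV, of C]])
       (auto intro!: AE_I2 order.trans[OF C])
qed

lemma schwartz_vderiv: "schwartz \<phi> \<Longrightarrow> schwartz (vderiv m \<phi>)"
proof -
  assume s: "schwartz \<phi>"
  have "vderiv k (vderiv m \<phi>) = vderiv (k + m) \<phi>" for k by (induction k) auto
  then show ?thesis using s unfolding schwartz_def by simp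
qed

lemma schwartz_tendsto_0:
  assumes "schwartz \<phi>"
  shows "(\<phi> \<longlongrightarrow> 0) at_top" "(\<phi> \<longlongrightarrow> 0) at_bot"
proof -
  obtain C where C: "\<And>t. norm (\<phi> t) \<le> C * inverse (1 + t\<^sup>2)"
    using schwartz_decay_2[OF assms] by blast
  show "(\<phi> \<longlongrightarrow> 0) at_top"
  proof (rule Lim_null_comparison[OF always_eventually[OF allI[OF C]]])
    show "((\<lambda>t. C * inverse (1 + t\<^sup>2)) \<longlongrightarrow> 0) at_top" by real_asymp
  qed
  show "(\<phi> \<longlongrightarrow> 0) at_bot"
  proof (rule Lim_null_comparison[OF always_eventually[OF allI[OF C]]])
    show "((\<lambda>t. C * inverse (1 + t\<^sup>2)) \<longlongrightarrow> 0) at_bot" by real_asymp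
  qed
qed

lemma integrable_mult_unimodular:
  fixes f g :: "real \<Rightarrow> complex"
  assumes "integrable lborel f" "g \<in> borel_measurable borel" "\<And>t. norm (g t) \<le> 1"
  shows "integrable lborel (\<lambda>t. f t * g t)"
  using assms
  by (intro Bochner_Integration.integrable_bound[OF assms(1)])
     (auto simp: norm_mult intro!: AE_I2 mult_left_le)

lemma fourier_kernel_norm: "norm (exp (- (2 * pi * \<i>) * complex_of_real u)) = 1"
  by (simp add: norm_exp_eq_Re)

text \<open>Integration by parts: the derivative of \<open>\<phi> * e\<close> is integrable and
  \<open>\<phi> * e\<close> vanishes at both ends, so this derivative has integral 0 over the line.
  The derivative of \<open>\<phi>\<close> enters as a separate \<open>\<psi>\<close>, so that a
  differential equation for \<open>\<phi>\<close> can be inserted directly.\<close>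

lemma fourier_has_vector_derivative:
  assumes "schwartz \<phi>" and der: "\<And>t. (\<phi> has_vector_derivative \<psi> t) (at t)"
  shows "fourier \<psi> \<xi> = 2 * pi * \<i> * of_real \<xi> * fourier \<phi> \<xi>"
proof -
  define e where "e t = exp (- (2 * pi * \<i>) * complex_of_real (\<xi> * t))" for t
  have e': "(e has_vector_derivative (- (2 * pi * \<i>) * of_real \<xi>) * e t) (at t)" for t
  proof -
    have "((\<lambda>z. exp (- (2 * pi * \<i>) * of_real \<xi> * z)) has_field_derivative
       (- (2 * pi * \<i>) * of_real \<xi>) * exp (- (2 * pi * \<i>) * of_real \<xi> * z)) (at z)" for z
      by (auto intro!: derivative_eq_intros)
    from has_vector_derivative_real_field[OF this[of "of_real t"]]
    show ?thesis by (simp add: e_def[abs_def] o_def mult_ac)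
  qed
  have ne: "norm (e t) = 1" for t unfolding e_def by (rule fourier_kernel_norm)
  have ce: "continuous_on UNIV e"
    unfolding e_def by (intro continuous_intros)
  have me: "e \<in> borel_measurable borel" by (rule borel_measurable_continuous_onI[OF ce])
  have \<psi>: "\<psi> = vderiv 1 \<phi>" using der by (auto intro!: ext vector_derivative_at[symmetric])
  have s\<psi>: "schwartz \<psi>" unfolding \<psi> by (rule schwartz_vderiv) fact
  have i: "integrable lborel (\<lambda>t. \<phi> t * e t)" "integrable lborel (\<lambda>t. \<psi> t * e t)"
    by (rule integrable_mult_unimodular[OF schwartz_imp_integrable me]; simp add: ne assms s\<psi>)+
  define W where "W t = \<psi> t * e t - (2 * pi * \<i> * of_real \<xi>) * (\<phi> t * e t)" for t
  have iW: "integrable lborel W" unfolding W_def by (intro Bochner_Integration.integrable_diff integrable_mult_right i)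
  have "(LBINT t=-\<infinity>..\<infinity>. W t) = 0 - 0"
  proof (rule interval_integral_FTC_integrable)
    show "((\<lambda>t. \<phi> t * e t) has_vector_derivative W x) (at x)" for x
      unfolding W_def by (auto intro!: derivative_eq_intros der e' simp: algebra_simps)
    show "isCont W x" for x
      using ce schwartz_imp_continuous[OF assms(1)] schwartz_imp_continuous[OF s\<psi>]
      unfolding W_def by (intro continuous_intros) (auto simp: continuous_on_eq_continuous_at)
    show "set_integrable lborel (einterval (- \<infinity>) \<infinity>) W"
      using iW by (simp add: set_integrable_def einterval_def)
    have lim: "((\<lambda>t. \<phi> t * e t) \<longlongrightarrow> 0) F" if "(\<phi> \<longlongrightarrow> 0) F" for F
    proof (rule tendsto_norm_zero_cancel)
      show "((\<lambda>t. norm (\<phi> t * e t)) \<longlongrightarrow> 0) F"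
        using tendsto_norm_zero[OF that] by (simp add: norm_mult ne)
    qed
    show "(((\<lambda>t. \<phi> t * e t) \<circ> real_of_ereal) \<longlongrightarrow> 0) (at_right (- \<infinity>))"
      using lim[OF schwartz_tendsto_0(2)[OF assms(1)]] by (simp add: ereal_tendsto_simps1)
    show "(((\<lambda>t. \<phi> t * e t) \<circ> real_of_ereal) \<longlongrightarrow> 0) (at_left \<infinity>)"
      using lim[OF schwartz_tendsto_0(1)[OF assms(1)]] by (simp add: ereal_tendsto_simps1)
  qed simp_all
  then have "(LINT t|lborel. W t) = 0"
    by (simp add: interval_lebesgue_integral_def set_lebesgue_integral_def einterval_def)
  then have "(LINT t|lborel. \<psi> t * e t) = (2 * pi * \<i> * of_real \<xi>) * (LINT t|lborel. \<phi> t * e t)"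
    unfolding W_def using i
    by (subst (asm) Bochner_Integration.integral_diff) auto
  then show ?thesis unfolding fourier_def e_def .
qed

text \<open>The characteristic function of the standard normal distribution, rescaled: the
  substitution by \<open>s = sqrt (2 * pi)\<close> turns the density with variance 1 into the
  Gaussian that is its own Fourier transform.\<close>

lemma fourier_gaussian_pi:
  "(LINT t|lborel. exp (- of_real (pi * t\<^sup>2)) * exp (- (2 * pi * \<i>) * complex_of_real (\<xi> * t))) = of_real (exp (- (pi * \<xi>\<^sup>2)))"
proof -
  define s where "s = sqrt (2 * pi)"
  have s: "s > 0" "s\<^sup>2 = 2 * pi" by (auto simp: s_def)
  have "of_real (exp (- ((s * \<xi>)\<^sup>2 / 2))) = char std_normal_distribution (- s * \<xi>)"
    by (simp add: char_std_normal_distribution)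
  also have "\<dots> = (LINT x|lborel. std_normal_density x *\<^sub>R iexp (- s * \<xi> * x))"
    unfolding char_def by (subst integral_density) (auto simp: normal_density_nonneg)
  also have "\<dots> = s *\<^sub>R (LINT x|lborel. std_normal_density (0 + s * x) *\<^sub>R iexp (- s * \<xi> * (0 + s * x)))"
    using s(1) by (subst lborel_integral_real_affine[of s _ 0]) auto
  also have "\<dots> = (LINT x|lborel. s *\<^sub>R (std_normal_density (0 + s * x) *\<^sub>R iexp (- s * \<xi> * (0 + s * x))))"
    by (rule integral_scaleR_right[symmetric])
  also have "\<dots> = (LINT t|lborel. exp (- of_real (pi * t\<^sup>2)) * exp (- (2 * pi * \<i>) * complex_of_real (\<xi> * t)))"
  proof (rule Bochner_Integration.integral_cong[OF refl])
    fix t :: real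
    have "s * std_normal_density (s * t) = exp (- (pi * t\<^sup>2))"
      using s(1) by (simp add: std_normal_density_def power_mult_distrib s(2) flip: s_def)
    moreover have "iexp (- s * \<xi> * (s * t)) = exp (- (2 * pi * \<i>) * complex_of_real (\<xi> * t))"
      using s(2) by (intro arg_cong[where f = exp]) (simp add: algebra_simps power2_eq_square flip: of_real_mult)
    ultimately show "s *\<^sub>R (std_normal_density (0 + s * t) *\<^sub>R iexp (- s * \<xi> * (0 + s * t)))
        = exp (- of_real (pi * t\<^sup>2)) * exp (- (2 * pi * \<i>) * complex_of_real (\<xi> * t))"
      by (simp add: scaleR_conv_of_real exp_of_real flip: of_real_minus of_real_mult mult.assoc)
  qed
  finally show ?thesis by (simp add: power_mult_distrib s(2))
qed

text \<open>Modulation becomes translation, which gives a bump at any real \<open>x\<close> whose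
  preimage has absolute value independent of \<open>x\<close>.\<close>

lemma fourier_gaussian_modulated:
  "fourier (gaussian pi (2 * pi * \<i> * of_real x)) \<xi> = of_real (exp (- (pi * (\<xi> - x)\<^sup>2)))"
proof -
  have "fourier (gaussian pi (2 * pi * \<i> * of_real x)) \<xi>
      = (LINT t|lborel. exp (- of_real (pi * t\<^sup>2)) * exp (- (2 * pi * \<i>) * complex_of_real ((\<xi> - x) * t)))"
    unfolding fourier_def gaussian_def mult_exp_exp
    by (intro Bochner_Integration.integral_cong refl arg_cong[where f = exp]) (simp add: algebra_simps)
  then show ?thesis using fourier_gaussian_pi[of "\<xi> - x"] by simp
qed

lemma fourier_gaussian_scaled:
  assumes "r > 0"
  shows "fourier (gaussian (pi / r\<^sup>2) 0) \<xi> = of_real (r * exp (- (pi * (r * \<xi>)\<^sup>2)))"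
proof -
  have "fourier (gaussian (pi / r\<^sup>2) 0) \<xi> = r *\<^sub>R (LINT t|lborel. gaussian (pi / r\<^sup>2) 0 (0 + r * t) * exp (- (2 * pi * \<i>) * complex_of_real (\<xi> * (0 + r * t))))"
    unfolding fourier_def using assms by (subst lborel_integral_real_affine[of r _ 0]) auto
  also have "(LINT t|lborel. gaussian (pi / r\<^sup>2) 0 (0 + r * t) * exp (- (2 * pi * \<i>) * complex_of_real (\<xi> * (0 + r * t))))
     = (LINT t|lborel. exp (- of_real (pi * t\<^sup>2)) * exp (- (2 * pi * \<i>) * complex_of_real (r * \<xi> * t)))"
    using assms by (intro Bochner_Integration.integral_cong refl) (simp add: gaussian_def power_mult_distrib mult_ac)
   also have "\<dots> = of_real (exp (- (pi * (r * \<xi>)\<^sup>2)))" by (rule fourier_gaussian_pi)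
  finally show ?thesis by (simp add: scaleR_conv_of_real)
qed

subsection \<open>Mollified one-sided exponentials\<close>

lemma half_line_integral_has_vector_derivative:
  fixes g :: "real \<Rightarrow> complex"
  assumes "continuous_on UNIV g" and int: "integrable lborel g"
  shows "((\<lambda>s. LINT v|lborel. indicator {..<s} v *\<^sub>R g v) has_vector_derivative g s) (at s)"
proof -
  have eq: "(LINT v|lborel. indicator {..<u} v *\<^sub>R g v) = (LBINT v=-\<infinity>..s-1. g v) + (LBINT v=s-1..u. g v)" for u :: real
  proof -
    have "(LBINT v=-\<infinity>..s-1. g v) + (LBINT v=s-1..u. g v) = (LBINT v=-\<infinity>..u. g v)"
    proof (rule interval_integral_sum)
      show "interval_lebesgue_integrable lborel (min (- \<infinity>) (min (ereal (s - 1)) (ereal u)))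
              (max (- \<infinity>) (max (ereal (s - 1)) (ereal u))) g"
        using integrable_mult_indicator[OF _ int]
        by (auto simp: interval_lebesgue_integrable_def set_integrable_def max_def)
    qed
    then show ?thesis by (simp add: interval_lebesgue_integral_def set_lebesgue_integral_def)
  qed
  have "((\<lambda>u. LBINT v=s-1..u. g v) has_vector_derivative g s) (at s within {s-1..s+1})"
    by (rule interval_integral_FTC2) (use assms in \<open>auto intro: continuous_on_subset\<close>)
  then have "((\<lambda>u. LBINT v=s-1..u. g v) has_vector_derivative g s) (at s)"
    by (subst (asm) at_within_Icc_at) auto
  then show ?thesis unfolding eq
    using has_vector_derivative_add[OF has_vector_derivative_const[of "LBINT v=-\<infinity>..s-1. g v"]] by force
qed

lemma gaussian_integrable: "q > 0 \<Longrightarrow> integrable lborel (gaussian q \<kappa>)"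
  by (intro schwartz_imp_integrable schwartz_gaussian)

lemma gaussian_continuous: "continuous_on A (gaussian q \<kappa>)"
  unfolding gaussian_def by (intro continuous_intros)

lemma gaussian_measurable [measurable]: "gaussian q \<kappa> \<in> borel_measurable borel"
  by (rule borel_measurable_continuous_onI[OF gaussian_continuous])

text \<open>The convolution of the one-sided exponential \<open>t \<mapsto> exp (2 \<pi> i z t)\<close> on \<open>t > 0\<close> with the
  Gaussian \<open>exp (- \<pi> (t/r)\<^sup>2) / r\<close>, written as a half-line integral.\<close>

definition smooth_exp :: "real \<Rightarrow> complex \<Rightarrow> real \<Rightarrow> complex" where
  "smooth_exp r z t = (LINT v|lborel. indicator {..<t / r} v *\<^sub>R gaussian pi (- (2 * pi * \<i> * z * of_real r)) v)
      * exp (2 * pi * \<i> * z * of_real t)"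

text \<open>A first order linear equation with a Gaussian source. It serves twice: iterated, it
  controls all derivatives; transformed, it yields the Fourier transform.\<close>

lemma smooth_exp_has_vector_derivative:
  assumes "r > 0"
  shows "(smooth_exp r z has_vector_derivative
     2 * pi * \<i> * z * smooth_exp r z t + of_real (1 / r) * gaussian (pi / r\<^sup>2) 0 t) (at t)"
proof -
  define \<kappa> where "\<kappa> = - (2 * pi * \<i> * z * of_real r)"
  define Q where "Q s = (LINT v|lborel. indicator {..<s} v *\<^sub>R gaussian pi \<kappa> v)" for s :: real
  have "(Q has_vector_derivative gaussian pi \<kappa> (t / r)) (at (t / r))"
    unfolding Q_def by (rule half_line_integral_has_vector_derivative[OF gaussian_continuous gaussian_integrable]) simp
  moreover have "((\<lambda>t. t / r) has_vector_derivative 1 / r) (at t)"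
    using assms by (auto intro!: derivative_eq_intros simp flip: has_real_derivative_iff_has_vector_derivative)
  ultimately have dQ: "((\<lambda>t. Q (t / r)) has_vector_derivative (1 / r) *\<^sub>R gaussian pi \<kappa> (t / r)) (at t)"
    using vector_diff_chain_at[of "\<lambda>t. t / r" "1 / r" t Q] by (simp add: o_def)
  have "((\<lambda>w. exp (2 * pi * \<i> * z * w)) has_field_derivative (2 * pi * \<i> * z) * exp (2 * pi * \<i> * z * w)) (at w)" for w
    by (auto intro!: derivative_eq_intros)
  from has_vector_derivative_real_field[OF this[of "of_real t"]]
  have dE: "((\<lambda>t. exp (2 * pi * \<i> * z * of_real t)) has_vector_derivative
      (2 * pi * \<i> * z) * exp (2 * pi * \<i> * z * of_real t)) (at t)"
    by (simp add: o_def)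
  \<comment> \<open>At the moving end point \<open>t / r\<close> the tilt of the Gaussian and the
    outer exponential cancel, so that \<open>z\<close> disappears from the source term.\<close>
  have "gaussian pi \<kappa> (t / r) * exp (2 * pi * \<i> * z * of_real t) = gaussian (pi / r\<^sup>2) 0 t"
    unfolding gaussian_def mult_exp_exp \<kappa>_def using assms
    by (intro arg_cong[where f = exp]) (simp add: field_simps power2_eq_square)
  then have eq: "(1 / r) *\<^sub>R gaussian pi \<kappa> (t / r) * exp (2 * pi * \<i> * z * of_real t) = of_real (1 / r) * gaussian (pi / r\<^sup>2) 0 t"
    by (simp add: scaleR_conv_of_real)
  have "((\<lambda>t. Q (t / r) * exp (2 * pi * \<i> * z * of_real t)) has_vector_derivative
     Q (t / r) * ((2 * pi * \<i> * z) * exp (2 * pi * \<i> * z * of_real t)) + (1 / r) *\<^sub>R gaussian pi \<kappa> (t / r) * exp (2 * pi * \<i> * z * of_real t)) (at t)"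
    by (rule has_vector_derivative_mult[OF dQ dE])
  then show ?thesis
    unfolding eq by (simp add: smooth_exp_def[abs_def] Q_def \<kappa>_def mult_ac)
qed

text \<open>A majorant, up to a constant, of the mollified exponentials that does not depend on
  \<open>r\<close>. On the negative axis the mollifier leaks a Gaussian tail; the exponent is halved
  there because the other half is spent on the integral over \<open>v\<close>.\<close>

definition one_sided_decay :: "real \<Rightarrow> real \<Rightarrow> real" where
  "one_sided_decay y t = (if t \<ge> 0 then exp (- 2 * pi * y * t) else exp (- (pi / 2) * t\<^sup>2))"

text \<open>Total mass of a majorant for the integrands behind \<open>smooth_exp\<close>: the first
  two Gaussians serve \<open>t \<ge> 0\<close>, the third is what remains for
  \<open>t < 0\<close>.\<close>

definition smooth_exp_const :: "real \<Rightarrow> real" where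
  "smooth_exp_const y = (LINT v|lborel. norm (gaussian pi (of_real (2 * pi * y)) v)
      + norm (gaussian pi (of_real (- 2 * pi * y)) v) + norm (gaussian (pi / 2) 0 v))"

lemma norm_gaussian_shift_le:
  assumes "0 < r" "r \<le> 1" "Im z > 0"
  shows "norm (gaussian pi (- (2 * pi * \<i> * z * of_real r)) v)
     \<le> norm (gaussian pi (of_real (2 * pi * Im z)) v) + norm (gaussian pi (of_real (- 2 * pi * Im z)) v)"
proof -
  have "norm (gaussian pi (- (2 * pi * \<i> * z * of_real r)) v) = exp (- pi * v\<^sup>2 + 2 * pi * Im z * (r * v))"
    by (simp add: norm_gaussian mult_ac)
  also have "\<dots> \<le> exp (- pi * v\<^sup>2 + 2 * pi * Im z * \<bar>v\<bar>)"
  proof -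
    have "r * v \<le> \<bar>r * v\<bar>" by simp
    also have "\<dots> \<le> \<bar>v\<bar>" using assms by (simp add: abs_mult mult_left_le_one_le)
    finally show ?thesis using assms by simp
  qed
  also have "\<dots> \<le> exp (- pi * v\<^sup>2 + 2 * pi * Im z * v) + exp (- pi * v\<^sup>2 - 2 * pi * Im z * v)"
    by (cases "v \<ge> 0") auto
  finally show ?thesis by (simp add: norm_gaussian)
qed

text \<open>For \<open>t \<ge> 0\<close> the outer factor is already the claimed decay. For
  \<open>t < 0\<close> the integration runs over \<open>v < t / r \<le> t\<close>. There
  \<open>r * v - t\<close> is negative, which absorbs the growing factor
  \<open>exp (- 2 * pi * Im z * t)\<close>, and \<open>v\<^sup>2\<close> is at least
  \<open>t\<^sup>2\<close>, which yields the decay in \<open>t\<close>.\<close>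

lemma smooth_exp_bound:
  assumes "0 < r" "r \<le> 1" "Im z > 0"
  shows "norm (smooth_exp r z t) \<le> smooth_exp_const (Im z) * one_sided_decay (Im z) t"
proof -
  define \<kappa> where "\<kappa> = - (2 * pi * \<i> * z * of_real r)"
  define B where "B v = norm (gaussian pi (of_real (2 * pi * Im z)) v)
      + norm (gaussian pi (of_real (- 2 * pi * Im z)) v) + norm (gaussian (pi / 2) 0 v)" for v
  have iB: "integrable lborel B" unfolding B_def
    by (intro Bochner_Integration.integrable_add integrable_norm gaussian_integrable) auto
  have "norm (smooth_exp r z t) = norm (LINT v|lborel. indicator {..<t / r} v *\<^sub>R gaussian pi \<kappa> v * exp (2 * pi * \<i> * z * of_real t))"
    unfolding smooth_exp_def \<kappa>_def by (subst integral_mult_left_zero) simp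
  also have "\<dots> \<le> (LINT v|lborel. norm (indicator {..<t / r} v *\<^sub>R gaussian pi \<kappa> v * exp (2 * pi * \<i> * z * of_real t)))"
    by (rule integral_norm_bound)
  also have "\<dots> \<le> (LINT v|lborel. B v * one_sided_decay (Im z) t)"
  proof (rule integral_mono)
    show "integrable lborel (\<lambda>v. norm (indicator {..<t / r} v *\<^sub>R gaussian pi \<kappa> v * exp (2 * pi * \<i> * z * of_real t)))"
      by (intro integrable_norm integrable_mult_left integrable_mult_indicator gaussian_integrable) auto
    show "integrable lborel (\<lambda>v. B v * one_sided_decay (Im z) t)" by (intro integrable_mult_left iB)
    show "norm (indicator {..<t / r} v *\<^sub>R gaussian pi \<kappa> v * exp (2 * pi * \<i> * z * of_real t)) \<le> B v * one_sided_decay (Im z) t" for v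
    proof (cases "v < t / r")
      case False
      then show ?thesis by (simp add: B_def one_sided_decay_def)
    next
      case True
      then have rv: "r * v < t" using assms by (simp add: field_simps)
      have eq: "norm (indicator {..<t / r} v *\<^sub>R gaussian pi \<kappa> v * exp (2 * pi * \<i> * z * of_real t))
          = norm (gaussian pi \<kappa> v) * exp (- 2 * pi * Im z * t)"
        using True by (simp add: norm_mult norm_exp_eq_Re mult_ac)
      show ?thesis
      proof (cases "t \<ge> 0")
        case True
        have "norm (gaussian pi \<kappa> v) \<le> B v"
          using norm_gaussian_shift_le[OF assms, of v] unfolding B_def \<kappa>_def
          by (smt (verit) norm_ge_zero)
        then show ?thesis unfolding eq one_sided_decay_def using True by simp
      next
        case False
        have "t / r \<le> t" using False assms by (simp add: field_simps mult_le_cancel_left2)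
        then have vt: "v < t" using \<open>v < t / r\<close> by simp
        have "norm (gaussian pi \<kappa> v) * exp (- 2 * pi * Im z * t) = exp (- pi * v\<^sup>2) * exp (- (2 * pi * Im z) * (t - r * v))"
          by (simp add: norm_gaussian \<kappa>_def algebra_simps flip: exp_add)
        also have "\<dots> \<le> exp (- pi * v\<^sup>2) * 1"
          using rv assms by (intro mult_left_mono) (auto simp: mult_nonneg_nonneg)
        also have "\<dots> \<le> exp (- (pi / 2) * v\<^sup>2) * exp (- (pi / 2) * t\<^sup>2)"
        proof -
          have "t\<^sup>2 \<le> v\<^sup>2" using vt False by (simp add: abs_le_square_iff[symmetric])
          then have "pi * t\<^sup>2 \<le> pi * v\<^sup>2" by simp
          then show ?thesis unfolding mult_exp_exp mult_1_right exp_le_cancel_iff by linarith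
        qed
        also have "\<dots> \<le> B v * exp (- (pi / 2) * t\<^sup>2)"
          by (intro mult_right_mono) (auto simp: B_def norm_gaussian)
        finally show ?thesis unfolding eq one_sided_decay_def using False by simp
      qed
    qed
  qed
  also have "\<dots> = smooth_exp_const (Im z) * one_sided_decay (Im z) t"
    by (simp add: smooth_exp_const_def B_def)
  finally show ?thesis .
qed

lemma one_sided_decay_power:
  assumes "y > 0"
  shows "\<bar>t\<bar> ^ k * one_sided_decay y t \<le> fact k / (2 * pi * y) ^ k + fact k * exp (1 / (2 * pi))"
proof (cases "t \<ge> 0")
  case True
  have "(2 * pi * y * t) ^ k * exp (- 2 * pi * y * t) \<le> (fact k * exp (2 * pi * y * t)) * exp (- 2 * pi * y * t)"
    using True assms by (intro mult_right_mono power_le_fact_exp) auto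
  then have "(2 * pi * y * t) ^ k * exp (- 2 * pi * y * t) \<le> fact k" by (simp add: mult.assoc mult_exp_exp)
  then have "t ^ k * exp (- 2 * pi * y * t) \<le> fact k / (2 * pi * y) ^ k"
    using assms by (simp add: field_simps power_mult_distrib)
  then show ?thesis using True by (simp add: one_sided_decay_def add_increasing2)
next
  case False
  then show ?thesis using gaussian_decay[of "pi / 2" t k 0] assms
    by (simp add: one_sided_decay_def norm_gaussian add_increasing)
qed

text \<open>By the differential equation, multiples of \<open>smooth_exp r z\<close> plus polynomial
  multiples of the Gaussian of width \<open>r\<close> form a class closed under
  differentiation.\<close>

lemma schwartz_smooth_exp:
  assumes "0 < r" "r \<le> 1" "Im z > 0"
  shows "schwartz (smooth_exp r z)"
proof -
  define P where "P = range (\<lambda>(c, p) t. c * smooth_exp r z t + poly p (of_real t) * gaussian (pi / r\<^sup>2) 0 t)"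
  show ?thesis
  proof (rule schwartz_of_derivative_closed[where P = P])
    have "(\<lambda>t. 1 * smooth_exp r z t + poly 0 (of_real t) * gaussian (pi / r\<^sup>2) 0 t) \<in> P"
      unfolding P_def by (rule range_eqI[of _ _ "(1, 0)"]) simp
    then show "smooth_exp r z \<in> P" by simp
  next
    fix \<phi> k assume "\<phi> \<in> P"
    then obtain c p where \<phi>: "\<phi> = (\<lambda>t. c * smooth_exp r z t + poly p (of_real t) * gaussian (pi / r\<^sup>2) 0 t)"
      unfolding P_def by auto
    define p' where "p' = pderiv p + p * [:0, - 2 * of_real (pi / r\<^sup>2):] + [:c * of_real (1 / r):]"
    have "(\<phi> has_vector_derivative c * (2 * pi * \<i> * z) * smooth_exp r z t + poly p' (of_real t) * gaussian (pi / r\<^sup>2) 0 t) (at t)" for t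
    proof -
      have "(\<phi> has_vector_derivative c * (2 * pi * \<i> * z * smooth_exp r z t + of_real (1 / r) * gaussian (pi / r\<^sup>2) 0 t)
          + poly (pderiv p + p * [:0, - 2 * of_real (pi / r\<^sup>2):]) (of_real t) * gaussian (pi / r\<^sup>2) 0 t) (at t)"
        unfolding \<phi> by (intro has_vector_derivative_add poly_gaussian_has_vector_derivative
            has_vector_derivative_mult_right smooth_exp_has_vector_derivative assms(1))
      then show ?thesis by (simp add: p'_def algebra_simps)
    qed
    moreover have "(\<lambda>t. c * (2 * pi * \<i> * z) * smooth_exp r z t + poly p' (of_real t) * gaussian (pi / r\<^sup>2) 0 t) \<in> P"
      unfolding P_def by (rule range_eqI[of _ _ "(c * (2 * pi * \<i> * z), p')"]) simp
    ultimately show "\<exists>\<psi>\<in>P. \<forall>t. (\<phi> has_vector_derivative \<psi> t) (at t)" by (rule_tac bexI) auto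
    have "pi / r\<^sup>2 > 0" using assms by simp
    from poly_gaussian_bounded[OF this, of k p 0] obtain C2 where
      C2: "\<And>t. \<bar>t\<bar> ^ k * norm (poly p (of_real t) * gaussian (pi / r\<^sup>2) 0 t) \<le> C2"
      unfolding bounded_iff by fastforce
    have sc: "smooth_exp_const (Im z) \<ge> 0" unfolding smooth_exp_const_def by (rule Bochner_Integration.integral_nonneg) simp
    show "bounded (range (\<lambda>t. \<bar>t\<bar> ^ k * norm (\<phi> t)))"
    proof (rule bounded_range_mult_le)
      fix t
      have "\<bar>t\<bar> ^ k * norm (\<phi> t) \<le> \<bar>t\<bar> ^ k * (norm c * (smooth_exp_const (Im z) * one_sided_decay (Im z) t) + norm (poly p (of_real t) * gaussian (pi / r\<^sup>2) 0 t))"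
      proof (rule mult_left_mono)
        have "norm (\<phi> t) \<le> norm (c * smooth_exp r z t) + norm (poly p (of_real t) * gaussian (pi / r\<^sup>2) 0 t)"
          unfolding \<phi> by (rule norm_triangle_ineq)
        also have "norm (c * smooth_exp r z t) \<le> norm c * (smooth_exp_const (Im z) * one_sided_decay (Im z) t)"
          unfolding norm_mult by (intro mult_left_mono smooth_exp_bound assms) auto
        finally show "norm (\<phi> t) \<le> norm c * (smooth_exp_const (Im z) * one_sided_decay (Im z) t) + norm (poly p (of_real t) * gaussian (pi / r\<^sup>2) 0 t)"
          by simp
      qed auto
      also have "\<dots> = norm c * smooth_exp_const (Im z) * (\<bar>t\<bar> ^ k * one_sided_decay (Im z) t) + \<bar>t\<bar> ^ k * norm (poly p (of_real t) * gaussian (pi / r\<^sup>2) 0 t)"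
        by (simp add: algebra_simps)
      also have "\<dots> \<le> norm c * smooth_exp_const (Im z) * (fact k / (2 * pi * Im z) ^ k + fact k * exp (1 / (2 * pi))) + C2"
        using sc by (intro add_mono C2 mult_left_mono one_sided_decay_power assms(3)) auto
      finally show "\<bar>t\<bar> ^ k * norm (\<phi> t) \<le> norm c * smooth_exp_const (Im z) * (fact k / (2 * pi * Im z) ^ k + fact k * exp (1 / (2 * pi))) + C2" .
    qed
  qed
qed

text \<open>Transforming the differential equation gives a linear equation for the value at
  \<open>\<xi>\<close>, solvable because \<open>z\<close> is not real. As \<open>r\<close> tends to
  0 the result tends to the Cauchy kernel; for \<open>r > 0\<close> the Gaussian factor makes it
  absolutely summable over the points.\<close>

lemma fourier_smooth_exp:
  assumes "0 < r" "r \<le> 1" "Im z > 0"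
  shows "fourier (smooth_exp r z) \<xi> = of_real (exp (- (pi * (r * \<xi>)\<^sup>2))) / (2 * pi * \<i> * (of_real \<xi> - z))"
proof -
  define e where "e t = exp (- (2 * pi * \<i>) * complex_of_real (\<xi> * t))" for t
  have me: "e \<in> borel_measurable borel"
    unfolding e_def by (intro borel_measurable_continuous_onI continuous_intros)
  have ne: "norm (e t) = 1" for t unfolding e_def by (rule fourier_kernel_norm)
  have pr: "pi / r\<^sup>2 > 0" using assms by simp
  have i: "integrable lborel (\<lambda>t. smooth_exp r z t * e t)" "integrable lborel (\<lambda>t. gaussian (pi / r\<^sup>2) 0 t * e t)"
    by (rule integrable_mult_unimodular[OF schwartz_imp_integrable[OF schwartz_smooth_exp[OF assms]] me]; simp add: ne)
       (rule integrable_mult_unimodular[OF gaussian_integrable[OF pr] me]; simp add: ne)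
  have "2 * pi * \<i> * of_real \<xi> * fourier (smooth_exp r z) \<xi>
     = fourier (\<lambda>t. 2 * pi * \<i> * z * smooth_exp r z t + of_real (1 / r) * gaussian (pi / r\<^sup>2) 0 t) \<xi>"
    by (rule fourier_has_vector_derivative[symmetric, OF schwartz_smooth_exp[OF assms] smooth_exp_has_vector_derivative[OF assms(1)]])
  also have "\<dots> = (LINT t|lborel. 2 * pi * \<i> * z * (smooth_exp r z t * e t) + of_real (1 / r) * (gaussian (pi / r\<^sup>2) 0 t * e t))"
    unfolding fourier_def e_def by (intro Bochner_Integration.integral_cong refl) (simp add: distrib_right mult.assoc)
  also have "\<dots> = 2 * pi * \<i> * z * (LINT t|lborel. smooth_exp r z t * e t) + of_real (1 / r) * (LINT t|lborel. gaussian (pi / r\<^sup>2) 0 t * e t)"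
    using i by (subst Bochner_Integration.integral_add) auto
  also have "\<dots> = 2 * pi * \<i> * z * fourier (smooth_exp r z) \<xi> + of_real (1 / r) * fourier (gaussian (pi / r\<^sup>2) 0) \<xi>"
    unfolding fourier_def e_def ..
  also have "of_real (1 / r) * fourier (gaussian (pi / r\<^sup>2) 0) \<xi> = of_real (exp (- (pi * (r * \<xi>)\<^sup>2)))"
    unfolding fourier_gaussian_scaled[OF assms(1)] using assms(1) by simp
  finally have "(2 * pi * \<i> * (of_real \<xi> - z)) * fourier (smooth_exp r z) \<xi> = of_real (exp (- (pi * (r * \<xi>)\<^sup>2)))"
    by (simp add: algebra_simps)
  moreover have "of_real \<xi> - z \<noteq> 0" using assms(3) by (auto simp: complex_eq_iff)
  ultimately show ?thesis by (simp add: field_simps)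
qed

text \<open>At \<open>t = 0\<close> only a half line of the mollifier is seen, whatever
  \<open>z\<close> is. Only this independence matters, so \<open>\<omega>\<close> is obtained before
  \<open>z\<close> and its value is left open.\<close>

lemma smooth_exp_limit:
  obtains \<omega> where "\<And>z t. Im z > 0 \<Longrightarrow>
    (\<lambda>n. smooth_exp (inverse (real (Suc n))) z t) \<longlonglongrightarrow>
      (if t > 0 then exp (2 * pi * \<i> * z * of_real t) else if t < 0 then 0 else \<omega>)"
proof -
  define \<omega> where "\<omega> = (LINT v|lborel. indicator {..<0} v *\<^sub>R gaussian pi 0 v)"
  \<comment> \<open>The half lines \<open>{..<t / r}\<close> grow to everything, shrink to nothing
    or stay fixed, according to the sign of \<open>t\<close>.\<close>
  define J where "J t = (if t > 0 then UNIV else if t < 0 then {} else {..<0::real})" for t :: real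
  have one: "(LINT v|lborel. gaussian pi 0 v) = 1"
    using fourier_gaussian_pi[of 0] by (simp add: gaussian_def)
  have "(\<lambda>n. smooth_exp (inverse (real (Suc n))) z t) \<longlonglongrightarrow>
      (if t > 0 then exp (2 * pi * \<i> * z * of_real t) else if t < 0 then 0 else \<omega>)" if z: "Im z > 0" for z t
  proof -
    have "(\<lambda>n. LINT v|lborel. indicator {..<t / inverse (real (Suc n))} v *\<^sub>R gaussian pi (- (2 * pi * \<i> * z * of_real (inverse (real (Suc n))))) v)
       \<longlonglongrightarrow> (LINT v|lborel. indicator (J t) v *\<^sub>R gaussian pi 0 v)"
    proof (rule integral_dominated_convergence[where w = "\<lambda>v. norm (gaussian pi (of_real (2 * pi * Im z)) v) + norm (gaussian pi (of_real (- 2 * pi * Im z)) v)"])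
      show "integrable lborel (\<lambda>v. norm (gaussian pi (of_real (2 * pi * Im z)) v) + norm (gaussian pi (of_real (- 2 * pi * Im z)) v))"
        by (intro Bochner_Integration.integrable_add integrable_norm gaussian_integrable) auto
      show "AE v in lborel. norm (indicator {..<t / inverse (real (Suc n))} v *\<^sub>R gaussian pi (- (2 * pi * \<i> * z * of_real (inverse (real (Suc n))))) v)
          \<le> norm (gaussian pi (of_real (2 * pi * Im z)) v) + norm (gaussian pi (of_real (- 2 * pi * Im z)) v)" for n
      proof (rule AE_I2)
        fix v
        have "norm (gaussian pi (- (2 * pi * \<i> * z * of_real (inverse (real (Suc n))))) v)
            \<le> norm (gaussian pi (of_real (2 * pi * Im z)) v) + norm (gaussian pi (of_real (- 2 * pi * Im z)) v)"
          by (rule norm_gaussian_shift_le) (use z in \<open>auto simp: field_simps\<close>)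
        then show "norm (indicator {..<t / inverse (real (Suc n))} v *\<^sub>R gaussian pi (- (2 * pi * \<i> * z * of_real (inverse (real (Suc n))))) v)
          \<le> norm (gaussian pi (of_real (2 * pi * Im z)) v) + norm (gaussian pi (of_real (- 2 * pi * Im z)) v)"
          by (simp add: indicator_def)
      qed
      show "AE v in lborel. (\<lambda>n. indicator {..<t / inverse (real (Suc n))} v *\<^sub>R gaussian pi (- (2 * pi * \<i> * z * of_real (inverse (real (Suc n))))) v)
          \<longlonglongrightarrow> indicator (J t) v *\<^sub>R gaussian pi 0 v"
      proof (rule AE_I2)
        fix v :: real
        have "eventually (\<lambda>n. (indicator {..<t / inverse (real (Suc n))} v :: real) = indicator (J t) v) sequentially"
        proof -
          consider "t > 0" | "t < 0" | "t = 0" by linarith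
          then show ?thesis
          proof cases
            case 1
            then have "filterlim (\<lambda>n. t * real (Suc n)) at_top sequentially" by real_asymp
            then have "eventually (\<lambda>n. t * real (Suc n) > v) sequentially" by (simp add: filterlim_at_top_dense)
            then show ?thesis by eventually_elim (use 1 in \<open>simp add: J_def divide_inverse\<close>)
          next
            case 2
            then have "filterlim (\<lambda>n. t * real (Suc n)) at_bot sequentially" by real_asymp
            then have "eventually (\<lambda>n. t * real (Suc n) < v) sequentially" by (simp add: filterlim_at_bot_dense)
            then show ?thesis by eventually_elim (use 2 in \<open>simp add: J_def divide_inverse\<close>)
          qed (simp add: J_def)
        qed
        then have 1: "(\<lambda>n. indicator {..<t / inverse (real (Suc n))} v :: real) \<longlonglongrightarrow> indicator (J t) v"
          by (rule tendsto_eventually)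
        have 2: "(\<lambda>n. gaussian pi (- (2 * pi * \<i> * z * of_real (inverse (real (Suc n))))) v) \<longlonglongrightarrow> gaussian pi (- (2 * pi * \<i> * z * of_real 0)) v"
          unfolding gaussian_def by (intro tendsto_intros LIMSEQ_inverse_real_of_nat)
        show "(\<lambda>n. indicator {..<t / inverse (real (Suc n))} v *\<^sub>R gaussian pi (- (2 * pi * \<i> * z * of_real (inverse (real (Suc n))))) v)
          \<longlonglongrightarrow> indicator (J t) v *\<^sub>R gaussian pi 0 v"
          using tendsto_scaleR[OF 1 2] by simp
      qed
    qed (auto simp: J_def)
    then have "(\<lambda>n. smooth_exp (inverse (real (Suc n))) z t)
        \<longlonglongrightarrow> (LINT v|lborel. indicator (J t) v *\<^sub>R gaussian pi 0 v) * exp (2 * pi * \<i> * z * of_real t)"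
      unfolding smooth_exp_def by (rule tendsto_mult_right)
    moreover have "(LINT v|lborel. indicator (J t) v *\<^sub>R gaussian pi 0 v) * exp (2 * pi * \<i> * z * of_real t)
        = (if t > 0 then exp (2 * pi * \<i> * z * of_real t) else if t < 0 then 0 else \<omega>)"
      by (cases "t = 0") (auto simp: J_def one \<omega>_def)
    ultimately show ?thesis by simp
  qed
  then show ?thesis using that by blast
qed

text \<open>On the imaginary axis the integrand is positive, and the stretch from -1 to 0 alone
  contributes the constant. The estimate transfers summability from a Schwartz function to the
  one-sided exponential, which is not one.\<close>

lemma smooth_exp_lower_bound:
  assumes "y > 0" "t > 0"
  shows "exp (- pi - 2 * pi * y) * exp (- 2 * pi * y * t) \<le> norm (smooth_exp 1 (\<i> * of_real y) t)"
proof -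
  define h where "h v = exp (- pi * v\<^sup>2 + 2 * pi * y * v)" for v :: real
  have g: "gaussian pi (- (2 * pi * \<i> * (\<i> * of_real y) * of_real 1)) v = of_real (h v)" for v
    unfolding gaussian_def h_def exp_of_real[symmetric] by (intro arg_cong[where f = exp]) (simp add: algebra_simps)
  have ih: "integrable lborel h"
  proof -
    have "h = (\<lambda>v. norm (gaussian pi (of_real (2 * pi * y)) v))" by (auto simp: norm_gaussian h_def)
    then show ?thesis using integrable_norm[OF gaussian_integrable[of pi]] by simp
  qed
  have "exp (- pi - 2 * pi * y) = (LINT v|lborel. indicator {-1..0::real} v *\<^sub>R exp (- pi - 2 * pi * y))"
    by simp
  also have "\<dots> \<le> (LINT v|lborel. indicator {..<t} v *\<^sub>R h v)"
  proof (rule integral_mono)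
    show "integrable lborel (\<lambda>v. indicator {..<t} v *\<^sub>R h v)"
      by (intro integrable_mult_indicator ih) auto
    show "indicator {-1..0} v *\<^sub>R exp (- pi - 2 * pi * y) \<le> indicator {..<t} v *\<^sub>R h v" for v
    proof (cases "v \<in> {-1..0}")
      case True
      then have "v\<^sup>2 \<le> 1\<^sup>2" by (intro power2_le_iff_abs_le[THEN iffD2]) auto
      then have "pi * v\<^sup>2 \<le> pi" by simp
      moreover have "2 * pi * y * (-1) \<le> 2 * pi * y * v"
        using True assms by (intro mult_left_mono) auto
      ultimately have "- pi - 2 * pi * y \<le> - pi * v\<^sup>2 + 2 * pi * y * v" by linarith
      then show ?thesis using True assms by (simp add: h_def)
    qed (simp add: h_def)
  qed auto
  finally have le: "exp (- pi - 2 * pi * y) \<le> (LINT v|lborel. indicator {..<t} v *\<^sub>R h v)" .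
  have "smooth_exp 1 (\<i> * of_real y) t = of_real (LINT v|lborel. indicator {..<t} v *\<^sub>R h v) * of_real (exp (- 2 * pi * y * t))"
  proof -
    have "(LINT v|lborel. indicator {..<t} v *\<^sub>R complex_of_real (h v)) = of_real (LINT v|lborel. indicator {..<t} v *\<^sub>R h v)"
      by (simp add: scaleR_conv_of_real flip: of_real_mult integral_complex_of_real)
    moreover have "exp (2 * pi * \<i> * (\<i> * of_real y) * of_real t) = of_real (exp (- 2 * pi * y * t))"
      unfolding exp_of_real[symmetric] by (intro arg_cong[where f = exp]) (simp add: algebra_simps)
    ultimately show ?thesis unfolding smooth_exp_def g by simp
  qed
  then have "norm (smooth_exp 1 (\<i> * of_real y) t) = \<bar>LINT v|lborel. indicator {..<t} v *\<^sub>R h v\<bar> * exp (- 2 * pi * y * t)"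
    by (simp add: norm_mult)
  then show ?thesis using le by (simp add: mult_right_mono)
qed

subsection \<open>Arctangent weights and Poisson kernels\<close>

lemma infsum_diff:
  fixes f g :: "'i \<Rightarrow> 'c :: real_normed_vector"
  assumes "f summable_on A" "g summable_on A"
  shows "infsum (\<lambda>x. f x - g x) A = infsum f A - infsum g A"
  using infsum_add[OF assms(1) iffD2[OF summable_on_uminus assms(2)]] by (simp add: infsum_uminus)

lemma summable_on_int_inverse_square: "(\<lambda>k::int. 1 / (1 + (real_of_int k)\<^sup>2)) summable_on UNIV"
proof -
  let ?f = "\<lambda>k::int. 1 / (1 + (real_of_int k)\<^sup>2)"
  have s: "summable (\<lambda>n::nat. 1 / (1 + (real n)\<^sup>2))"
  proof (rule summable_comparison_test[OF _ inverse_power_summable[of 2]])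
    show "\<exists>N. \<forall>n\<ge>N. norm (1 / (1 + (real n)\<^sup>2)) \<le> inverse ((real n)\<^sup>2)"
      by (intro exI[of _ 1]) (auto simp: field_simps add_pos_nonneg)
  qed simp
  then have "(\<lambda>n::nat. 1 / (1 + (real n)\<^sup>2)) summable_on UNIV"
    by (intro norm_summable_imp_summable_on) simp
  then have 1: "(\<lambda>n::nat. ?f (int n)) summable_on UNIV" "(\<lambda>n::nat. ?f (- int n)) summable_on UNIV"
    by simp_all
  have b1: "bij_betw int UNIV {0..}" by (rule bij_betwI[of _ _ _ nat]) auto
  have b2: "bij_betw (\<lambda>n. - int n) UNIV {..0}" by (rule bij_betwI[of _ _ _ "\<lambda>k. nat (- k)"]) auto
  have "?f summable_on {0..}" "?f summable_on {..0}"
    by (rule iffD1[OF summable_on_reindex_bij_betw[OF b1] 1(1)],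
        rule iffD1[OF summable_on_reindex_bij_betw[OF b2] 1(2)])
  then have "?f summable_on ({0..} \<union> {..0})" by (rule summable_on_union)
  moreover have "{0..} \<union> {..0} = (UNIV :: int set)" by auto
  ultimately show ?thesis by simp
qed

lemma one_plus_square_le_dist_square:
  assumes "Im z > 0"
  shows "1 + x\<^sup>2 \<le> (2 + (1 + 2 * (norm z)\<^sup>2) / (Im z)\<^sup>2) * (norm (of_real x - z))\<^sup>2"
proof -
  define d where "d = norm (of_real x - z)"
  have "\<bar>Im (of_real x - z)\<bar> \<le> d" unfolding d_def by (rule abs_Im_le_cmod)
  then have yd: "(Im z)\<^sup>2 \<le> d\<^sup>2" using assms by (intro power_mono) auto
  have "\<bar>x\<bar> \<le> d + norm z"
    unfolding d_def using norm_triangle_ineq[of "of_real x - z" z] by simp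
  then have "\<bar>x\<bar>\<^sup>2 \<le> (d + norm z)\<^sup>2" by (intro power_mono) auto
  also have "\<dots> \<le> 2 * d\<^sup>2 + 2 * (norm z)\<^sup>2"
    using sum_squares_bound[of d "norm z"] by (simp add: power2_eq_square algebra_simps)
  finally have "1 + x\<^sup>2 \<le> 2 * d\<^sup>2 + (1 + 2 * (norm z)\<^sup>2)" by simp
  also have "1 + 2 * (norm z)\<^sup>2 = (1 + 2 * (norm z)\<^sup>2) / (Im z)\<^sup>2 * (Im z)\<^sup>2"
    using assms by simp
  also have "2 * d\<^sup>2 + \<dots> \<le> 2 * d\<^sup>2 + (1 + 2 * (norm z)\<^sup>2) / (Im z)\<^sup>2 * d\<^sup>2"
    by (intro add_left_mono mult_left_mono yd) auto
  finally show ?thesis by (simp add: d_def algebra_simps)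
qed

text \<open>A single Cauchy kernel decays like \<open>1 / x\<close>, which need not be summable over
  the points; the difference of two decays like \<open>1 / x\<^sup>2\<close>. Up to the factor
  \<open>norm (w - z)\<close> the constant is the geometric mean of the two constants comparing
  \<open>1 + x\<^sup>2\<close> with the squared distances.\<close>

lemma cauchy_kernel_difference_bound:
  assumes "Im z > 0" "Im w > 0"
  obtains C where "C \<ge> 0" "\<And>x. norm (1 / (z - complex_of_real x) - 1 / (w - of_real x)) \<le> C * (1 / (1 + x\<^sup>2))"
proof -
  define K where "K z = 2 + (1 + 2 * (norm z)\<^sup>2) / (Im z)\<^sup>2" for z :: complex
  have K: "K z > 0" for z unfolding K_def by (intro add_pos_nonneg) auto
  show ?thesis
  proof (rule that[of "norm (w - z) * sqrt (K z * K w)"])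
    show "0 \<le> norm (w - z) * sqrt (K z * K w)" using K[of z] K[of w] by simp
    fix x :: real
    define d e where "d = norm (of_real x - z)" and "e = norm (of_real x - w)"
    have ne: "z \<noteq> of_real x" "w \<noteq> of_real x" using assms by auto
    then have de: "d > 0" "e > 0" by (auto simp: d_def e_def)
    have x1: "1 + x\<^sup>2 > 0" by (simp add: add_pos_nonneg)
    have "1 + x\<^sup>2 \<le> K z * d\<^sup>2" "1 + x\<^sup>2 \<le> K w * e\<^sup>2"
      unfolding K_def d_def e_def by (rule one_plus_square_le_dist_square; fact)+
    then have "(1 + x\<^sup>2) * (1 + x\<^sup>2) \<le> (K z * d\<^sup>2) * (K w * e\<^sup>2)"
      using x1 K[of z] by (intro mult_mono) auto
    then have "(1 + x\<^sup>2)\<^sup>2 \<le> (K z * K w) * (d * e)\<^sup>2" by (simp add: power2_eq_square mult_ac)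
    then have "sqrt ((1 + x\<^sup>2)\<^sup>2) \<le> sqrt ((K z * K w) * (d * e)\<^sup>2)" by (rule real_sqrt_le_mono)
    then have le: "1 + x\<^sup>2 \<le> sqrt (K z * K w) * (d * e)"
      using x1 de by (simp add: real_sqrt_mult)
    have "1 / (z - of_real x) - 1 / (w - of_real x) = (w - z) / ((z - of_real x) * (w - of_real x))"
      using ne by (simp add: field_simps)
    then have "norm (1 / (z - of_real x) - 1 / (w - of_real x)) = norm (w - z) / (d * e)"
      by (simp add: norm_divide norm_mult d_def e_def norm_minus_commute)
    also have "\<dots> = norm (w - z) * (1 / (d * e))" by simp
    also have "\<dots> \<le> norm (w - z) * (sqrt (K z * K w) / (1 + x\<^sup>2))"
      using le de x1 by (intro mult_left_mono) (auto simp: field_simps)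
    finally show "norm (1 / (z - of_real x) - 1 / (w - of_real x)) \<le> norm (w - z) * sqrt (K z * K w) * (1 / (1 + x\<^sup>2))"
      by simp
  qed
qed

lemma arctan_mean_value:
  assumes "s < t"
  shows "\<exists>\<xi>. s < \<xi> \<and> \<xi> < t \<and> arctan t - arctan s = (t - s) * inverse (1 + \<xi>\<^sup>2)"
proof -
  have "\<exists>\<xi>>s. \<xi> < t \<and> arctan t - arctan s = (t - s) * inverse (1 + \<xi>\<^sup>2)"
    by (rule MVT2[OF assms DERIV_arctan])
  then show ?thesis by auto
qed

lemma arctan_ge:
  assumes "s > 0"
  shows "arctan s \<ge> pi / 2 - 1 / s"
proof -
  have 1: "arctan (1 / s) = pi / 2 - arctan s"
    using arctan_inverse[of s] assms by (simp add: inverse_eq_divide)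
  obtain \<xi> where "arctan (1 / s) - arctan 0 = (1 / s - 0) * inverse (1 + \<xi>\<^sup>2)"
    using arctan_mean_value[of 0 "1 / s"] assms by auto
  moreover have "(1 / s) * inverse (1 + \<xi>\<^sup>2) \<le> (1 / s) * 1"
    using assms by (intro mult_left_mono) (auto simp: inverse_le_1_iff)
  ultimately have "arctan (1 / s) \<le> 1 / s" by simp
  then show ?thesis using 1 by linarith
qed

text \<open>For \<open>y > 0\<close>, the integral over \<open>u\<close> from \<open>p\<close> to
  \<open>q\<close> of the Poisson kernel \<open>y / ((u - x)\<^sup>2 + y\<^sup>2)\<close>, that is,
  the angle under which the interval is seen from height \<open>y\<close> above \<open>x\<close>.
  For small \<open>y\<close> it approximates \<open>pi\<close> times the indicator of the
  interval.\<close>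

definition arctan_weight :: "real \<Rightarrow> real \<Rightarrow> real \<Rightarrow> real \<Rightarrow> real" where
  "arctan_weight y p q x = arctan ((q - x) / y) - arctan ((p - x) / y)"

lemma arctan_weight_nonneg: "y > 0 \<Longrightarrow> p \<le> q \<Longrightarrow> arctan_weight y p q x \<ge> 0"
  unfolding arctan_weight_def by (simp add: arctan_le_iff divide_right_mono)

lemma arctan_weight_le_pi: "arctan_weight y p q x \<le> pi"
  unfolding arctan_weight_def using arctan_ubound[of "(q - x) / y"] arctan_lbound[of "(p - x) / y"] by simp

lemma arctan_weight_inside:
  assumes "y > 0" "d > 0" "p + d \<le> x" "x \<le> q - d"
  shows "arctan_weight y p q x \<ge> pi - 2 * y / d"
proof -
  have "arctan (d / y) \<le> arctan ((q - x) / y)" "arctan (d / y) \<le> arctan ((x - p) / y)"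
    using assms by (auto simp: arctan_le_iff intro!: divide_right_mono)
  moreover have "arctan ((p - x) / y) = - arctan ((x - p) / y)"
    by (simp add: arctan_minus[symmetric] minus_divide_left)
  moreover have "arctan (d / y) \<ge> pi / 2 - y / d"
    using arctan_ge[of "d / y"] assms by simp
  ultimately show ?thesis unfolding arctan_weight_def by linarith
qed

text \<open>The mean value theorem gives decay like the inverse square of the distance to
  \<open>p\<close>; at distance at least \<open>d\<close> the 1 in the denominator costs only the
  factor \<open>1 + 1 / d\<^sup>2\<close>. In this form the tail is summable over the points with a
  bound independent of the position of \<open>p\<close>.\<close>

lemma arctan_weight_left:
  assumes "y > 0" "d > 0" "p \<le> q" "x \<le> p - d"
  shows "arctan_weight y p q x \<le> (q - p) * y * (1 + 1 / d\<^sup>2) * (1 / (1 + (x - p)\<^sup>2))"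
proof (cases "p = q")
  case True
  then show ?thesis by (simp add: arctan_weight_def)
next
  case False
  define s t where "s = (p - x) / y" and "t = (q - x) / y"
  have st: "0 < s" "s < t" using assms False by (auto simp: s_def t_def divide_strict_right_mono)
  obtain \<xi> where \<xi>: "s < \<xi>" "arctan t - arctan s = (t - s) * inverse (1 + \<xi>\<^sup>2)"
    using arctan_mean_value[OF st(2)] by blast
  have "s\<^sup>2 \<le> \<xi>\<^sup>2" using \<xi>(1) st by (intro power_mono) auto
  then have "inverse (1 + \<xi>\<^sup>2) \<le> inverse (s\<^sup>2)" using st by (intro le_imp_inverse_le) auto
  then have "arctan_weight y p q x \<le> (t - s) * inverse (s\<^sup>2)"
    unfolding arctan_weight_def s_def[symmetric] t_def[symmetric] \<xi>(2) using st by (intro mult_left_mono) auto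
  also have "t - s = (q - p) / y" by (simp add: s_def t_def diff_divide_distrib)
  also have "(q - p) / y * inverse (s\<^sup>2) = (q - p) * y * (1 / (x - p)\<^sup>2)"
  proof -
    have "(q - p) / y * inverse (D / y\<^sup>2) = (q - p) * y * (1 / D)" for D
      using assms(1) by (simp add: power2_eq_square)
    moreover have "s\<^sup>2 = (x - p)\<^sup>2 / y\<^sup>2" by (simp add: s_def power_divide power2_commute)
    ultimately show ?thesis by simp
  qed
  also have "\<dots> \<le> (q - p) * y * ((1 + 1 / d\<^sup>2) * (1 / (1 + (x - p)\<^sup>2)))"
  proof (rule mult_left_mono)
    have D: "d\<^sup>2 \<le> (p - x)\<^sup>2" using assms by (intro power_mono) auto
    define D where "D = (x - p)\<^sup>2"
    have D: "d\<^sup>2 \<le> D" "D > 0" using D assms unfolding D_def by (auto simp: power2_commute)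
    have "1 + D \<le> D * (1 + 1 / d\<^sup>2)" using D assms by (simp add: field_simps)
    then show "1 / (x - p)\<^sup>2 \<le> (1 + 1 / d\<^sup>2) * (1 / (1 + (x - p)\<^sup>2))"
      unfolding D_def[symmetric] using D by (simp add: divide_le_eq le_divide_eq mult_ac)
  qed (use assms in auto)
  finally show ?thesis by (simp only: mult.assoc)
qed

lemma arctan_weight_right:
  assumes "y > 0" "d > 0" "p \<le> q" "x \<ge> q + d"
  shows "arctan_weight y p q x \<le> (q - p) * y * (1 + 1 / d\<^sup>2) * (1 / (1 + (x - q)\<^sup>2))"
proof -
  have "arctan_weight y p q x = arctan_weight y (- q) (- p) (- x)"
  proof -
    have "(- p - - x) / y = - ((p - x) / y)" "(- q - - x) / y = - ((q - x) / y)"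
      unfolding minus_divide_left by simp_all
    then show ?thesis unfolding arctan_weight_def by (simp only: arctan_minus)
  qed
  also have "\<dots> \<le> (- p - (- q)) * y * (1 + 1 / d\<^sup>2) * (1 / (1 + (- x - (- q))\<^sup>2))"
    by (rule arctan_weight_left) (use assms in auto)
  also have "(- x - (- q))\<^sup>2 = (x - q)\<^sup>2" by (simp add: power2_eq_square algebra_simps)
  finally show ?thesis by simp
qed

lemma poisson_kernel_bound:
  fixes u x y R :: real
  assumes "y > 0" "\<bar>u\<bar> \<le> R"
  shows "y / ((u - x)\<^sup>2 + y\<^sup>2) \<le> y * (2 + (1 + 2 * (R\<^sup>2 + y\<^sup>2)) / y\<^sup>2) * (1 / (1 + x\<^sup>2))"
proof -
  have n: "(norm (of_real x - Complex u y))\<^sup>2 = (u - x)\<^sup>2 + y\<^sup>2" "(norm (Complex u y))\<^sup>2 = u\<^sup>2 + y\<^sup>2"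
    by (simp_all add: cmod_power2 power2_commute)
  have "u\<^sup>2 \<le> R\<^sup>2" using assms(2) power_mono[of "\<bar>u\<bar>" R 2] by simp
  have "1 + x\<^sup>2 \<le> (2 + (1 + 2 * (u\<^sup>2 + y\<^sup>2)) / y\<^sup>2) * ((u - x)\<^sup>2 + y\<^sup>2)"
    using one_plus_square_le_dist_square[of "Complex u y" x] assms(1) by (simp add: n)
  also have "\<dots> \<le> (2 + (1 + 2 * (R\<^sup>2 + y\<^sup>2)) / y\<^sup>2) * ((u - x)\<^sup>2 + y\<^sup>2)"
    using \<open>u\<^sup>2 \<le> R\<^sup>2\<close> by (intro mult_right_mono add_left_mono divide_right_mono) auto
  finally have le: "1 + x\<^sup>2 \<le> (2 + (1 + 2 * (R\<^sup>2 + y\<^sup>2)) / y\<^sup>2) * ((u - x)\<^sup>2 + y\<^sup>2)" .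
  define K where "K = 2 + (1 + 2 * (R\<^sup>2 + y\<^sup>2)) / y\<^sup>2"
  define v where "v = (u - x)\<^sup>2 + y\<^sup>2"
  have pos: "1 + x\<^sup>2 > 0" "v > 0" using assms by (auto simp: v_def intro: add_pos_nonneg add_nonneg_pos)
  have "1 / v \<le> K / (1 + x\<^sup>2)"
    using le pos unfolding K_def[symmetric] v_def[symmetric] by (simp add: field_simps)
  then have "y * (1 / v) \<le> y * (K / (1 + x\<^sup>2))" using assms by (intro mult_left_mono) auto
  then show ?thesis by (simp add: K_def v_def)
qed

text \<open>Uniform convergence of the Poisson kernels on \<open>{p..q}\<close> permits termwise
  integration. A pointwise estimate of the Poisson sum can thus be turned into one for the
  weights.\<close>

lemma arctan_weight_sum_integral:
  fixes \<alpha> :: "'i \<Rightarrow> real"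
  assumes "y > 0" "p \<le> q" and s: "(\<lambda>n. 1 / (1 + (\<alpha> n)\<^sup>2)) summable_on UNIV"
  obtains J where "((\<lambda>n. arctan_weight y p q (\<alpha> n)) has_sum J) UNIV"
    "((\<lambda>u. \<Sum>\<^sub>\<infinity>n. y / ((u - \<alpha> n)\<^sup>2 + y\<^sup>2)) has_integral J) {p..q}"
proof -
  let ?F = "finite_subsets_at_top (UNIV :: 'i set)"
  define f where "f X u = (\<Sum>n\<in>X. y / ((u - \<alpha> n)\<^sup>2 + y\<^sup>2))" for X u
  define R where "R = max \<bar>p\<bar> \<bar>q\<bar>"
  have ul: "uniform_limit {p..q} f (\<lambda>u. \<Sum>\<^sub>\<infinity>n. y / ((u - \<alpha> n)\<^sup>2 + y\<^sup>2)) ?F"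
    unfolding f_def
  proof (rule Weierstrass_m_test_general)
    show "(\<lambda>n. y * (2 + (1 + 2 * (R\<^sup>2 + y\<^sup>2)) / y\<^sup>2) * (1 / (1 + (\<alpha> n)\<^sup>2))) summable_on UNIV"
      by (rule summable_on_cmult_right[OF s])
    fix n u assume "u \<in> {p..q}"
    then have "\<bar>u\<bar> \<le> R" unfolding R_def by auto
    then show "norm (y / ((u - \<alpha> n)\<^sup>2 + y\<^sup>2)) \<le> y * (2 + (1 + 2 * (R\<^sup>2 + y\<^sup>2)) / y\<^sup>2) * (1 / (1 + (\<alpha> n)\<^sup>2))"
      using poisson_kernel_bound[OF assms(1), of u R "\<alpha> n"] assms(1) by simp
  qed
  have pos: "(u - x)\<^sup>2 + y\<^sup>2 \<noteq> 0" for u x using assms(1) by (simp add: sum_power2_eq_zero_iff)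
  have cont: "continuous_on {p..q} (f X)" for X
    unfolding f_def by (intro continuous_intros) (use pos in auto)
  obtain I J where IJ: "\<And>X. (f X has_integral I X) {p..q}"
    "((\<lambda>u. \<Sum>\<^sub>\<infinity>n. y / ((u - \<alpha> n)\<^sup>2 + y\<^sup>2)) has_integral J) {p..q}" "(I \<longlongrightarrow> J) ?F"
    using uniform_limit_integral[OF ul cont] by (metis finite_subsets_at_top_neq_bot)
  have I: "I X = (\<Sum>n\<in>X. arctan_weight y p q (\<alpha> n))" if "finite X" for X
  proof -
    have "((\<lambda>u. y / ((u - x)\<^sup>2 + y\<^sup>2)) has_integral arctan_weight y p q x) {p..q}" for x
      unfolding arctan_weight_def
    proof (rule fundamental_theorem_of_calculus[OF assms(2)])
      fix u assume "u \<in> {p..q}"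
      have "((\<lambda>u. arctan ((u - x) / y)) has_real_derivative (1 / y) * inverse (1 + ((u - x) / y)\<^sup>2)) (at u)"
        by (auto intro!: derivative_eq_intros simp: divide_inverse)
      also have "(1 / y) * inverse (1 + ((u - x) / y)\<^sup>2) = y / ((u - x)\<^sup>2 + y\<^sup>2)"
      proof -
        have "1 + ((u - x) / y)\<^sup>2 = ((u - x)\<^sup>2 + y\<^sup>2) / y\<^sup>2" using assms(1) by (simp add: field_simps)
        then show ?thesis using assms(1) by (simp add: power2_eq_square)
      qed
      finally show "((\<lambda>u. arctan ((u - x) / y)) has_vector_derivative y / ((u - x)\<^sup>2 + y\<^sup>2)) (at u within {p..q})"
        by (simp add: has_real_derivative_iff_has_vector_derivative has_vector_derivative_at_within)
    qed
    then have "(f X has_integral (\<Sum>n\<in>X. arctan_weight y p q (\<alpha> n))) {p..q}"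
      unfolding f_def using that by (intro has_integral_sum) auto
    then show ?thesis using IJ(1)[of X] has_integral_unique by blast
  qed
  have "((\<lambda>n. arctan_weight y p q (\<alpha> n)) has_sum J) UNIV"
    unfolding has_sum_def
  proof (rule Lim_transform_eventually[OF IJ(3)])
    show "\<forall>\<^sub>F X in ?F. I X = (\<Sum>n\<in>X. arctan_weight y p q (\<alpha> n))"
      unfolding eventually_finite_subsets_at_top using I by (intro exI[of _ "{}"]) auto
  qed
  then show ?thesis using IJ(2) that by blast
qed

subsection \<open>Bounded functions on strips\<close>

lemma norm_exp_minus_1_le: "norm (exp u - 1) \<le> norm u * exp (norm u)" for u :: complex
proof (cases "u = 0")
  case False
  have "norm (exp u - exp 0) \<le> exp (norm u) * norm (u - 0)"
  proof (rule field_differentiable_bound[where S = "cball 0 (norm u)" and f' = exp])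
    show "norm (exp z) \<le> exp (norm u)" if "z \<in> cball 0 (norm u)" for z :: complex
      using that complex_Re_le_cmod[of z] by (simp add: norm_exp_eq_Re)
  qed (auto intro!: derivative_eq_intros)
  then show ?thesis by (simp add: mult.commute)
qed simp

text \<open>A Phragmen-Lindelof argument: the factor \<open>exp (- \<delta> * w\<^sup>2)\<close>
  makes the function small on the vertical sides of a long rectangle, the maximum principle applies
  there, and \<open>\<delta>\<close> tends to 0. The a priori bound \<open>M\<close> only controls
  the vertical sides and drops out.\<close>

lemma bounded_strip_maximum:
  fixes h :: "complex \<Rightarrow> complex"
  assumes hol: "h holomorphic_on UNIV" and S: "S > 0" and m: "m > 0"
    and bdd: "\<And>z. \<bar>Im z\<bar> \<le> S \<Longrightarrow> norm (h z) \<le> M"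
    and edge: "\<And>z. \<bar>Im z\<bar> = S \<Longrightarrow> norm (h z) \<le> m"
    and z: "\<bar>Im z\<bar> \<le> S"
  shows "norm (h z) \<le> m"
proof -
  have le: "norm (h z) \<le> m * exp (\<delta> * S\<^sup>2) * exp (\<delta> * ((Re z)\<^sup>2 - (Im z)\<^sup>2))" if \<delta>: "\<delta> > 0" for \<delta>
  proof -
    have M0: "M \<ge> 0" using order.trans[OF norm_ge_zero bdd[of 0]] S by simp
    have "filterlim (\<lambda>R. M * exp (- \<delta> * R\<^sup>2)) (nhds 0) at_top"
      using \<delta> by real_asymp
    then have "eventually (\<lambda>R. M * exp (- \<delta> * R\<^sup>2) < m) at_top"
      using m by (rule order_tendstoD(2))
    moreover have "eventually (\<lambda>R. R > \<bar>Re z\<bar>) at_top" by (rule eventually_gt_at_top)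
    ultimately have "eventually (\<lambda>R. M * exp (- \<delta> * R\<^sup>2) < m \<and> R > \<bar>Re z\<bar>) at_top" by (rule eventually_conj)
    then obtain R where R: "M * exp (- \<delta> * R\<^sup>2) < m" "R > \<bar>Re z\<bar>"
      by (rule eventually_happens'[rotated, elim_format]) auto
    define Q where "Q = cbox (Complex (- R) (- S)) (Complex R S)"
    define k where "k w = h w * exp (- of_real \<delta> * w\<^sup>2)" for w
    have hk: "k holomorphic_on A" for A
      unfolding k_def by (intro holomorphic_intros holomorphic_on_subset[OF hol]) auto
    have nk: "norm (k w) = norm (h w) * exp (\<delta> * (Im w)\<^sup>2) * exp (- \<delta> * (Re w)\<^sup>2)" for w
      by (simp add: k_def norm_mult norm_exp_eq_Re power2_eq_square algebra_simps flip: exp_add)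
    have "norm (k z) \<le> m * exp (\<delta> * S\<^sup>2)"
    proof (rule maximum_modulus_frontier[where S = Q and f = k and \<xi> = z])
      show "k holomorphic_on interior Q" by (rule hk)
      show "continuous_on (closure Q) k" by (rule holomorphic_on_imp_continuous_on[OF hk])
      show "bounded Q" unfolding Q_def by (rule bounded_cbox)
      show "z \<in> Q" using z R by (auto simp: Q_def in_cbox_complex_iff)
    next
      fix w assume "w \<in> frontier Q"
      then have w: "w \<in> Q" "w \<notin> box (Complex (- R) (- S)) (Complex R S)"
        unfolding Q_def by (auto simp: frontier_def)
      then have im: "\<bar>Im w\<bar> \<le> S" by (auto simp: Q_def in_cbox_complex_iff)
      have eS: "exp (\<delta> * (Im w)\<^sup>2) \<le> exp (\<delta> * S\<^sup>2)"
        using im \<delta> power_mono[of "\<bar>Im w\<bar>" S 2] by simp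
      have "\<bar>Im w\<bar> = S \<or> \<bar>Re w\<bar> = R"
        using w by (auto simp: Q_def in_cbox_complex_iff in_box_complex_iff)
      then show "norm (k w) \<le> m * exp (\<delta> * S\<^sup>2)"
      proof
        assume "\<bar>Im w\<bar> = S"
        then have "norm (h w) \<le> m" by (rule edge)
        then have "norm (k w) \<le> m * exp (\<delta> * S\<^sup>2) * 1"
          unfolding nk using eS \<delta> m by (intro mult_mono) auto
        then show ?thesis by simp
      next
        assume "\<bar>Re w\<bar> = R"
        then have "(Re w)\<^sup>2 = R\<^sup>2" by (metis power2_abs)
        then have "norm (k w) \<le> M * exp (\<delta> * S\<^sup>2) * exp (- \<delta> * R\<^sup>2)"
          unfolding nk using eS bdd[OF im] M0 by (intro mult_mono) auto
        also have "\<dots> = (M * exp (- \<delta> * R\<^sup>2)) * exp (\<delta> * S\<^sup>2)" by simp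
        also have "\<dots> \<le> m * exp (\<delta> * S\<^sup>2)" using R by (intro mult_right_mono) auto
        finally show ?thesis .
      qed
    qed
    then have "norm (h z) * exp (\<delta> * (Im z)\<^sup>2) * exp (- \<delta> * (Re z)\<^sup>2) * exp (\<delta> * ((Re z)\<^sup>2 - (Im z)\<^sup>2))
        \<le> m * exp (\<delta> * S\<^sup>2) * exp (\<delta> * ((Re z)\<^sup>2 - (Im z)\<^sup>2))"
      unfolding nk by (rule mult_right_mono) simp
    moreover have "exp (\<delta> * (Im z)\<^sup>2) * exp (- \<delta> * (Re z)\<^sup>2) * exp (\<delta> * ((Re z)\<^sup>2 - (Im z)\<^sup>2)) = 1"
      by (simp add: mult_exp_exp algebra_simps)
    ultimately show ?thesis by (simp only: mult.assoc mult_1_right)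
  qed
  have "((\<lambda>\<delta>. m * exp (\<delta> * S\<^sup>2) * exp (\<delta> * ((Re z)\<^sup>2 - (Im z)\<^sup>2))) \<longlongrightarrow>
     m * exp (0 * S\<^sup>2) * exp (0 * ((Re z)\<^sup>2 - (Im z)\<^sup>2))) (at_right 0)"
    by (intro tendsto_intros)
  then have "norm (h z) \<le> m * exp (0 * S\<^sup>2) * exp (0 * ((Re z)\<^sup>2 - (Im z)\<^sup>2))"
    by (rule tendsto_lowerbound) (auto simp: eventually_at_right_less intro!: le eventually_mono[OF eventually_at_right_less[of 0]])
  then show ?thesis by simp
qed

text \<open>A version of the three lines theorem: multiplying by \<open>exp (- i k z)\<close> trades smallness on the
  upper edge against the bound on the lower one.\<close>

lemma bounded_strip_small:
  assumes "M > 0" "\<epsilon> > 0" "S > 0" "- S < \<alpha>"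
  obtains \<eta> where "\<eta> > 0" "\<And>h z. h holomorphic_on UNIV \<Longrightarrow> (\<And>z. \<bar>Im z\<bar> \<le> S \<Longrightarrow> norm (h z) \<le> M) \<Longrightarrow>
     (\<And>z. Im z = S \<Longrightarrow> norm (h z) \<le> \<eta>) \<Longrightarrow> \<alpha> \<le> Im z \<Longrightarrow> Im z \<le> S \<Longrightarrow> norm (h z) \<le> \<epsilon>"
proof -
  have "filterlim (\<lambda>k. M * exp (- k * (S + \<alpha>))) (nhds 0) at_top"
    using assms by real_asymp
  then have "eventually (\<lambda>k. M * exp (- k * (S + \<alpha>)) < \<epsilon>) at_top"
    using assms(2) by (rule order_tendstoD(2))
  then have "eventually (\<lambda>k. M * exp (- k * (S + \<alpha>)) < \<epsilon> \<and> k > 0) at_top"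
    using eventually_gt_at_top[of 0] by (rule eventually_conj)
  then obtain k where k: "M * exp (- k * (S + \<alpha>)) < \<epsilon>" "k > 0"
    by (rule eventually_happens'[rotated, elim_format]) auto
  \<comment> \<open>Chosen so that \<open>\<eta> * exp (k * S)\<close> equals
    \<open>M * exp (- k * S)\<close>, the size on the lower edge. It depends on \<open>M\<close>,
    \<open>\<epsilon>\<close>, \<open>S\<close> and \<open>\<alpha>\<close> but not on
    \<open>h\<close>, so one \<open>\<eta>\<close> serves all translates.\<close>
  define \<eta> where "\<eta> = M * exp (- k * S) * exp (- k * S)"
  show ?thesis
  proof (rule that[of \<eta>])
    show "\<eta> > 0" using assms by (simp add: \<eta>_def)
    fix h z assume h: "h holomorphic_on UNIV" "\<And>z. \<bar>Im z\<bar> \<le> S \<Longrightarrow> norm (h z) \<le> M"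
      "\<And>z. Im z = S \<Longrightarrow> norm (h z) \<le> \<eta>" "\<alpha> \<le> Im z" "Im z \<le> S"
    define G where "G w = h w * exp (- \<i> * of_real k * w)" for w
    have nG: "norm (G w) = norm (h w) * exp (k * Im w)" for w
      by (simp add: G_def norm_mult norm_exp_eq_Re)
    have "norm (G z) \<le> M * exp (- k * S)"
    proof (rule bounded_strip_maximum[where h = G and z = z and S = S and M = "M * exp (k * S)"])
      show "G holomorphic_on UNIV" unfolding G_def by (intro holomorphic_intros h(1))
      show "0 < M * exp (- k * S)" using assms by simp
      show "\<bar>Im z\<bar> \<le> S" using h assms by auto
      show "norm (G w) \<le> M * exp (k * S)" if "\<bar>Im w\<bar> \<le> S" for w
        unfolding nG using h(2)[OF that] that k assms(1) by (intro mult_mono) auto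
      show "norm (G w) \<le> M * exp (- k * S)" if w: "\<bar>Im w\<bar> = S" for w
      proof (cases "Im w = S")
        case True
        have "norm (G w) \<le> \<eta> * exp (k * S)"
          unfolding nG using h(3)[OF True] order.trans[OF norm_ge_zero h(3)[OF True]] True by (intro mult_mono) auto
        also have "\<dots> = M * exp (- k * S)" by (simp add: \<eta>_def mult.assoc mult_exp_exp)
        finally show ?thesis .
      next
        case False
        then have "Im w = - S" using w by auto
        then show ?thesis unfolding nG using h(2)[of w] w assms(1) by (intro mult_mono) auto
      qed
    qed (use assms in auto)
    then have "norm (h z) * exp (k * Im z) * exp (- k * Im z) \<le> M * exp (- k * S) * exp (- k * Im z)"
      unfolding nG by (rule mult_right_mono) simp
    then have "norm (h z) \<le> M * exp (- k * (S + Im z))"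
      by (simp add: mult.assoc mult_exp_exp algebra_simps)
    also have "\<dots> \<le> M * exp (- k * (S + \<alpha>))"
      using h(4) k assms(1) by simp
    finally show "norm (h z) \<le> \<epsilon>" using k by simp
  qed
qed

subsection \<open>Cauchy sums over the support\<close>

locale integer_fourier_measure =
  fixes \<Lambda> \<Gamma> :: "real set" and c :: "real \<Rightarrow> nat" and b :: "real \<Rightarrow> complex"
    and a :: "int \<Rightarrow> real"
  assumes c_pos: "\<And>x. x \<in> \<Lambda> \<Longrightarrow> c x > 0"
    and mu_temp: "tempered_discrete \<Lambda> (\<lambda>x. of_nat (c x))"
    and absmuhat_temp: "tempered_discrete \<Gamma> (\<lambda>x. complex_of_real (norm (b x)))"
    and fourier_eq: "\<And>\<phi>. schwartz \<phi> \<Longrightarrow>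
        pair_discrete \<Lambda> (\<lambda>x. of_nat (c x)) (fourier \<phi>) = pair_discrete \<Gamma> b \<phi>"
    and a_mono: "\<And>n. a n \<le> a (n + 1)"
    and a_range: "range a = \<Lambda>"
    and a_mult: "\<And>x. x \<in> \<Lambda> \<Longrightarrow> card {n. a n = x} = c x"
    and zero_notin: "0 \<notin> range a"
begin

lemma a_mono_le: "m \<le> n \<Longrightarrow> a m \<le> a n"
  by (induction n rule: int_ge_induct) (use a_mono order.trans in blast)+

text \<open>Both sums are taken over the pairs of a point and an index at that point: each point
  \<open>x\<close> has \<open>c x\<close> indices, so multiplicity turns into repetition of the
  term.\<close>

lemma sum_over_enumeration:
  fixes \<psi> :: "real \<Rightarrow> complex"
  assumes "(\<lambda>x. norm (of_nat (c x) * \<psi> x)) summable_on \<Lambda>"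
  shows "(\<lambda>n. norm (\<psi> (a n))) summable_on UNIV"
    and "(\<Sum>\<^sub>\<infinity>n. \<psi> (a n)) = pair_discrete \<Lambda> (\<lambda>x. of_nat (c x)) \<psi>"
proof -
  define I where "I = Sigma \<Lambda> (\<lambda>x. {n. a n = x})"
  \<comment> \<open>An infinite set has \<open>card\<close> 0, so the positive multiplicity forces
    the fibre to be finite.\<close>
  have fin: "finite {n. a n = x}" if "x \<in> \<Lambda>" for x
    using c_pos[OF that] a_mult[OF that] by (metis card.infinite less_irrefl)
  have bij: "bij_betw snd I UNIV"
    by (rule bij_betwI[of _ _ _ "\<lambda>n. (a n, n)"]) (use a_range in \<open>auto simp: I_def\<close>)
  have 1: "(\<lambda>p. norm (case p of (x, n) \<Rightarrow> \<psi> x)) summable_on I"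
    unfolding I_def
  proof (rule Infinite_Sum.abs_summable_on_Sigma_iff[THEN iffD2], intro conjI ballI)
    show "(\<lambda>n. norm (case (x, n) of (x, n) \<Rightarrow> \<psi> x)) summable_on {n. a n = x}" if "x \<in> \<Lambda>" for x
      using fin[OF that] by simp
    show "(\<lambda>x. norm (infsum (\<lambda>n. norm (case (x, n) of (x, n) \<Rightarrow> \<psi> x)) {n. a n = x})) summable_on \<Lambda>"
      using assms by (rule summable_on_cong[THEN iffD1, rotated]) (simp add: fin a_mult norm_mult)
  qed
  have "(\<lambda>p. norm (\<psi> (a (snd p)))) summable_on I"
    using 1 by (rule summable_on_cong[THEN iffD1, rotated]) (auto simp: I_def)
  then show "(\<lambda>n. norm (\<psi> (a n))) summable_on UNIV"
    using summable_on_reindex_bij_betw[OF bij, of "\<lambda>n. norm (\<psi> (a n))"] by simp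
  have "(\<Sum>\<^sub>\<infinity>n. \<psi> (a n)) = (\<Sum>\<^sub>\<infinity>p\<in>I. \<psi> (a (snd p)))"
    by (rule infsum_reindex_bij_betw[OF bij, symmetric])
  also have "\<dots> = (\<Sum>\<^sub>\<infinity>(x, n)\<in>I. \<psi> x)"
    by (rule infsum_cong) (auto simp: I_def)
  also have "\<dots> = (\<Sum>\<^sub>\<infinity>x\<in>\<Lambda>. \<Sum>\<^sub>\<infinity>n\<in>{n. a n = x}. \<psi> x)"
    using Infinite_Sum.abs_summable_summable[OF 1] unfolding I_def by (rule infsum_Sigma'_banach[symmetric])
  also have "\<dots> = pair_discrete \<Lambda> (\<lambda>x. of_nat (c x)) \<psi>"
    unfolding pair_discrete_def by (rule infsum_cong) (simp add: fin a_mult)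
  finally show "(\<Sum>\<^sub>\<infinity>n. \<psi> (a n)) = pair_discrete \<Lambda> (\<lambda>x. of_nat (c x)) \<psi>" .
qed

lemma summable_b_schwartz:
  assumes "schwartz \<phi>"
  shows "(\<lambda>\<gamma>. norm (b \<gamma>) * norm (\<phi> \<gamma>)) summable_on \<Gamma>"
  using absmuhat_temp assms unfolding tempered_discrete_def by (simp add: norm_mult)

text \<open>A translated Gaussian is the transform of a modulated one, and modulation leaves
  \<open>norm (\<phi> \<gamma>)\<close> unchanged. The frequency side is therefore bounded by the
  same \<open>B\<close> for all \<open>x\<close>, which entails a uniform bound on the number of
  points in a unit interval.\<close>

lemma gaussian_sum_bound:
  obtains B where "\<And>x. (\<lambda>n. exp (- (pi * (a n - x)\<^sup>2))) summable_on UNIV"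
    "\<And>x. (\<Sum>\<^sub>\<infinity>n. exp (- (pi * (a n - x)\<^sup>2))) \<le> B"
proof -
  define B where "B = (\<Sum>\<^sub>\<infinity>\<gamma>\<in>\<Gamma>. norm (b \<gamma>) * norm (gaussian pi 0 \<gamma>))"
  have "(\<lambda>n. exp (- (pi * (a n - x)\<^sup>2))) summable_on UNIV \<and> (\<Sum>\<^sub>\<infinity>n. exp (- (pi * (a n - x)\<^sup>2))) \<le> B" for x
  proof -
    define \<psi> where "\<psi> \<xi> = complex_of_real (exp (- (pi * (\<xi> - x)\<^sup>2)))" for \<xi>
    define \<phi> where "\<phi> = gaussian pi (2 * pi * \<i> * of_real x)"
    have f: "fourier \<phi> = \<psi>" unfolding \<phi>_def \<psi>_def by (rule ext, rule fourier_gaussian_modulated)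
    have "\<psi> = (\<lambda>\<xi>. poly [:of_real (exp (- (pi * x\<^sup>2))):] (of_real \<xi>) * gaussian pi (of_real (2 * pi * x)) \<xi>)"
    proof (rule ext)
      fix \<xi>
      have "- (pi * (\<xi> - x)\<^sup>2) = - (pi * x\<^sup>2) + (- (pi * \<xi>\<^sup>2) + 2 * pi * x * \<xi>)"
        by (simp add: power2_eq_square algebra_simps)
      then have "exp (- (pi * (\<xi> - x)\<^sup>2)) = exp (- (pi * x\<^sup>2)) * exp (- (pi * \<xi>\<^sup>2) + 2 * pi * x * \<xi>)"
        by (simp only: mult_exp_exp)
      moreover have "complex_of_real (exp (- (pi * \<xi>\<^sup>2) + 2 * pi * x * \<xi>)) = gaussian pi (of_real (2 * pi * x)) \<xi>"
        by (simp add: gaussian_def exp_of_real[symmetric])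
      ultimately show "\<psi> \<xi> = poly [:of_real (exp (- (pi * x\<^sup>2))):] (of_real \<xi>) * gaussian pi (of_real (2 * pi * x)) \<xi>"
        unfolding \<psi>_def by (simp only: of_real_mult) simp
    qed
    then have "schwartz \<psi>" by (simp only: schwartz_poly_gaussian pi_gt_zero)
    then have s: "(\<lambda>x. norm (of_nat (c x) * \<psi> x)) summable_on \<Lambda>"
      using mu_temp unfolding tempered_discrete_def by blast
    have n\<psi>: "norm (\<psi> \<xi>) = exp (- (pi * (\<xi> - x)\<^sup>2))" for \<xi> by (simp add: \<psi>_def)
    have sum1: "(\<lambda>n. exp (- (pi * (a n - x)\<^sup>2))) summable_on UNIV"
      using sum_over_enumeration(1)[OF s] by (simp add: n\<psi>)
    have s\<phi>: "schwartz \<phi>" unfolding \<phi>_def by (rule schwartz_gaussian) simp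
    have n\<phi>: "norm (\<phi> \<gamma>) = norm (gaussian pi 0 \<gamma>)" for \<gamma> by (simp add: \<phi>_def norm_gaussian)
    have "(\<Sum>\<^sub>\<infinity>n. \<psi> (a n)) = pair_discrete \<Gamma> b \<phi>"
      using sum_over_enumeration(2)[OF s] fourier_eq[OF s\<phi>] f by simp
    moreover have "(\<Sum>\<^sub>\<infinity>n. \<psi> (a n)) = of_real (\<Sum>\<^sub>\<infinity>n. exp (- (pi * (a n - x)\<^sup>2)))"
      unfolding \<psi>_def by (rule infsumI[OF has_sum_bounded_linear[OF bounded_linear_of_real has_sum_infsum[OF sum1]]])
    moreover have "norm (pair_discrete \<Gamma> b \<phi>) \<le> B"
      unfolding pair_discrete_def B_def
      using norm_infsum_bound[of "\<lambda>\<gamma>. b \<gamma> * \<phi> \<gamma>" \<Gamma>] summable_b_schwartz[OF s\<phi>]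
      by (simp add: norm_mult n\<phi>)
    ultimately have "norm (complex_of_real (\<Sum>\<^sub>\<infinity>n. exp (- (pi * (a n - x)\<^sup>2)))) \<le> B" by metis
    then have "\<bar>\<Sum>\<^sub>\<infinity>n. exp (- (pi * (a n - x)\<^sup>2))\<bar> \<le> B" unfolding norm_of_real .
    then show ?thesis using sum1 by linarith
  qed
  then show ?thesis using that by blast
qed

text \<open>The points are grouped by \<open>k n\<close>, the integer part of
  \<open>a n - x\<close>. Within a group the Gaussian centred at \<open>x + k\<close> is at least
  \<open>exp (- pi)\<close>, so each group costs at most a constant times
  \<open>B / (1 + k\<^sup>2)\<close>. The factor 3 comes from
  \<open>1 + k\<^sup>2 \<le> 3 * (1 + t\<^sup>2)\<close> for \<open>t\<close> in the cell.\<close>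

lemma cauchy_sum_bound:
  obtains B where "\<And>x. (\<lambda>n. 1 / (1 + (a n - x)\<^sup>2)) summable_on UNIV"
    "\<And>x. (\<Sum>\<^sub>\<infinity>n. 1 / (1 + (a n - x)\<^sup>2)) \<le> B"
proof -
  obtain B where B: "\<And>x. (\<lambda>n. exp (- (pi * (a n - x)\<^sup>2))) summable_on UNIV"
    "\<And>x. (\<Sum>\<^sub>\<infinity>n. exp (- (pi * (a n - x)\<^sup>2))) \<le> B"
    using gaussian_sum_bound by metis
  have B0: "B \<ge> 0" using order.trans[OF infsum_nonneg B(2)[of 0]] by simp
  define Z where "Z = (\<Sum>\<^sub>\<infinity>k::int. 1 / (1 + (real_of_int k)\<^sup>2))"
  have fin: "(\<Sum>n\<in>X. 1 / (1 + (a n - x)\<^sup>2)) \<le> 3 * exp pi * B * Z" if "finite X" for X x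
  proof -
    define k where "k n = \<lfloor>a n - x\<rfloor>" for n
    have le: "1 / (1 + (a n - x)\<^sup>2) \<le> 3 * exp pi * (1 / (1 + (real_of_int (k n))\<^sup>2)) * exp (- (pi * (a n - (x + k n))\<^sup>2))" for n
    proof -
      define t s where "t = a n - x" and "s = t - k n"
      have s: "0 \<le> s" "s \<le> 1" unfolding s_def t_def k_def by linarith+
      then have "s\<^sup>2 \<le> 1\<^sup>2" by (intro power_mono) auto
      then have e: "1 \<le> exp pi * exp (- (pi * s\<^sup>2))" by (simp add: mult_exp_exp)
      have "(real_of_int (k n))\<^sup>2 = (t - s)\<^sup>2" by (simp add: s_def)
      also have "\<dots> \<le> 2 * t\<^sup>2 + 2 * s\<^sup>2"
        using sum_squares_bound[of t "- s"] by (simp add: power2_eq_square algebra_simps)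
      also have "\<dots> \<le> 2 * t\<^sup>2 + 2" using \<open>s\<^sup>2 \<le> 1\<^sup>2\<close> by simp
      finally have "1 + (real_of_int (k n))\<^sup>2 \<le> 3 * (1 + t\<^sup>2)"
        using zero_le_power2[of t] unfolding distrib_left by linarith
      moreover have "1 + t\<^sup>2 > 0" "1 + (real_of_int (k n))\<^sup>2 > 0" by (auto intro: add_pos_nonneg)
      ultimately have "1 / (1 + t\<^sup>2) \<le> 3 * (1 / (1 + (real_of_int (k n))\<^sup>2)) * 1"
        by (simp add: field_simps)
      also have "\<dots> \<le> 3 * (1 / (1 + (real_of_int (k n))\<^sup>2)) * (exp pi * exp (- (pi * s\<^sup>2)))"
        by (intro mult_left_mono e) auto
      finally show ?thesis by (simp add: t_def s_def mult_ac diff_diff_eq)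
    qed
    have "(\<Sum>n\<in>X. 1 / (1 + (a n - x)\<^sup>2)) \<le> (\<Sum>n\<in>X. 3 * exp pi * (1 / (1 + (real_of_int (k n))\<^sup>2)) * exp (- (pi * (a n - (x + k n))\<^sup>2)))"
      by (intro sum_mono le)
    also have "\<dots> = (\<Sum>j\<in>k ` X. \<Sum>n\<in>{n\<in>X. k n = j}. 3 * exp pi * (1 / (1 + (real_of_int (k n))\<^sup>2)) * exp (- (pi * (a n - (x + k n))\<^sup>2)))"
      by (rule sum.image_gen[OF that])
    also have "\<dots> = (\<Sum>j\<in>k ` X. 3 * exp pi * (1 / (1 + (real_of_int j)\<^sup>2)) * (\<Sum>n\<in>{n\<in>X. k n = j}. exp (- (pi * (a n - (x + j))\<^sup>2))))"
      by (intro sum.cong refl) (simp add: sum_distrib_left)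
    also have "\<dots> \<le> (\<Sum>j\<in>k ` X. 3 * exp pi * (1 / (1 + (real_of_int j)\<^sup>2)) * B)"
    proof (intro sum_mono mult_left_mono)
      fix j
      have "(\<Sum>n\<in>{n\<in>X. k n = j}. exp (- (pi * (a n - (x + j))\<^sup>2))) \<le> (\<Sum>\<^sub>\<infinity>n. exp (- (pi * (a n - (x + j))\<^sup>2)))"
        using that by (intro finite_sum_le_infsum B(1)) auto
      then show "(\<Sum>n\<in>{n\<in>X. k n = j}. exp (- (pi * (a n - (x + j))\<^sup>2))) \<le> B" using B(2) order.trans by blast
    qed auto
    also have "\<dots> = 3 * exp pi * B * (\<Sum>j\<in>k ` X. 1 / (1 + (real_of_int j)\<^sup>2))"
      by (simp add: sum_distrib_left mult_ac)
    also have "\<dots> \<le> 3 * exp pi * B * Z"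
      unfolding Z_def using that B0
      by (intro mult_left_mono finite_sum_le_infsum summable_on_int_inverse_square) auto
    finally show ?thesis .
  qed
  have s: "(\<lambda>n. 1 / (1 + (a n - x)\<^sup>2)) summable_on UNIV" for x
  proof (rule nonneg_bdd_above_summable_on)
    show "bdd_above (sum (\<lambda>n. 1 / (1 + (a n - x)\<^sup>2)) ` {F. F \<subseteq> UNIV \<and> finite F})"
      using fin by (intro bdd_aboveI[where M = "3 * exp pi * B * Z"]) auto
  qed simp
  show ?thesis
    by (rule that[OF s infsum_le_finite_sums[OF s fin]])
qed

section \<open>Exponential series over the positive frequencies\<close>

definition pos_freqs where "pos_freqs = \<Gamma> \<inter> {0<..}"

text \<open>The one-sided exponential is not a Schwartz function, but on \<open>\<gamma> > 0\<close>
  it is dominated, up to a constant, by its mollification with \<open>r = 1\<close>, which is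
  one.\<close>

lemma summable_b_exp:
  assumes "y > 0"
  shows "(\<lambda>\<gamma>. norm (b \<gamma>) * exp (- 2 * pi * y * \<gamma>)) summable_on pos_freqs"
proof -
  have "schwartz (smooth_exp 1 (\<i> * of_real y))"
    by (rule schwartz_smooth_exp) (use assms in auto)
  then have "(\<lambda>\<gamma>. norm (b \<gamma>) * norm (smooth_exp 1 (\<i> * of_real y) \<gamma>)) summable_on \<Gamma>"
    by (rule summable_b_schwartz)
  then have "(\<lambda>\<gamma>. norm (b \<gamma>) * norm (smooth_exp 1 (\<i> * of_real y) \<gamma>)) summable_on pos_freqs"
    by (rule summable_on_subset_banach) (auto simp: pos_freqs_def)
  then have s: "(\<lambda>\<gamma>. exp (pi + 2 * pi * y) * (norm (b \<gamma>) * norm (smooth_exp 1 (\<i> * of_real y) \<gamma>))) summable_on pos_freqs"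
    by (rule summable_on_cmult_right)
  show ?thesis
  proof (rule summable_on_comparison_test[OF s])
    fix \<gamma> assume "\<gamma> \<in> pos_freqs"
    then have "\<gamma> > 0" by (simp add: pos_freqs_def)
    have "exp (- 2 * pi * y * \<gamma>) = exp (pi + 2 * pi * y) * (exp (- pi - 2 * pi * y) * exp (- 2 * pi * y * \<gamma>))"
      by (simp add: mult_exp_exp flip: mult.assoc)
    also have "\<dots> \<le> exp (pi + 2 * pi * y) * norm (smooth_exp 1 (\<i> * of_real y) \<gamma>)"
      by (intro mult_left_mono smooth_exp_lower_bound assms \<open>\<gamma> > 0\<close>) auto
    finally have "norm (b \<gamma>) * exp (- 2 * pi * y * \<gamma>) \<le> norm (b \<gamma>) * (exp (pi + 2 * pi * y) * norm (smooth_exp 1 (\<i> * of_real y) \<gamma>))"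
      by (intro mult_left_mono) auto
    then show "norm (b \<gamma>) * exp (- 2 * pi * y * \<gamma>) \<le> exp (pi + 2 * pi * y) * (norm (b \<gamma>) * norm (smooth_exp 1 (\<i> * of_real y) \<gamma>))"
      by (simp add: mult_ac)
  qed auto
qed

lemma summable_b_one_sided_decay:
  assumes "y > 0"
  shows "(\<lambda>\<gamma>. norm (b \<gamma>) * one_sided_decay y \<gamma>) summable_on \<Gamma>"
proof -
  have 1: "(\<lambda>\<gamma>. norm (b \<gamma>) * one_sided_decay y \<gamma>) summable_on pos_freqs"
    using summable_b_exp[OF assms]
    by (rule summable_on_cong[THEN iffD1, rotated]) (auto simp: pos_freqs_def one_sided_decay_def)
  have "(\<lambda>\<gamma>. norm (b \<gamma>) * norm (gaussian (pi / 2) 0 \<gamma>)) summable_on \<Gamma>"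
    by (rule summable_b_schwartz[OF schwartz_gaussian]) simp
  then have "(\<lambda>\<gamma>. norm (b \<gamma>) * norm (gaussian (pi / 2) 0 \<gamma>)) summable_on (\<Gamma> \<inter> {..0})"
    by (rule summable_on_subset_banach) auto
  then have 2: "(\<lambda>\<gamma>. norm (b \<gamma>) * one_sided_decay y \<gamma>) summable_on (\<Gamma> \<inter> {..0})"
    by (rule summable_on_cong[THEN iffD1, rotated]) (auto simp: one_sided_decay_def norm_gaussian)
  have "\<Gamma> = pos_freqs \<union> (\<Gamma> \<inter> {..0})" by (auto simp: pos_freqs_def)
  then show ?thesis using summable_on_union[OF 1 2] by simp
qed

definition pos_series where "pos_series z = (\<Sum>\<^sub>\<infinity>\<gamma>\<in>pos_freqs. b \<gamma> * exp (2 * pi * \<i> * complex_of_real \<gamma> * z))"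

lemma pos_series_abs_summable:
  assumes "Im z > 0"
  shows "(\<lambda>\<gamma>. norm (b \<gamma> * exp (2 * pi * \<i> * complex_of_real \<gamma> * z))) summable_on pos_freqs"
  using summable_b_exp[OF assms] by (simp add: norm_mult norm_exp_eq_Re mult_ac)

text \<open>As \<open>norm (of_real x - z)\<close> is at least \<open>Im z\<close>, the transform of
  \<open>smooth_exp r z\<close> is dominated by a Gaussian. This makes the sum over the points
  absolutely convergent without checking that the transform itself is a Schwartz function.\<close>

lemma smoothed_cauchy_sum:
  assumes "0 < r" "r \<le> 1" "Im z > 0"
  shows "(\<lambda>n. norm (of_real (exp (- (pi * (r * a n)\<^sup>2))) / (2 * pi * \<i> * (of_real (a n) - z)))) summable_on UNIV"
    and "(\<Sum>\<^sub>\<infinity>n. of_real (exp (- (pi * (r * a n)\<^sup>2))) / (2 * pi * \<i> * (of_real (a n) - z)))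
      = (\<Sum>\<^sub>\<infinity>\<gamma>\<in>\<Gamma>. b \<gamma> * smooth_exp r z \<gamma>)"
proof -
  let ?\<psi> = "\<lambda>x. complex_of_real (exp (- (pi * (r * x)\<^sup>2))) / (2 * pi * \<i> * (of_real x - z))"
  have f: "fourier (smooth_exp r z) = ?\<psi>" by (rule ext, rule fourier_smooth_exp[OF assms])
  have "schwartz (gaussian (pi * r\<^sup>2) 0)" using assms by (intro schwartz_gaussian) simp
  then have "(\<lambda>x. norm (of_nat (c x) * gaussian (pi * r\<^sup>2) 0 x)) summable_on \<Lambda>"
    using mu_temp unfolding tempered_discrete_def by blast
  then have s1: "(\<lambda>x. inverse (2 * pi * Im z) * norm (of_nat (c x) * gaussian (pi * r\<^sup>2) 0 x)) summable_on \<Lambda>"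
    by (rule summable_on_cmult_right)
  have s: "(\<lambda>x. norm (of_nat (c x) * ?\<psi> x)) summable_on \<Lambda>"
  proof (rule summable_on_comparison_test[OF s1])
    fix x assume "x \<in> \<Lambda>"
    have "\<bar>Im (of_real x - z)\<bar> \<le> norm (of_real x - z)" by (rule abs_Im_le_cmod)
    then have d: "Im z \<le> norm (of_real x - z)" using assms by simp
    have "norm (?\<psi> x) = exp (- (pi * (r * x)\<^sup>2)) / (2 * pi * norm (of_real x - z))"
      by (simp add: norm_divide norm_mult)
    also have "\<dots> \<le> exp (- (pi * (r * x)\<^sup>2)) / (2 * pi * Im z)"
      using d assms by (intro divide_left_mono mult_left_mono mult_pos_pos) auto
    also have "\<dots> = inverse (2 * pi * Im z) * norm (gaussian (pi * r\<^sup>2) 0 x)"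
      by (simp add: norm_gaussian power_mult_distrib field_simps)
    finally have "of_nat (c x) * norm (?\<psi> x) \<le> of_nat (c x) * (inverse (2 * pi * Im z) * norm (gaussian (pi * r\<^sup>2) 0 x))"
      by (rule mult_left_mono) simp
    then show "norm (of_nat (c x) * ?\<psi> x) \<le> inverse (2 * pi * Im z) * norm (of_nat (c x) * gaussian (pi * r\<^sup>2) 0 x)"
      unfolding norm_mult norm_of_nat by (simp only: mult_ac)
  qed auto
  show "(\<lambda>n. norm (?\<psi> (a n))) summable_on UNIV" by (rule sum_over_enumeration(1)[OF s])
  show "(\<Sum>\<^sub>\<infinity>n. ?\<psi> (a n)) = (\<Sum>\<^sub>\<infinity>\<gamma>\<in>\<Gamma>. b \<gamma> * smooth_exp r z \<gamma>)"
    using sum_over_enumeration(2)[OF s] fourier_eq[OF schwartz_smooth_exp[OF assms]] f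
    by (simp add: pair_discrete_def)
qed

lemma summable_cauchy_difference:
  assumes "Im z > 0" "Im w > 0"
  shows "(\<lambda>n. norm (1 / (z - complex_of_real (a n)) - 1 / (w - of_real (a n)))) summable_on UNIV"
proof -
  obtain C where C: "\<And>x. norm (1 / (z - complex_of_real x) - 1 / (w - of_real x)) \<le> C * (1 / (1 + x\<^sup>2))"
    using cauchy_kernel_difference_bound[OF assms] by metis
  obtain B where "\<And>x. (\<lambda>n. 1 / (1 + (a n - x)\<^sup>2)) summable_on UNIV"
    using cauchy_sum_bound by metis
  from summable_on_cmult_right[OF this[of 0], of C]
  have "(\<lambda>n. C * (1 / (1 + (a n)\<^sup>2))) summable_on UNIV" by simp
  then show ?thesis by (rule summable_on_comparison_test) (use C in auto)
qed

text \<open>Pairing the measure with the smoothed one-sided exponentials and removing the smoothing.  Only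
  differences of two such identities survive the limit, since the Cauchy kernel alone is not
  absolutely summable and the frequency \<open>0\<close> contributes half of its mass.\<close>

lemma cauchy_sum_difference:
  assumes "Im z > 0" "Im w > 0"
  shows "(\<Sum>\<^sub>\<infinity>n. 1 / (z - complex_of_real (a n)) - 1 / (w - of_real (a n))) = - (2 * pi * \<i>) * (pos_series z - pos_series w)"
proof -
  define r where "r k = inverse (real (Suc k))" for k
  have r: "0 < r k" "r k \<le> 1" for k by (auto simp: r_def field_simps)
  have r0: "r \<longlonglongrightarrow> 0" unfolding r_def by (rule LIMSEQ_inverse_real_of_nat)
  define D where "D n = 1 / (z - complex_of_real (a n)) - 1 / (w - of_real (a n))" for n
  define T where "T k n = - (1 / (2 * pi * \<i>)) * (of_real (exp (- (pi * (r k * a n)\<^sup>2))) * D n)" for k n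
  have sD: "(\<lambda>n. norm (D n)) summable_on UNIV" unfolding D_def by (rule summable_cauchy_difference[OF assms])
  have ne: "z \<noteq> of_real x" "w \<noteq> of_real x" "of_real x \<noteq> z" "of_real x \<noteq> w" for x using assms by auto
  define S where "S k = (\<Sum>\<^sub>\<infinity>\<gamma>\<in>\<Gamma>. b \<gamma> * smooth_exp (r k) z \<gamma> - b \<gamma> * smooth_exp (r k) w \<gamma>)" for k
  have sE: "(\<lambda>\<gamma>. b \<gamma> * smooth_exp (r k) z \<gamma>) summable_on \<Gamma>" if "Im z > 0" for z k
    using summable_b_schwartz[OF schwartz_smooth_exp[OF r that]]
    by (intro abs_summable_summable[of "\<lambda>\<gamma>. b \<gamma> * smooth_exp (r k) z \<gamma>"]) (simp only: norm_mult)
  have TS: "infsum (T k) UNIV = S k" for k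
  proof -
    have "S k = (\<Sum>\<^sub>\<infinity>\<gamma>\<in>\<Gamma>. b \<gamma> * smooth_exp (r k) z \<gamma>) - (\<Sum>\<^sub>\<infinity>\<gamma>\<in>\<Gamma>. b \<gamma> * smooth_exp (r k) w \<gamma>)"
      unfolding S_def by (intro infsum_diff sE assms)
    also have "\<dots> = (\<Sum>\<^sub>\<infinity>n. of_real (exp (- (pi * (r k * a n)\<^sup>2))) / (2 * pi * \<i> * (of_real (a n) - z))
        - of_real (exp (- (pi * (r k * a n)\<^sup>2))) / (2 * pi * \<i> * (of_real (a n) - w)))"
      unfolding smoothed_cauchy_sum(2)[OF r assms(1), symmetric] smoothed_cauchy_sum(2)[OF r assms(2), symmetric]
      by (rule infsum_diff[symmetric, OF abs_summable_summable[OF smoothed_cauchy_sum(1)[OF r assms(1)]]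
            abs_summable_summable[OF smoothed_cauchy_sum(1)[OF r assms(2)]]])
    also have "\<dots> = infsum (T k) UNIV"
    proof (rule infsum_cong)
      fix n
      have e: "g / (2 * pi * \<i> * (x - z)) - g / (2 * pi * \<i> * (x - w)) = - (1 / (2 * pi * \<i>)) * (g * (1 / (z - x) - 1 / (w - x)))"
        if "x \<noteq> z" "x \<noteq> w" for g x :: complex
        using that by (simp add: divide_simps) (simp add: algebra_simps)
      show "of_real (exp (- (pi * (r k * a n)\<^sup>2))) / (2 * pi * \<i> * (of_real (a n) - z))
        - of_real (exp (- (pi * (r k * a n)\<^sup>2))) / (2 * pi * \<i> * (of_real (a n) - w)) = T k n"
        unfolding T_def D_def by (rule e; rule ne)
    qed
    finally show ?thesis by simp
  qed
  have L1: "(\<lambda>k. infsum (T k) UNIV) \<longlonglongrightarrow> (\<Sum>\<^sub>\<infinity>n. - (1 / (2 * pi * \<i>)) * D n)"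
  proof (rule infsum_dominated_convergence[where Y = UNIV and M = "\<lambda>n. 1 / (2 * pi) * norm (D n)"])
    show "(\<lambda>n. 1 / (2 * pi) * norm (D n)) summable_on UNIV" by (rule summable_on_cmult_right[OF sD])
    show "norm (T k n) \<le> 1 / (2 * pi) * norm (D n)" for k n
    proof -
      have "exp (- (pi * (r k * a n)\<^sup>2)) * norm (D n) \<le> 1 * norm (D n)" by (intro mult_right_mono) auto
      then show ?thesis by (simp add: T_def norm_mult norm_divide divide_right_mono)
    qed
    show "(\<lambda>k. T k n) \<longlonglongrightarrow> - (1 / (2 * pi * \<i>)) * D n" for n
    proof -
      have "(\<lambda>k. - (1 / (2 * pi * \<i>)) * (of_real (exp (- (pi * (r k * a n)\<^sup>2))) * D n)) \<longlonglongrightarrow> - (1 / (2 * pi * \<i>)) * (of_real (exp (- (pi * (0 * a n)\<^sup>2))) * D n)"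
        by (intro tendsto_intros r0)
      then show ?thesis by (simp add: T_def)
    qed
  qed auto
  obtain \<omega> where \<omega>: "\<And>z t. Im z > 0 \<Longrightarrow> (\<lambda>n. smooth_exp (inverse (real (Suc n))) z t) \<longlonglongrightarrow>
      (if t > 0 then exp (2 * pi * \<i> * z * of_real t) else if t < 0 then 0 else \<omega>)"
    using smooth_exp_limit by metis
  \<comment> \<open>The two values \<open>\<omega>\<close> at frequency 0 cancel because they do not
    depend on the point, and at negative frequencies both limits are 0.\<close>
  define l where "l \<gamma> = b \<gamma> * (if \<gamma> > 0 then exp (2 * pi * \<i> * z * of_real \<gamma>) - exp (2 * pi * \<i> * w * of_real \<gamma>) else 0)" for \<gamma>
  have L2: "S \<longlonglongrightarrow> infsum l \<Gamma>" unfolding S_def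
  proof (rule infsum_dominated_convergence[where Y = UNIV and
        M = "\<lambda>\<gamma>. smooth_exp_const (Im z) * (norm (b \<gamma>) * one_sided_decay (Im z) \<gamma>) + smooth_exp_const (Im w) * (norm (b \<gamma>) * one_sided_decay (Im w) \<gamma>)"])
    show "(\<lambda>\<gamma>. smooth_exp_const (Im z) * (norm (b \<gamma>) * one_sided_decay (Im z) \<gamma>) + smooth_exp_const (Im w) * (norm (b \<gamma>) * one_sided_decay (Im w) \<gamma>)) summable_on \<Gamma>"
      by (intro summable_on_add summable_on_cmult_right summable_b_one_sided_decay assms)
    have *: "norm (b \<gamma> * smooth_exp (r k) z \<gamma>) \<le> smooth_exp_const (Im z) * (norm (b \<gamma>) * one_sided_decay (Im z) \<gamma>)" if "Im z > 0" for z k \<gamma>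
      using mult_left_mono[OF smooth_exp_bound[OF r that, of k \<gamma>], of "norm (b \<gamma>)"] by (simp add: norm_mult mult_ac)
    show "norm (b \<gamma> * smooth_exp (r k) z \<gamma> - b \<gamma> * smooth_exp (r k) w \<gamma>) \<le>
        smooth_exp_const (Im z) * (norm (b \<gamma>) * one_sided_decay (Im z) \<gamma>) + smooth_exp_const (Im w) * (norm (b \<gamma>) * one_sided_decay (Im w) \<gamma>)" for \<gamma> k
      by (intro norm_triangle_le_diff add_mono * assms)
    show "(\<lambda>k. b \<gamma> * smooth_exp (r k) z \<gamma> - b \<gamma> * smooth_exp (r k) w \<gamma>) \<longlonglongrightarrow> l \<gamma>" for \<gamma>
    proof -
      have "(\<lambda>k. b \<gamma> * smooth_exp (r k) z \<gamma> - b \<gamma> * smooth_exp (r k) w \<gamma>) \<longlonglongrightarrow>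
         b \<gamma> * (if \<gamma> > 0 then exp (2 * pi * \<i> * z * of_real \<gamma>) else if \<gamma> < 0 then 0 else \<omega>)
         - b \<gamma> * (if \<gamma> > 0 then exp (2 * pi * \<i> * w * of_real \<gamma>) else if \<gamma> < 0 then 0 else \<omega>)"
        unfolding r_def by (intro tendsto_diff tendsto_mult_left \<omega> assms)
      then show ?thesis by (simp add: l_def algebra_simps split: if_splits)
    qed
  qed auto
  have "infsum l \<Gamma> = (\<Sum>\<^sub>\<infinity>\<gamma>\<in>pos_freqs. b \<gamma> * exp (2 * pi * \<i> * complex_of_real \<gamma> * z) - b \<gamma> * exp (2 * pi * \<i> * complex_of_real \<gamma> * w))"
    by (rule infsum_cong_neutral) (auto simp: pos_freqs_def l_def right_diff_distrib mult_ac)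
  also have "\<dots> = pos_series z - pos_series w" unfolding pos_series_def
    by (rule infsum_diff[OF abs_summable_summable[OF pos_series_abs_summable[OF assms(1)]]
          abs_summable_summable[OF pos_series_abs_summable[OF assms(2)]]])
  finally have lU: "infsum l \<Gamma> = pos_series z - pos_series w" .
  have "(\<Sum>\<^sub>\<infinity>n. - (1 / (2 * pi * \<i>)) * D n) = pos_series z - pos_series w"
    using LIMSEQ_unique[OF L1] L2 unfolding TS lU by simp
  then have "- (1 / (2 * pi * \<i>)) * infsum D UNIV = pos_series z - pos_series w"
    by (simp only: infsum_cmult_right')
  then show ?thesis unfolding D_def by (simp add: field_simps)
qed

subsection \<open>Counting points\<close>

lemma pos_series_shift:
  assumes "Im z > 0"
  shows "norm (pos_series (z + of_real \<tau>) - pos_series z)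
    \<le> (\<Sum>\<^sub>\<infinity>\<gamma>\<in>pos_freqs. (norm (b \<gamma>) * exp (- 2 * pi * Im z * \<gamma>)) * norm (cis (2 * pi * \<gamma> * \<tau>) - 1))"
proof -
  let ?e = "\<lambda>\<gamma> z. b \<gamma> * exp (2 * pi * \<i> * complex_of_real \<gamma> * z)"
  have im: "Im (z + of_real \<tau>) > 0" using assms by simp
  have eq: "?e \<gamma> (z + of_real \<tau>) - ?e \<gamma> z = ?e \<gamma> z * (cis (2 * pi * \<gamma> * \<tau>) - 1)" for \<gamma>
    by (simp add: cis_conv_exp exp_add algebra_simps)
  have n: "norm (?e \<gamma> z * (cis (2 * pi * \<gamma> * \<tau>) - 1)) = (norm (b \<gamma>) * exp (- 2 * pi * Im z * \<gamma>)) * norm (cis (2 * pi * \<gamma> * \<tau>) - 1)" for \<gamma>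
    by (simp add: norm_mult norm_exp_eq_Re mult_ac)
  have s: "(\<lambda>\<gamma>. norm (?e \<gamma> z * (cis (2 * pi * \<gamma> * \<tau>) - 1))) summable_on pos_freqs"
  proof (rule summable_on_comparison_test[OF summable_on_cmult_right[OF pos_series_abs_summable[OF assms], of 2]])
    show "norm (?e \<gamma> z * (cis (2 * pi * \<gamma> * \<tau>) - 1)) \<le> 2 * norm (?e \<gamma> z)" for \<gamma>
    proof -
      have "norm (?e \<gamma> z * (cis (2 * pi * \<gamma> * \<tau>) - 1)) = norm (?e \<gamma> z) * norm (cis (2 * pi * \<gamma> * \<tau>) - 1)"
        by (rule norm_mult)
      also have "\<dots> \<le> norm (?e \<gamma> z) * 2" by (rule mult_left_mono[OF norm_cis_minus_1_le norm_ge_zero])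
      finally show ?thesis by (simp only: mult.commute)
    qed
  qed auto
  have "pos_series (z + of_real \<tau>) - pos_series z = (\<Sum>\<^sub>\<infinity>\<gamma>\<in>pos_freqs. ?e \<gamma> (z + of_real \<tau>) - ?e \<gamma> z)"
    unfolding pos_series_def
    by (rule infsum_diff[symmetric, OF abs_summable_summable[OF pos_series_abs_summable[OF im]] abs_summable_summable[OF pos_series_abs_summable[OF assms]]])
  also have "\<dots> = (\<Sum>\<^sub>\<infinity>\<gamma>\<in>pos_freqs. ?e \<gamma> z * (cis (2 * pi * \<gamma> * \<tau>) - 1))" by (simp only: eq)
  also have "norm \<dots> \<le> (\<Sum>\<^sub>\<infinity>\<gamma>\<in>pos_freqs. norm (?e \<gamma> z * (cis (2 * pi * \<gamma> * \<tau>) - 1)))"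
    by (rule norm_infsum_bound[OF s])
  finally show ?thesis by (simp only: n)
qed

definition poisson_sum where "poisson_sum y x = (\<Sum>\<^sub>\<infinity>n. y / ((x - a n)\<^sup>2 + y\<^sup>2))"

lemma summable_inverse_square: "(\<lambda>n. 1 / (1 + (a n - x)\<^sup>2)) summable_on UNIV"
  using cauchy_sum_bound by metis

lemma poisson_summable:
  assumes "y > 0"
  shows "(\<lambda>n. y / ((x - a n)\<^sup>2 + y\<^sup>2)) summable_on UNIV"
proof -
  have "(\<lambda>n. y * (2 + (1 + 2 * (\<bar>x\<bar>\<^sup>2 + y\<^sup>2)) / y\<^sup>2) * (1 / (1 + (a n - 0)\<^sup>2))) summable_on UNIV"
    by (rule summable_on_cmult_right[OF summable_inverse_square])
  then show ?thesis
    by (rule summable_on_comparison_test) (use poisson_kernel_bound[OF assms, of x "\<bar>x\<bar>"] assms in auto)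
qed

text \<open>This is the imaginary part of the difference identity at a point and its translate. The
  right-hand side does not contain \<open>x\<close>, so one almost period of the frequencies works
  for all \<open>x\<close> simultaneously.\<close>

lemma poisson_sum_shift:
  assumes "y > 0"
  shows "\<bar>poisson_sum y (x + \<tau>) - poisson_sum y x\<bar>
    \<le> 2 * pi * (\<Sum>\<^sub>\<infinity>\<gamma>\<in>pos_freqs. (norm (b \<gamma>) * exp (- 2 * pi * y * \<gamma>)) * norm (cis (2 * pi * \<gamma> * \<tau>) - 1))"
proof -
  define z where "z = Complex x y"
  define w where "w = z + of_real \<tau>"
  have zw: "Im z > 0" "Im w > 0" using assms by (auto simp: z_def w_def)
  define D where "D n = 1 / (w - complex_of_real (a n)) - 1 / (z - of_real (a n))" for n
  have k: "Im (1 / (Complex u y - of_real v)) = - (y / ((u - v)\<^sup>2 + y\<^sup>2))" for u v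
    by (simp add: Im_divide)
  have w: "w = Complex (x + \<tau>) y" by (simp add: w_def z_def complex_eq_iff)
  have ImD: "Im (D n) = - (y / ((x + \<tau> - a n)\<^sup>2 + y\<^sup>2) - y / ((x - a n)\<^sup>2 + y\<^sup>2))" for n
    unfolding D_def w z_def minus_complex.sel k by simp
  have sD: "D summable_on UNIV" unfolding D_def
    by (rule abs_summable_summable[OF summable_cauchy_difference[OF zw(2,1)]])
  have "((\<lambda>n. Im (D n)) has_sum Im (infsum D UNIV)) UNIV"
    by (rule has_sum_Im[OF has_sum_infsum[OF sD]])
  then have "Im (infsum D UNIV) = (\<Sum>\<^sub>\<infinity>n. Im (D n))" by (rule infsumI[symmetric])
  also have "\<dots> = - (poisson_sum y (x + \<tau>) - poisson_sum y x)"
    unfolding ImD infsum_uminus poisson_sum_def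
    by (simp only: infsum_diff[OF poisson_summable[OF assms] poisson_summable[OF assms]])
  finally have "\<bar>poisson_sum y (x + \<tau>) - poisson_sum y x\<bar> = \<bar>Im (infsum D UNIV)\<bar>" by simp
  also have "\<dots> \<le> norm (infsum D UNIV)" by (rule abs_Im_le_cmod)
  also have "infsum D UNIV = - (2 * pi * \<i>) * (pos_series w - pos_series z)"
    unfolding D_def by (rule cauchy_sum_difference[OF zw(2,1)])
  also have "norm \<dots> = 2 * pi * norm (pos_series w - pos_series z)" by (simp add: norm_mult)
  also have "norm (pos_series w - pos_series z) \<le> (\<Sum>\<^sub>\<infinity>\<gamma>\<in>pos_freqs. (norm (b \<gamma>) * exp (- 2 * pi * y * \<gamma>)) * norm (cis (2 * pi * \<gamma> * \<tau>) - 1))"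
    using pos_series_shift[OF zw(1), of \<tau>] unfolding w_def by (simp add: z_def)
  finally show ?thesis by simp
qed

lemma poisson_almost_periods:
  assumes "y > 0" "\<eta> > 0"
  shows "\<exists>L>0. \<forall>x0. \<exists>\<tau>\<in>{x0..x0+L}. \<forall>x. \<bar>poisson_sum y (x + \<tau>) - poisson_sum y x\<bar> \<le> \<eta>"
proof -
  have "\<eta> / (2 * pi) > 0" using assms by simp
  \<comment> \<open>The spare frequency is set to 0, which makes its condition void.\<close>
  from common_almost_periods_weighted[OF summable_b_exp[OF assms(1)] _ this, of "\<lambda>\<gamma>. 2 * pi * \<gamma>" 0]
  obtain L where L: "L > 0" "\<And>x0. \<exists>\<tau>\<in>{x0..x0+L}. (\<Sum>\<^sub>\<infinity>\<gamma>\<in>pos_freqs. (norm (b \<gamma>) * exp (- 2 * pi * y * \<gamma>)) * norm (cis (2 * pi * \<gamma> * \<tau>) - 1)) < \<eta> / (2 * pi)"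
    by fastforce
  have "\<bar>poisson_sum y (x + \<tau>) - poisson_sum y x\<bar> \<le> \<eta>"
    if "(\<Sum>\<^sub>\<infinity>\<gamma>\<in>pos_freqs. (norm (b \<gamma>) * exp (- 2 * pi * y * \<gamma>)) * norm (cis (2 * pi * \<gamma> * \<tau>) - 1)) < \<eta> / (2 * pi)" for x \<tau>
  proof -
    have "2 * pi * (\<Sum>\<^sub>\<infinity>\<gamma>\<in>pos_freqs. (norm (b \<gamma>) * exp (- 2 * pi * y * \<gamma>)) * norm (cis (2 * pi * \<gamma> * \<tau>) - 1)) \<le> 2 * pi * (\<eta> / (2 * pi))"
      using that by (intro mult_left_mono) auto
    also have "\<dots> = \<eta>" by simp
    finally show ?thesis using poisson_sum_shift[OF assms(1), of x \<tau>] by linarith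
  qed
  then show ?thesis using L by meson
qed

section \<open>Smoothed and exact counts of points\<close>

definition weight_sum where "weight_sum y p q = (\<Sum>\<^sub>\<infinity>n. arctan_weight y p q (a n))"

lemma weight_summable:
  assumes "y > 0" "p \<le> q"
  shows "(\<lambda>n. arctan_weight y p q (a n)) summable_on UNIV"
proof -
  have "(\<lambda>n. 1 / (1 + (a n)\<^sup>2)) summable_on UNIV" using summable_inverse_square[of 0] by simp
  then obtain J where "((\<lambda>n. arctan_weight y p q (a n)) has_sum J) UNIV"
    using arctan_weight_sum_integral[OF assms] by blast
  then show ?thesis by (rule has_sum_imp_summable)
qed

text \<open>The weights are integrals of Poisson kernels over \<open>{p..q}\<close>, so the
  pointwise estimate integrates; translating the interval by \<open>\<tau>\<close> amounts to
  translating the points by \<open>- \<tau>\<close>.\<close>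

lemma weight_sum_shift:
  assumes "y > 0" "p \<le> q" "\<eta> \<ge> 0" and \<tau>: "\<And>x. \<bar>poisson_sum y (x + \<tau>) - poisson_sum y x\<bar> \<le> \<eta>"
  shows "\<bar>weight_sum y (p + \<tau>) (q + \<tau>) - weight_sum y p q\<bar> \<le> \<eta> * (q - p)"
proof -
  have s: "(\<lambda>n. 1 / (1 + (a n)\<^sup>2)) summable_on UNIV" using summable_inverse_square[of 0] by simp
  obtain J where J: "((\<lambda>n. arctan_weight y p q (a n)) has_sum J) UNIV"
    "((\<lambda>u. \<Sum>\<^sub>\<infinity>n. y / ((u - a n)\<^sup>2 + y\<^sup>2)) has_integral J) {p..q}"
    using arctan_weight_sum_integral[OF assms(1,2) s] by blast
  obtain J' where J': "((\<lambda>n. arctan_weight y p q (a n - \<tau>)) has_sum J') UNIV"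
    "((\<lambda>u. \<Sum>\<^sub>\<infinity>n. y / ((u - (a n - \<tau>))\<^sup>2 + y\<^sup>2)) has_integral J') {p..q}"
    using arctan_weight_sum_integral[OF assms(1,2) summable_inverse_square[of \<tau>]] by blast
  have "arctan_weight y p q (a n - \<tau>) = arctan_weight y (p + \<tau>) (q + \<tau>) (a n)" for n
    by (simp add: arctan_weight_def algebra_simps)
  then have w: "weight_sum y p q = J" "weight_sum y (p + \<tau>) (q + \<tau>) = J'"
    using J(1) J'(1) unfolding weight_sum_def by (simp_all add: infsumI)
  have i: "((\<lambda>u. poisson_sum y (u + \<tau>)) has_integral J') {p..q}" "(poisson_sum y has_integral J) {p..q}"
    unfolding poisson_sum_def using J(2) J'(2) by (simp_all only: diff_diff_eq2)
  have "((\<lambda>u. poisson_sum y (u + \<tau>) - poisson_sum y u) has_integral (J' - J)) (cbox p q)"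
    using has_integral_diff[OF i] by simp
  then have "norm (J' - J) \<le> \<eta> * measure lborel (cbox p q)"
    by (rule has_integral_bound[OF assms(3)]) (use \<tau> in auto)
  then show ?thesis using w assms(2) by simp
qed

text \<open>Open at the left end only, so that counts over adjacent intervals add up even when
  points lie at the common end.\<close>

definition point_count :: "real \<Rightarrow> real \<Rightarrow> real" where
  "point_count p q = real (card {n. p < a n \<and> a n \<le> q})"

text \<open>A point of the interval lies within \<open>D\<close> of \<open>p\<close> and so
  contributes at least \<open>1 / (1 + D\<^sup>2)\<close> to the sum centred at \<open>p\<close>;
  the bound \<open>B\<close> for that sum is the same everywhere on the line.\<close>

lemma count_bound:
  obtains B where "B \<ge> 0" "\<And>x. (\<Sum>\<^sub>\<infinity>n. 1 / (1 + (a n - x)\<^sup>2)) \<le> B"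
    "\<And>p q. finite {n. p \<le> a n \<and> a n \<le> q}"
    "\<And>p q D. q - p \<le> D \<Longrightarrow> D \<ge> 0 \<Longrightarrow> real (card {n. p \<le> a n \<and> a n \<le> q}) \<le> B * (1 + D\<^sup>2)"
proof -
  obtain B where B: "\<And>x. (\<Sum>\<^sub>\<infinity>n. 1 / (1 + (a n - x)\<^sup>2)) \<le> B"
    using cauchy_sum_bound by metis
  have B0: "B \<ge> 0" using order.trans[OF infsum_nonneg B[of 0]] by simp
  have fin: "real (card X) \<le> B * (1 + D\<^sup>2)"
    if X: "finite X" "X \<subseteq> {n. p \<le> a n \<and> a n \<le> q}" and D: "q - p \<le> D" "D \<ge> 0" for X p q D
  proof -
    have pos: "1 + D\<^sup>2 > 0" by (simp add: add_pos_nonneg)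
    have "real (card X) * (1 / (1 + D\<^sup>2)) = (\<Sum>n\<in>X. 1 / (1 + D\<^sup>2))" by simp
    also have "\<dots> \<le> (\<Sum>n\<in>X. 1 / (1 + (a n - p)\<^sup>2))"
    proof (intro sum_mono divide_left_mono)
      fix n assume "n \<in> X"
      then have "(a n - p)\<^sup>2 \<le> D\<^sup>2" using X D by (intro power_mono) auto
      then show "1 + (a n - p)\<^sup>2 \<le> 1 + D\<^sup>2" by simp
      show "0 < (1 + D\<^sup>2) * (1 + (a n - p)\<^sup>2)" by (intro mult_pos_pos add_pos_nonneg) auto
    qed auto
    also have "\<dots> \<le> (\<Sum>\<^sub>\<infinity>n. 1 / (1 + (a n - p)\<^sup>2))"
      using X by (intro finite_sum_le_infsum summable_inverse_square) auto
    also have "\<dots> \<le> B" by (rule B)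
    finally show ?thesis using pos by (simp add: field_simps)
  qed
  have finite: "finite {n. p \<le> a n \<and> a n \<le> q}" for p q
  proof (rule ccontr)
    define D where "D = max 0 (q - p)"
    assume "infinite {n. p \<le> a n \<and> a n \<le> q}"
    \<comment> \<open>\<open>card\<close> says nothing about an infinite set, so finiteness is shown
      through a finite subset exceeding the bound.\<close>
    then obtain X where X: "X \<subseteq> {n. p \<le> a n \<and> a n \<le> q}" "finite X" "card X = nat \<lceil>B * (1 + D\<^sup>2)\<rceil> + 1"
      using infinite_arbitrarily_large by blast
    have "real (card X) \<le> B * (1 + D\<^sup>2)" by (rule fin[OF X(2,1)]) (auto simp: D_def)
    then show False using X(3) by linarith
  qed
  show ?thesis by (rule that[OF B0 B finite fin[OF finite subset_refl]])
qed

lemma finite_between: "finite {n. p \<le> a n \<and> a n \<le> q}"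
  using count_bound by metis

lemma finite_point_count: "finite {n. p < a n \<and> a n \<le> q}"
  by (rule finite_subset[OF _ finite_between[of p q]]) auto

lemma point_count_add:
  assumes "p \<le> q" "q \<le> r"
  shows "point_count p r = point_count p q + point_count q r"
proof -
  have "{n. p < a n \<and> a n \<le> r} = {n. p < a n \<and> a n \<le> q} \<union> {n. q < a n \<and> a n \<le> r}"
    using assms by auto
  moreover have "{n. p < a n \<and> a n \<le> q} \<inter> {n. q < a n \<and> a n \<le> r} = {}" by auto
  ultimately have "card {n. p < a n \<and> a n \<le> r} = card {n. p < a n \<and> a n \<le> q} + card {n. q < a n \<and> a n \<le> r}"
    using card_Un_disjoint[OF finite_point_count finite_point_count] by simp
  then show ?thesis by (simp add: point_count_def)
qed

lemma point_count_mono: "p' \<le> p \<Longrightarrow> q \<le> q' \<Longrightarrow> point_count p q \<le> point_count p' q'"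
  unfolding point_count_def by (intro of_nat_mono card_mono finite_point_count) auto

lemma weight_sum_lower:
  assumes "y > 0" "d > 0" "p \<le> q" "finite X" "\<And>n. n \<in> X \<Longrightarrow> p + d \<le> a n \<and> a n \<le> q - d"
  shows "real (card X) * (pi - 2 * y / d) \<le> weight_sum y p q"
proof -
  have "real (card X) * (pi - 2 * y / d) = (\<Sum>n\<in>X. pi - 2 * y / d)" by simp
  also have "\<dots> \<le> (\<Sum>n\<in>X. arctan_weight y p q (a n))"
    using assms by (intro sum_mono arctan_weight_inside) auto
  also have "\<dots> \<le> weight_sum y p q"
    unfolding weight_sum_def using assms
    by (intro finite_sum_le_infsum weight_summable arctan_weight_nonneg) auto
  finally show ?thesis .
qed

text \<open>Points in \<open>X\<close> are charged the full weight \<open>pi\<close>, wherever they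
  lie; all others are at distance at least \<open>d\<close> from the interval and enter through two
  quadratic tails, each a multiple of a sum bounded by \<open>B\<close>.\<close>

lemma weight_sum_upper:
  assumes "y > 0" "d > 0" "p \<le> q" "finite X"
    and B: "\<And>x. (\<Sum>\<^sub>\<infinity>n. 1 / (1 + (a n - x)\<^sup>2)) \<le> B"
    and X: "\<And>n. n \<notin> X \<Longrightarrow> a n \<le> p - d \<or> a n \<ge> q + d"
  shows "weight_sum y p q \<le> real (card X) * pi + (q - p) * y * (1 + 1 / d\<^sup>2) * (2 * B)"
proof -
  define K where "K = (q - p) * y * (1 + 1 / d\<^sup>2)"
  have K: "K \<ge> 0" using assms by (simp add: K_def)
  define g where "g n = (if n \<in> X then pi else 0)" for n
  define h where "h n = K * (1 / (1 + (a n - p)\<^sup>2)) + K * (1 / (1 + (a n - q)\<^sup>2))" for n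
  have h0: "h n \<ge> 0" "K * (1 / (1 + (a n - p)\<^sup>2)) \<ge> 0" "K * (1 / (1 + (a n - q)\<^sup>2)) \<ge> 0" for n
    using K by (auto simp: h_def)
  have le: "arctan_weight y p q (a n) \<le> g n + h n" for n
  proof (cases "n \<in> X")
    case True
    then show ?thesis using arctan_weight_le_pi[of y p q "a n"] h0(1)[of n] by (simp add: g_def)
  next
    case False
    then consider "a n \<le> p - d" | "a n \<ge> q + d" using X by blast
    then show ?thesis
    proof cases
      case 1
      then show ?thesis using arctan_weight_left[OF assms(1-3), of "a n"] False h0(3)[of n]
        unfolding g_def h_def K_def by simp
    next
      case 2
      then show ?thesis using arctan_weight_right[OF assms(1-3), of "a n"] False h0(2)[of n]
        unfolding g_def h_def K_def by simp
    qed
  qed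
  have sg: "g summable_on UNIV" "infsum g UNIV = real (card X) * pi"
  proof -
    have "g summable_on X" "infsum g X = real (card X) * pi"
      using assms(4) by (auto simp: g_def)
    moreover have "(g summable_on UNIV) = (g summable_on X)"
      by (rule summable_on_cong_neutral) (auto simp: g_def)
    moreover have "infsum g UNIV = infsum g X"
      by (rule infsum_cong_neutral) (auto simp: g_def)
    ultimately show "g summable_on UNIV" "infsum g UNIV = real (card X) * pi" by simp_all
  qed
  have s1: "(\<lambda>n. K * (1 / (1 + (a n - x)\<^sup>2))) summable_on UNIV" for x
    by (rule summable_on_cmult_right[OF summable_inverse_square])
  have i1: "(\<Sum>\<^sub>\<infinity>n. K * (1 / (1 + (a n - x)\<^sup>2))) \<le> K * B" for x
    unfolding infsum_cmult_right' by (rule mult_left_mono[OF B K])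
  have sh: "h summable_on UNIV" unfolding h_def by (rule summable_on_add[OF s1 s1])
  have ih: "infsum h UNIV \<le> K * (2 * B)"
    unfolding h_def infsum_add[OF s1 s1] using i1[of p] i1[of q] by simp
  have "weight_sum y p q \<le> (\<Sum>\<^sub>\<infinity>n. g n + h n)"
    unfolding weight_sum_def
    by (rule infsum_mono[OF weight_summable[OF assms(1,3)] summable_on_add[OF sg(1) sh] le])
  also have "\<dots> = infsum g UNIV + infsum h UNIV" by (rule infsum_add[OF sg(1) sh])
  finally show ?thesis using ih unfolding sg K_def by linarith
qed

text \<open>Integrality enters here: for points that stay away from the end points of a cell, a smoothed
  count determines the exact count, so an almost period of the smoothed count preserves the number
  of points in the cell exactly.\<close>

lemma cell_count:
  assumes B: "\<And>x. (\<Sum>\<^sub>\<infinity>n. 1 / (1 + (a n - x)\<^sup>2)) \<le> B"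
    and M: "\<And>p q. q - p \<le> 2 \<Longrightarrow> point_count p q \<le> M"
    and pq: "p \<le> q" "q - p \<le> 2" and \<delta>: "0 < \<delta>" "\<delta> \<le> 1"
    and sep: "\<And>n. \<bar>a n - p\<bar> \<ge> \<delta>" "\<And>n. \<bar>a n - q\<bar> \<ge> \<delta>"
    and y: "y > 0" and \<eta>: "\<eta> \<ge> 0"
    and small: "3 * y * (1 + 1 / (\<delta> / 2)\<^sup>2) * (2 * B) + 3 * \<eta> + M * (2 * y / (\<delta> / 2)) \<le> 1"
    and \<tau>: "\<And>x. \<bar>poisson_sum y (x + \<tau>) - poisson_sum y x\<bar> \<le> \<eta>"
  shows "point_count (p + \<tau>) (q + \<tau>) = point_count p q"
proof -
  \<comment> \<open>Half of the separation: moving an end point of the cell by \<open>d\<close>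
    still leaves it at distance at least \<open>d\<close> from all points.\<close>
  define d where "d = \<delta> / 2"
  define X where "X = {n. p < a n \<and> a n \<le> q}"
  define X' where "X' = {n. p + \<tau> < a n \<and> a n \<le> q + \<tau>}"
  have fX: "finite X" "finite X'" unfolding X_def X'_def by (rule finite_point_count)+
  have c: "point_count p q = real (card X)" "point_count (p + \<tau>) (q + \<tau>) = real (card X')"
    by (auto simp: point_count_def X_def X'_def)
  have d: "d > 0" using \<delta> by (simp add: d_def)
  have B0: "B \<ge> 0" using order.trans[OF infsum_nonneg B[of 0]] by simp
  have e: "(q' - p') * y * (1 + 1 / d\<^sup>2) * (2 * B) \<le> 3 * y * (1 + 1 / d\<^sup>2) * (2 * B)" if "q' - p' \<le> 3" for p' q'
    using that y B0 by (intro mult_right_mono) auto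
  have \<eta>3: "\<eta> * (q' - p') \<le> 3 * \<eta>" if "q' - p' \<le> 3" for p' q'
    using mult_left_mono[OF that \<eta>] by (simp add: mult.commute)
  have far: "a n \<le> p - \<delta> \<or> a n \<ge> p + \<delta>" "a n \<le> q - \<delta> \<or> a n \<ge> q + \<delta>" for n
    using sep(1)[of n] sep(2)[of n] by linarith+
  have k: "real (card X) * (2 * y / d) \<le> M * (2 * y / d)" "real (card X') * (2 * y / d) \<le> M * (2 * y / d)"
    using M[of q p] M[of "q + \<tau>" "p + \<tau>"] pq y d unfolding c by (intro mult_right_mono; simp)+
  have small': "3 * y * (1 + 1 / d\<^sup>2) * (2 * B) + 3 * \<eta> + M * (2 * y / d) \<le> 1"
    using small by (simp only: d_def)
  \<comment> \<open>The cell is enlarged by \<open>d\<close>: then all of \<open>X'\<close> lies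
    deep enough in the translated cell although nothing is known about points near its ends, while
    the separation at \<open>p\<close> and \<open>q\<close> keeps the points outside
    \<open>X\<close> away from the original one.\<close>
  have "card X' \<le> card X"
  proof -
    have pq': "p - d \<le> q + d" "(q + d) - (p - d) \<le> 3" using pq d \<delta> by (auto simp: d_def)
    have "real (card X') * (pi - 2 * y / d) \<le> weight_sum y (p - d + \<tau>) (q + d + \<tau>)"
      using pq d by (intro weight_sum_lower[OF y d _ fX(2)]) (auto simp: X'_def)
    also have "\<dots> \<le> weight_sum y (p - d) (q + d) + 3 * \<eta>"
      using weight_sum_shift[OF y pq'(1) \<eta> \<tau>] \<eta>3[OF pq'(2)] by linarith
    also have "weight_sum y (p - d) (q + d) \<le> real (card X) * pi + ((q + d) - (p - d)) * y * (1 + 1 / d\<^sup>2) * (2 * B)"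
    proof (rule weight_sum_upper[OF y d pq'(1) fX(1) B])
      fix n assume "n \<notin> X"
      then show "a n \<le> p - d - d \<or> a n \<ge> q + d + d"
        using far[of n] \<delta> unfolding X_def d_def by auto
    qed
    finally have "real (card X') * (pi - 2 * y / d)
        \<le> real (card X) * pi + ((q + d) - (p - d)) * y * (1 + 1 / d\<^sup>2) * (2 * B) + 3 * \<eta>" by simp
    then have "real (card X') * pi \<le> real (card X) * pi + 1"
      using e[OF pq'(2)] k(2) small' unfolding right_diff_distrib[of "real (card X')" pi "2 * y / d"] by linarith
    then have "(real (card X') - real (card X)) * pi \<le> 1" by (simp add: algebra_simps)
    show ?thesis
    proof (rule ccontr)
      assume "\<not> card X' \<le> card X"
      \<comment> \<open>One extra point would cost \<open>pi\<close>, but all errors together are at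
        most 1.\<close>
      then have "1 * pi \<le> (real (card X') - real (card X)) * pi" by (intro mult_right_mono) auto
      then show False using \<open>(real (card X') - real (card X)) * pi \<le> 1\<close> pi_gt3 by linarith
    qed
  qed
  \<comment> \<open>Here the cell is shrunk by \<open>d\<close>, with the roles exchanged: the
    separation puts \<open>X\<close> deep inside, and every point outside \<open>X'\<close> is
    automatically at distance \<open>d\<close> from the shrunken translate. The empty case is set
    aside because the shrunken cell might be inverted.\<close>
  moreover have "card X \<le> card X'"
  proof (cases "X = {}")
    case False
    then obtain n where "n \<in> X" by blast
    then have "p + \<delta> \<le> a n" "a n \<le> q - \<delta>" using far[of n] \<delta> unfolding X_def by auto
    then have pq': "p + d \<le> q - d" "(q - d) - (p + d) \<le> 3" using pq d by (auto simp: d_def)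
    have "real (card X) * (pi - 2 * y / d) \<le> weight_sum y (p + d) (q - d)"
    proof (rule weight_sum_lower[OF y d pq'(1) fX(1)])
      fix n assume "n \<in> X"
      then show "p + d + d \<le> a n \<and> a n \<le> q - d - d"
        using far[of n] \<delta> unfolding X_def d_def by auto
    qed
    also have "\<dots> \<le> weight_sum y (p + d + \<tau>) (q - d + \<tau>) + 3 * \<eta>"
      using weight_sum_shift[OF y pq'(1) \<eta> \<tau>] \<eta>3[OF pq'(2)] by linarith
    also have "weight_sum y (p + d + \<tau>) (q - d + \<tau>) \<le> real (card X') * pi + ((q - d + \<tau>) - (p + d + \<tau>)) * y * (1 + 1 / d\<^sup>2) * (2 * B)"
      using pq' by (intro weight_sum_upper[OF y d _ fX(2) B]) (auto simp: X'_def)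
    finally have "real (card X) * (pi - 2 * y / d)
        \<le> real (card X') * pi + ((q - d + \<tau>) - (p + d + \<tau>)) * y * (1 + 1 / d\<^sup>2) * (2 * B) + 3 * \<eta>" by simp
    moreover have "(q - d + \<tau>) - (p + d + \<tau>) \<le> 3" using pq'(2) by simp
    ultimately have "real (card X) * pi \<le> real (card X') * pi + 1"
      using e[of "q - d + \<tau>" "p + d + \<tau>"] k(1) small' unfolding right_diff_distrib[of "real (card X)" pi "2 * y / d"] by linarith
    then have "(real (card X) - real (card X')) * pi \<le> 1" by (simp add: algebra_simps)
    show ?thesis
    proof (rule ccontr)
      assume "\<not> card X \<le> card X'"
      then have "1 * pi \<le> (real (card X) - real (card X')) * pi" by (intro mult_right_mono) auto
      then show False using \<open>(real (card X) - real (card X')) * pi \<le> 1\<close> pi_gt3 by linarith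
    qed
  qed simp
  ultimately show ?thesis unfolding c by simp
qed

text \<open>Pigeonhole: \<open>M + 1\<close> disjoint intervals of radius \<open>\<delta>\<close>
  fit into the unit interval starting at \<open>j\<close>, which holds at most \<open>2 * B\<close>
  points; so some centre has no point within \<open>\<delta>\<close>. What counts is that
  \<open>\<delta>\<close> is the same for all \<open>j\<close>, so that one almost period serves all
  cells.\<close>

lemma cut_points:
  obtains \<delta> P where "0 < \<delta>" "\<delta> \<le> 1" "\<And>j::int. of_int j \<le> P j \<and> P j \<le> of_int j + 1"
    "\<And>j n. \<bar>a n - P j\<bar> \<ge> \<delta>"
proof -
  obtain B where B: "B \<ge> 0" "\<And>p q D. q - p \<le> D \<Longrightarrow> D \<ge> 0 \<Longrightarrow> real (card {n. p \<le> a n \<and> a n \<le> q}) \<le> B * (1 + D\<^sup>2)"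
    using count_bound by metis
  define M where "M = nat \<lceil>2 * B\<rceil>"
  define \<delta> where "\<delta> = 1 / (2 * (real M + 1))"
  have \<delta>: "0 < \<delta>" "\<delta> \<le> 1" "2 * (real M + 1) * \<delta> = 1" by (auto simp: \<delta>_def field_simps)
  have "\<exists>p. of_int j \<le> p \<and> p \<le> of_int j + 1 \<and> (\<forall>n. \<bar>a n - p\<bar> \<ge> \<delta>)" for j :: int
  proof (rule ccontr)
    assume no: "\<not> ?thesis"
    define c where "c i = of_int j + (2 * real i + 1) * \<delta>" for i :: nat
    have c: "of_int j + \<delta> \<le> c i \<and> c i \<le> of_int j + 1 - \<delta>" if "i \<le> M" for i
    proof -
      have "(2 * real i + 1) * \<delta> \<le> (2 * real M + 1) * \<delta>" using that \<delta> by (intro mult_right_mono) auto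
      moreover have "1 * \<delta> \<le> (2 * real i + 1) * \<delta>" using \<delta> by (intro mult_right_mono) auto
      moreover have "(2 * real M + 1) * \<delta> = 1 - \<delta>" using \<delta>(3) by (simp add: algebra_simps)
      ultimately show ?thesis unfolding c_def by linarith
    qed
    have "\<exists>n. \<bar>a n - c i\<bar> < \<delta>" if "i \<le> M" for i
    proof -
      have "of_int j \<le> c i" "c i \<le> of_int j + 1" using c[OF that] \<delta>(1) by linarith+
      then show ?thesis using no by (meson linorder_not_le)
    qed
    then obtain N where N: "\<And>i. i \<le> M \<Longrightarrow> \<bar>a (N i) - c i\<bar> < \<delta>" by metis
    have "inj_on N {..M}"
    proof (rule linorder_inj_onI)
      fix i k assume ik: "i < k" "i \<in> {..M}" "k \<in> {..M}"
      have "(2 * (real i + 1) + 1) * \<delta> \<le> (2 * real k + 1) * \<delta>"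
        using ik \<delta> by (intro mult_right_mono) auto
      then have "c i + 2 * \<delta> \<le> c k" unfolding c_def by (simp add: algebra_simps)
      then show "N i \<noteq> N k" using N[of i] N[of k] ik by fastforce
    qed auto
    then have cN: "card (N ` {..M}) = M + 1" by (simp add: card_image)
    have sub: "N ` {..M} \<subseteq> {n. of_int j \<le> a n \<and> a n \<le> of_int j + 1}"
    proof
      fix n assume "n \<in> N ` {..M}"
      then obtain i where "i \<le> M" "n = N i" by auto
      then show "n \<in> {n. of_int j \<le> a n \<and> a n \<le> of_int j + 1}"
        using N[of i] c[of i] by (auto simp: abs_less_iff)
    qed
    have "M + 1 \<le> card {n. of_int j \<le> a n \<and> a n \<le> of_int j + 1}"
      using card_mono[OF finite_between sub] cN by simp
    moreover have "real (card {n. of_int j \<le> a n \<and> a n \<le> of_int j + 1}) \<le> B * (1 + 1\<^sup>2)"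
      by (rule B(2)) auto
    ultimately have "real M + 1 \<le> 2 * B" by simp
    then show False unfolding M_def by linarith
  qed
  then obtain P where "\<And>j::int. of_int j \<le> P j \<and> P j \<le> of_int j + 1 \<and> (\<forall>n. \<bar>a n - P j\<bar> \<ge> \<delta>)" by metis
  then show ?thesis using that[of \<delta> P] \<delta> by blast
qed

lemma point_count_le_perturb:
  assumes K: "\<And>s t. t - s \<le> D \<Longrightarrow> point_count s t \<le> K" and "\<bar>p - p'\<bar> \<le> D" "\<bar>q - q'\<bar> \<le> D"
  shows "point_count p q \<le> point_count p' q' + 2 * K"
proof -
  have "{n. p < a n \<and> a n \<le> q} \<subseteq> {n. p' < a n \<and> a n \<le> q'} \<union> ({n. p < a n \<and> a n \<le> p'} \<union> {n. q' < a n \<and> a n \<le> q})"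
    by auto
  then have "card {n. p < a n \<and> a n \<le> q} \<le> card ({n. p' < a n \<and> a n \<le> q'} \<union> ({n. p < a n \<and> a n \<le> p'} \<union> {n. q' < a n \<and> a n \<le> q}))"
    by (intro card_mono) (auto intro: finite_point_count)
  also have "\<dots> \<le> card {n. p' < a n \<and> a n \<le> q'} + (card {n. p < a n \<and> a n \<le> p'} + card {n. q' < a n \<and> a n \<le> q})"
    by (intro order.trans[OF card_Un_le] add_left_mono card_Un_le)
  finally have "point_count p q \<le> point_count p' q' + (point_count p p' + point_count q' q)" unfolding point_count_def by linarith
  moreover have "point_count p p' \<le> K" "point_count q' q \<le> K" using assms by (intro K; linarith)+
  ultimately show ?thesis by linarith
qed

text \<open>Between two cut points an almost period preserves the count exactly, cell by cell, so no
  error accumulates with the length \<open>h\<close>. Any translation lies within \<open>L\<close>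
  of an almost period; the only loss is at the two ends, when \<open>x\<close> and
  \<open>x + h\<close> are moved to cut points and \<open>\<tau>\<close> is compared with
  \<open>x' - x\<close>.\<close>

lemma point_count_translation_bounded:
  obtains C where "C \<ge> 0" "\<And>x x' h. h \<ge> 0 \<Longrightarrow> \<bar>point_count x (x + h) - point_count x' (x' + h)\<bar> \<le> C"
proof -
  obtain B where B: "B \<ge> 0" "\<And>x. (\<Sum>\<^sub>\<infinity>n. 1 / (1 + (a n - x)\<^sup>2)) \<le> B"
    "\<And>p q. finite {n. p \<le> a n \<and> a n \<le> q}"
    "\<And>p q D. q - p \<le> D \<Longrightarrow> D \<ge> 0 \<Longrightarrow> real (card {n. p \<le> a n \<and> a n \<le> q}) \<le> B * (1 + D\<^sup>2)"
    by (rule count_bound) blast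
  have K: "point_count s t \<le> B * (1 + D\<^sup>2)" if "t - s \<le> D" "D \<ge> 0" for s t D
  proof -
    have "point_count s t \<le> real (card {n. s \<le> a n \<and> a n \<le> t})"
      unfolding point_count_def by (intro of_nat_mono card_mono finite_between) auto
    also have "\<dots> \<le> B * (1 + D\<^sup>2)" by (rule B(4)[OF that])
    finally show ?thesis .
  qed
  obtain \<delta> P where P: "0 < \<delta>" "\<delta> \<le> 1" "\<And>j::int. of_int j \<le> P j \<and> P j \<le> of_int j + 1"
    "\<And>j n. \<bar>a n - P j\<bar> \<ge> \<delta>" by (rule cut_points) blast
  define M where "M = B * (1 + 2\<^sup>2)"
  \<comment> \<open>\<open>y * Z\<close> is the part of the error in \<open>cell_count\<close> that
    depends on \<open>y\<close>; it is made at most 1/2, and the tolerance 1/6 for the almost period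
    accounts for the other half.\<close>
  define Z where "Z = 3 * (1 + 1 / (\<delta> / 2)\<^sup>2) * (2 * B) + M * (2 / (\<delta> / 2))"
  have Z: "Z \<ge> 0" using B P by (simp add: Z_def M_def)
  define y where "y = 1 / (2 * Z + 1)"
  have y: "y > 0" "y * Z \<le> 1 / 2" using Z by (auto simp: y_def field_simps)
  have small: "3 * y * (1 + 1 / (\<delta> / 2)\<^sup>2) * (2 * B) + 3 * (1 / 6) + M * (2 * y / (\<delta> / 2)) \<le> 1"
  proof -
    have "y * Z = 3 * y * (1 + 1 / (\<delta> / 2)\<^sup>2) * (2 * B) + M * (2 * y / (\<delta> / 2))"
      unfolding Z_def by (simp add: algebra_simps)
    then show ?thesis using y(2) by linarith
  qed
  obtain L where L: "L > 0" "\<And>x0. \<exists>\<tau>\<in>{x0..x0+L}. \<forall>x. \<bar>poisson_sum y (x + \<tau>) - poisson_sum y x\<bar> \<le> 1 / 6"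
    using poisson_almost_periods[OF y(1), of "1 / 6"] by auto
  have chain: "point_count (P i + \<tau>) (P j + \<tau>) = point_count (P i) (P j)"
    if "i \<le> j" and \<tau>: "\<And>x. \<bar>poisson_sum y (x + \<tau>) - poisson_sum y x\<bar> \<le> 1 / 6" for i j \<tau>
    using that(1)
  proof (induction j rule: int_ge_induct)
    case base
    have "point_count p p = 0" for p
    proof -
      have "{n. p < a n \<and> a n \<le> p} = {}" by auto
      then show ?thesis unfolding point_count_def by (simp only: card.empty of_nat_0)
    qed
    then show ?case by simp
  next
    case (step j)
    have PP: "P i \<le> P j" "P j \<le> P (j + 1)" "P (j + 1) - P j \<le> 2"
      using P(3)[of i] P(3)[of j] P(3)[of "j + 1"] step.hyps by (cases "i = j"; simp)+
    have "point_count (P j + \<tau>) (P (j + 1) + \<tau>) = point_count (P j) (P (j + 1))"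
    proof (rule cell_count[OF B(2) _ PP(2,3) P(1,2) P(4) P(4) y(1) _ small \<tau>])
      show "point_count p q \<le> M" if "q - p \<le> 2" for p q unfolding M_def using that by (rule K) simp
    qed simp
    then show ?case
      using point_count_add[of "P i" "P j" "P (j + 1)"] point_count_add[of "P i + \<tau>" "P j + \<tau>" "P (j + 1) + \<tau>"] PP step.IH by simp
  qed
  \<comment> \<open>The first term pays for moving both ends by at most 1, the second for windows of
    length \<open>1 + L\<close> at the translated ends.\<close>
  define C where "C = 2 * (B * (1 + 1\<^sup>2)) + 2 * (B * (1 + (1 + L)\<^sup>2))"
  have C0: "C \<ge> 0" using B by (simp add: C_def)
  have le: "point_count x (x + h) \<le> point_count x' (x' + h) + C" if h: "h \<ge> 0" for x x' h
  proof -
    obtain \<tau> where \<tau>: "\<tau> \<in> {x' - x..x' - x + L}" "\<And>x. \<bar>poisson_sum y (x + \<tau>) - poisson_sum y x\<bar> \<le> 1 / 6"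
      using L(2) by blast
    define i j where "i = \<lfloor>x\<rfloor>" and "j = \<lfloor>x + h\<rfloor>"
    have ij: "i \<le> j" unfolding i_def j_def using h by (intro floor_mono) simp
    have i: "\<bar>x - P i\<bar> \<le> 1" "\<bar>x + h - P j\<bar> \<le> 1"
      using P(3)[of i] P(3)[of j] unfolding i_def j_def by linarith+
    have "point_count x (x + h) \<le> point_count (P i) (P j) + 2 * (B * (1 + 1\<^sup>2))"
      by (rule point_count_le_perturb[OF K i]) auto
    also have "point_count (P i) (P j) = point_count (P i + \<tau>) (P j + \<tau>)" using chain[OF ij \<tau>(2)] by simp
    also have "\<dots> \<le> point_count x' (x' + h) + 2 * (B * (1 + (1 + L)\<^sup>2))"
    proof (rule point_count_le_perturb[OF K])
      show "\<bar>P i + \<tau> - x'\<bar> \<le> 1 + L" "\<bar>P j + \<tau> - (x' + h)\<bar> \<le> 1 + L"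
        using i \<tau>(1) by auto
    qed (use L(1) in auto)
    finally show ?thesis by (simp add: C_def)
  qed
  show ?thesis
  proof (rule that[OF C0])
    show "\<bar>point_count x (x + h) - point_count x' (x' + h)\<bar> \<le> C" if "h \<ge> 0" for x x' h
      using le[OF that, of x x'] le[OF that, of x' x] by linarith
  qed
qed

text \<open>Up to multiplicities there are \<open>n\<close> points between \<open>a 0\<close> and
  \<open>a n\<close>, and as many between \<open>a (- n)\<close> and \<open>a 0\<close>. Counts
  depend almost only on length, so the two distances from \<open>a 0\<close> cannot differ by as
  much as a length \<open>H0\<close> that is certain to contain too many points.\<close>

lemma symmetric_sum_bounded:
  obtains H where "\<And>n::nat. \<bar>a (int n) + a (- int n)\<bar> \<le> H"
proof -
  obtain C where C: "C \<ge> 0" "\<And>x x' h. h \<ge> 0 \<Longrightarrow> \<bar>point_count x (x + h) - point_count x' (x' + h)\<bar> \<le> C"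
    using point_count_translation_bounded by metis
  obtain m where m: "\<And>x. real (card {n. a n = x}) \<le> m"
  proof -
    obtain B where B: "\<And>p q D. q - p \<le> D \<Longrightarrow> D \<ge> 0 \<Longrightarrow> real (card {n. p \<le> a n \<and> a n \<le> q}) \<le> B * (1 + D\<^sup>2)"
      using count_bound by metis
    have "{n. a n = x} = {n. x \<le> a n \<and> a n \<le> x}" for x by auto
    then show ?thesis using that[of "B * (1 + 0\<^sup>2)"] B[of _ _ 0] by simp
  qed
  have fe: "finite {n. a n = x}" for x
    by (rule finite_subset[OF _ finite_between[of x x]]) auto
  have idx: "\<bar>point_count (a i) (a j) - real_of_int (j - i)\<bar> \<le> m" if "i \<le> j" for i j
  proof -
    have cI: "card {i<..j} = nat (j - i)" by simp
    have "{n. a i < a n \<and> a n \<le> a j} \<subseteq> {i<..j} \<union> {n. a n = a j}"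
    proof
      fix n assume n: "n \<in> {n. a i < a n \<and> a n \<le> a j}"
      then have "i < n" using a_mono_le[of n i] by (smt (verit) mem_Collect_eq)
      moreover have "n \<le> j \<or> a n = a j" using a_mono_le[of j n] n by (smt (verit) mem_Collect_eq)
      ultimately show "n \<in> {i<..j} \<union> {n. a n = a j}" by auto
    qed
    then have "card {n. a i < a n \<and> a n \<le> a j} \<le> card ({i<..j} \<union> {n. a n = a j})"
      by (intro card_mono) (auto intro: fe)
    also have "\<dots> \<le> nat (j - i) + card {n. a n = a j}" using card_Un_le[of "{i<..j}"] cI by simp
    finally have 1: "point_count (a i) (a j) \<le> real_of_int (j - i) + m"
      unfolding point_count_def using m[of "a j"] that by linarith
    have "{i<..j} \<subseteq> {n. a i < a n \<and> a n \<le> a j} \<union> {n. a n = a i}"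
    proof
      fix n assume n: "n \<in> {i<..j}"
      then have "a i \<le> a n" "a n \<le> a j" using a_mono_le by auto
      then show "n \<in> {n. a i < a n \<and> a n \<le> a j} \<union> {n. a n = a i}" by auto
    qed
    then have "card {i<..j} \<le> card ({n. a i < a n \<and> a n \<le> a j} \<union> {n. a n = a i})"
      by (intro card_mono) (auto intro: fe finite_point_count)
    also have "\<dots> \<le> card {n. a i < a n \<and> a n \<le> a j} + card {n. a n = a i}" by (rule card_Un_le)
    finally have 2: "real_of_int (j - i) \<le> point_count (a i) (a j) + m"
      unfolding point_count_def cI using m[of "a i"] that by linarith
    show ?thesis using 1 2 by linarith
  qed
  \<comment> \<open>Of the \<open>N\<close> points, \<open>m\<close> may be lost to multiplicities
    and \<open>C\<close> to translation; at least \<open>C + 2 * m + 1\<close> remain, one more than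
    the discrepancy allowed in \<open>main\<close>.\<close>
  define N where "N = nat \<lceil>2 * C + 3 * m + 1\<rceil>"
  define H0 where "H0 = a (int N) - a 0"
  have H0: "H0 \<ge> 0" using a_mono_le[of 0 "int N"] by (simp add: H0_def)
  have many: "point_count s (s + H0) \<ge> C + 2 * m + 1" for s
  proof -
    have "point_count (a 0) (a 0 + H0) \<ge> real N - m" using idx[of 0 "int N"] by (simp add: H0_def)
    moreover have "real N \<ge> 2 * C + 3 * m + 1" unfolding N_def by linarith
    ultimately show ?thesis using C(2)[OF H0, of s "a 0"] by linarith
  qed
  have main: "\<not> h \<ge> h' + H0" if "h' \<ge> 0" and c: "\<bar>point_count (a 0 - h) (a 0) - point_count (a 0 - h') (a 0)\<bar> \<le> C + 2 * m" for h h'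
  proof
    assume h: "h \<ge> h' + H0"
    have "point_count (a 0 - h) (a 0) = point_count (a 0 - h) (a 0 - h') + point_count (a 0 - h') (a 0)"
      using h H0 that(1) by (intro point_count_add) auto
    moreover have "point_count (a 0 - h) (a 0 - h') \<ge> point_count (a 0 - h) (a 0 - h + H0)"
      using h by (intro point_count_mono) auto
    ultimately show False using c many[of "a 0 - h"] by linarith
  qed
  show ?thesis
  proof (rule that[of "2 * \<bar>a 0\<bar> + H0"])
    fix n :: nat
    define h h' where "h = a (int n) - a 0" and "h' = a 0 - a (- int n)"
    have hh: "h \<ge> 0" "h' \<ge> 0" using a_mono_le[of 0 "int n"] a_mono_le[of "- int n" 0] by (auto simp: h_def h'_def)
    have 1: "\<bar>point_count (a 0) (a 0 + h) - real n\<bar> \<le> m" using idx[of 0 "int n"] by (simp add: h_def)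
    have 2: "\<bar>point_count (a 0 - h') (a 0) - real n\<bar> \<le> m" using idx[of "- int n" 0] by (simp add: h'_def)
    have 3: "\<bar>point_count (a 0 - h) (a 0) - point_count (a 0) (a 0 + h)\<bar> \<le> C" using C(2)[OF hh(1), of "a 0 - h" "a 0"] by simp
    have c: "\<bar>point_count (a 0 - h) (a 0) - point_count (a 0 - h') (a 0)\<bar> \<le> C + 2 * m" using 1 2 3 by linarith
    have "\<not> h \<ge> h' + H0" "\<not> h' \<ge> h + H0"
      using main[OF hh(2) c] main[OF hh(1), of h'] c by (auto simp: abs_minus_commute)
    then show "\<bar>a (int n) + a (- int n)\<bar> \<le> 2 * \<bar>a 0\<bar> + H0"
      unfolding h_def h'_def by linarith
  qed
qed

subsection \<open>The product and its logarithmic derivative\<close>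

text \<open>Indexed from 0 and shifted by one: \<open>a 0\<close> has no partner, and pair
  \<open>n\<close> consists of \<open>a (n + 1)\<close> and \<open>a (- n - 1)\<close>.\<close>

definition right_zero :: "nat \<Rightarrow> real" where "right_zero n = a (int (Suc n))"
definition left_zero :: "nat \<Rightarrow> real" where "left_zero n = a (- int (Suc n))"

lemma a_nonzero: "a n \<noteq> 0" "right_zero k \<noteq> 0" "left_zero k \<noteq> 0"
  using zero_notin unfolding right_zero_def left_zero_def by (metis rangeI)+

text \<open>Only finitely many points lie in \<open>{-1..1}\<close> and none is 0, so all keep a
  fixed distance \<open>e\<close> from 0, and \<open>1 / (a n)\<^sup>2\<close> is comparable with
  \<open>1 / (1 + (a n)\<^sup>2)\<close>.\<close>

lemma inverse_square_summable_int: "(\<lambda>n. 1 / (a n)\<^sup>2) summable_on UNIV"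
proof -
  define F where "F = {n. -1 \<le> a n \<and> a n \<le> 1}"
  have F: "finite F" unfolding F_def by (rule finite_between)
  define e where "e = Min (insert 1 ((\<lambda>n. \<bar>a n\<bar>) ` F))"
  have e: "e > 0" "e \<le> 1" unfolding e_def using F a_nonzero(1) by (auto simp: Min_gr_iff)
  have ae: "\<bar>a n\<bar> \<ge> e" for n
  proof (cases "n \<in> F")
    case True
    then show ?thesis unfolding e_def using F by (intro Min_le) auto
  next
    case False
    then show ?thesis using e(2) unfolding F_def by auto
  qed
  have "(\<lambda>n. (1 + 1 / e\<^sup>2) * (1 / (1 + (a n - 0)\<^sup>2))) summable_on UNIV"
    by (rule summable_on_cmult_right[OF summable_inverse_square])
  then show ?thesis
  proof (rule summable_on_comparison_test)
    fix n
    define D where "D = (a n)\<^sup>2"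
    have D: "e\<^sup>2 \<le> D" "D > 0" using ae[of n] e power_mono[of e "\<bar>a n\<bar>" 2] a_nonzero(1)[of n] unfolding D_def by auto
    have "1 + D \<le> D * (1 + 1 / e\<^sup>2)" using D e by (simp add: field_simps)
    then show "1 / (a n)\<^sup>2 \<le> (1 + 1 / e\<^sup>2) * (1 / (1 + (a n - 0)\<^sup>2))"
      unfolding diff_zero D_def[symmetric] using D by (simp add: divide_le_eq le_divide_eq mult_ac)
  qed auto
qed

lemma summable_along:
  assumes "inj \<iota>"
  shows "summable (\<lambda>n::nat. 1 / (a (\<iota> n))\<^sup>2)"
proof -
  have r: "(\<lambda>k. 1 / (a k)\<^sup>2) summable_on range \<iota>"
    using inverse_square_summable_int by (rule summable_on_subset_banach) auto
  have "bij_betw \<iota> UNIV (range \<iota>)" using assms by (simp add: bij_betw_def)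
  from summable_on_reindex_bij_betw[OF this, of "\<lambda>k. 1 / (a k)\<^sup>2"] r
  have "(\<lambda>n. 1 / (a (\<iota> n))\<^sup>2) summable_on UNIV" by (simp only:)
  then show ?thesis by (rule summable_on_imp_summable)
qed

definition pair_weight :: "nat \<Rightarrow> real" where "pair_weight n = 1 / (right_zero n)\<^sup>2 + 1 / (left_zero n)\<^sup>2"

lemma summable_pair_weight: "summable pair_weight"
proof -
  have "inj (\<lambda>n. int (Suc n))" "inj (\<lambda>n. - int (Suc n))" by (auto simp: inj_def)
  then show ?thesis unfolding pair_weight_def right_zero_def left_zero_def by (intro summable_add summable_along)
qed

lemma inverse_product_le_pair_weight: "1 / \<bar>right_zero n * left_zero n\<bar> \<le> pair_weight n"
proof -
  have "0 \<le> (1 / \<bar>right_zero n\<bar> - 1 / \<bar>left_zero n\<bar>)\<^sup>2" by simp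
  then have "2 * (1 / \<bar>right_zero n * left_zero n\<bar>) \<le> pair_weight n"
    by (simp add: power2_diff power_divide pair_weight_def abs_mult)
  moreover have "0 \<le> 1 / \<bar>right_zero n * left_zero n\<bar>" by simp
  ultimately show ?thesis by linarith
qed

definition pair_bound where "pair_bound = (SOME C. \<forall>n::nat. \<bar>a (int n) + a (- int n)\<bar> \<le> C)"

lemma pair_sum_bound: "\<bar>right_zero n + left_zero n\<bar> \<le> pair_bound" "pair_bound \<ge> 0"
proof -
  have "\<exists>C. \<forall>n::nat. \<bar>a (int n) + a (- int n)\<bar> \<le> C" using symmetric_sum_bounded by metis
  from someI_ex[OF this] have "\<bar>a (int n) + a (- int n)\<bar> \<le> pair_bound" for n unfolding pair_bound_def by blast
  from this[of "Suc n"] show "\<bar>right_zero n + left_zero n\<bar> \<le> pair_bound" by (simp add: right_zero_def left_zero_def)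
  then show "pair_bound \<ge> 0" by linarith
qed

definition factor_dev :: "nat \<Rightarrow> complex \<Rightarrow> complex" where
  "factor_dev n z = (case n of 0 \<Rightarrow> - (z / of_real (a 0))
     | Suc k \<Rightarrow> (1 - z / of_real (right_zero k)) * (1 - z / of_real (left_zero k)) - 1)"

lemma one_plus_factor_dev: "1 + factor_dev 0 z = 1 - z / of_real (a 0)"
  "1 + factor_dev (Suc k) z = (1 - z / of_real (right_zero k)) * (1 - z / of_real (left_zero k))"
  by (simp_all add: factor_dev_def)

lemma partial_product_eq:
  "(\<Prod>n<Suc N. 1 + factor_dev n z) = (1 - z / complex_of_real (a 0)) *
     (\<Prod>n\<in>{1..N}. (1 - z / complex_of_real (a (int n))) * (1 - z / complex_of_real (a (- int n))))"
  unfolding One_nat_def prod.lessThan_Suc_shift prod.atLeast1_atMost_eq comp_def one_plus_factor_dev right_zero_def left_zero_def ..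

text \<open>For a pair \<open>p\<close>, \<open>q\<close> the linear term is
  \<open>- z (p + q) / (p q)\<close> with \<open>p + q\<close> bounded, so it decays as fast as the
  term with \<open>z\<^sup>2\<close>. This is where the bound on symmetric sums makes the product
  converge.\<close>

lemma norm_factor_dev_Suc: "norm (factor_dev (Suc k) z) \<le> (norm z * pair_bound + (norm z)\<^sup>2) * pair_weight k"
proof -
  have "factor_dev (Suc k) z = (- z * of_real (right_zero k + left_zero k) + z\<^sup>2) * of_real (1 / (right_zero k * left_zero k))"
    using a_nonzero(2,3)[of k] by (simp add: factor_dev_def field_simps power2_eq_square)
  also have "norm \<dots> = norm (- z * of_real (right_zero k + left_zero k) + z\<^sup>2) * (1 / \<bar>right_zero k * left_zero k\<bar>)"
    by (simp only: norm_mult norm_of_real abs_divide abs_one)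
  also have "\<dots> \<le> (norm z * pair_bound + (norm z)\<^sup>2) * pair_weight k"
  proof (intro mult_mono inverse_product_le_pair_weight)
    have "norm (- z * of_real (right_zero k + left_zero k) + z\<^sup>2) \<le> norm (- z * of_real (right_zero k + left_zero k)) + norm (z\<^sup>2)"
      by (rule norm_triangle_ineq)
    also have "\<dots> = norm z * \<bar>right_zero k + left_zero k\<bar> + (norm z)\<^sup>2"
      by (simp only: norm_mult norm_of_real norm_power norm_minus_cancel)
    also have "\<dots> \<le> norm z * pair_bound + (norm z)\<^sup>2"
      by (intro add_right_mono mult_left_mono pair_sum_bound(1)) simp
    finally show "norm (- z * of_real (right_zero k + left_zero k) + z\<^sup>2) \<le> norm z * pair_bound + (norm z)\<^sup>2" .
  qed (use pair_sum_bound(2) in auto)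
  finally show ?thesis .
qed

definition zero_product :: "complex \<Rightarrow> complex" where "zero_product z = lim (\<lambda>N. \<Prod>n<N. 1 + factor_dev n z)"

lemma factor_dev_holomorphic: "factor_dev n holomorphic_on A"
  unfolding factor_dev_def by (cases n) (auto intro!: holomorphic_intros simp: a_nonzero)

lemma product_uniform_limit: "uniform_limit (cball 0 R) (\<lambda>N z. \<Prod>n<N. 1 + factor_dev n z) zero_product sequentially"
proof -
  define R' where "R' = max R 0"
  define M where "M n = (case n of 0 \<Rightarrow> R' / \<bar>a 0\<bar> | Suc k \<Rightarrow> (R' * pair_bound + R'\<^sup>2) * pair_weight k)" for n
  have "summable (\<lambda>k. M (Suc k))" unfolding M_def by (simp add: summable_mult summable_pair_weight)
  then have M: "summable M" by (simp only: summable_Suc_iff)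
  have le: "norm (factor_dev n z) \<le> M n" if "z \<in> cball 0 R" for n z
  proof -
    have z: "norm z \<le> R'" using that by (simp add: R'_def)
    show ?thesis
    proof (cases n)
      case 0
      then show ?thesis using z by (simp add: factor_dev_def M_def norm_divide divide_right_mono)
    next
      case (Suc k)
      have w0: "pair_weight k \<ge> 0" by (simp add: pair_weight_def)
      have "(norm z * pair_bound + (norm z)\<^sup>2) * pair_weight k \<le> (R' * pair_bound + R'\<^sup>2) * pair_weight k"
        using z pair_sum_bound(2) w0 by (intro mult_right_mono add_mono power_mono) auto
      then show ?thesis using norm_factor_dev_Suc[of k z] unfolding Suc M_def by simp
    qed
  qed
  have "uniformly_convergent_on (cball 0 R) (\<lambda>N z. \<Sum>n<N. norm (factor_dev n z))"
    by (rule Weierstrass_m_test'[OF _ M]) (use le in auto)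
  then have "uniformly_convergent_on (cball 0 R) (\<lambda>N z. \<Prod>n<N. 1 + factor_dev n z)"
    by (intro uniformly_convergent_on_prod holomorphic_on_imp_continuous_on factor_dev_holomorphic) auto
  then show ?thesis unfolding uniformly_convergent_uniform_limit_iff zero_product_def .
qed

lemma product_tendsto: "(\<lambda>N. \<Prod>n<N. 1 + factor_dev n z) \<longlonglongrightarrow> zero_product z"
  by (rule tendsto_uniform_limitI[OF product_uniform_limit[of "norm z"]]) simp

lemma product_uniform_limit_cball: "uniform_limit (cball x d) (\<lambda>N z. \<Prod>n<N. 1 + factor_dev n z) zero_product sequentially"
proof (rule uniform_limit_on_subset[OF product_uniform_limit[of "norm x + d"]])
  show "cball x d \<subseteq> cball 0 (norm x + d)"
  proof
    fix w assume "w \<in> cball x d"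
    then have "norm (w - x) \<le> d" by (simp add: dist_norm norm_minus_commute)
    then show "w \<in> cball 0 (norm x + d)" using norm_triangle_ineq[of "w - x" x] by simp
  qed
qed

lemma zero_product_holomorphic: "zero_product holomorphic_on UNIV"
proof (rule holomorphic_uniform_sequence[where f = "\<lambda>N z. \<Prod>n<N. 1 + factor_dev n z"])
  show "(\<lambda>z. \<Prod>n<N. 1 + factor_dev n z) holomorphic_on UNIV" for N
    by (intro holomorphic_intros factor_dev_holomorphic)
  show "\<exists>d. 0 < d \<and> cball x d \<subseteq> UNIV \<and> uniform_limit (cball x d) (\<lambda>N z. \<Prod>n<N. 1 + factor_dev n z) zero_product sequentially" for x
    using product_uniform_limit_cball by (intro exI[of _ 1]) auto
qed auto

section \<open>The logarithmic derivative in the upper half plane\<close>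

definition log_deriv_term :: "nat \<Rightarrow> complex \<Rightarrow> complex" where
  "log_deriv_term n z = (case n of 0 \<Rightarrow> 1 / (z - of_real (a 0)) | Suc k \<Rightarrow> 1 / (z - of_real (right_zero k)) + 1 / (z - of_real (left_zero k)))"

lemma factor_has_field_derivative:
  assumes "Im z > 0"
  shows "((\<lambda>z. 1 + factor_dev n z) has_field_derivative (1 + factor_dev n z) * log_deriv_term n z) (at z)"
proof -
  have ne: "z - of_real x \<noteq> 0" for x using assms by (auto simp: complex_eq_iff)
  have lin: "((\<lambda>z. 1 - z / of_real x) has_field_derivative (1 - z / of_real x) * (1 / (z - of_real x))) (at z)"
    if "x \<noteq> 0" for x
  proof -
    have "(1 - z / of_real x) * (1 / (z - of_real x)) = - (1 / of_real x)"
      using ne[of x] that by (simp add: field_simps)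
    moreover have "((\<lambda>z. 1 - z / of_real x) has_field_derivative - (1 / of_real x)) (at z)"
      using that by (auto intro!: derivative_eq_intros)
    ultimately show ?thesis by simp
  qed
  show ?thesis
  proof (cases n)
    case 0
    then show ?thesis using lin[OF a_nonzero(1)[of 0]] unfolding 0 one_plus_factor_dev log_deriv_term_def by simp
  next
    case (Suc k)
    have "((\<lambda>z. (1 - z / of_real (right_zero k)) * (1 - z / of_real (left_zero k))) has_field_derivative
       (1 - z / of_real (right_zero k)) * (1 / (z - of_real (right_zero k))) * (1 - z / of_real (left_zero k))
       + (1 - z / of_real (left_zero k)) * (1 / (z - of_real (left_zero k))) * (1 - z / of_real (right_zero k))) (at z)"
      by (rule DERIV_mult[OF lin[OF a_nonzero(2)] lin[OF a_nonzero(3)]])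
    then show ?thesis unfolding Suc one_plus_factor_dev log_deriv_term_def by (simp add: distrib_left mult_ac)
  qed
qed

lemma product_has_field_derivative:
  assumes "Im z > 0"
  shows "((\<lambda>z. \<Prod>n<N. 1 + factor_dev n z) has_field_derivative (\<Prod>n<N. 1 + factor_dev n z) * (\<Sum>n<N. log_deriv_term n z)) (at z)"
proof (induction N)
  case (Suc N)
  from DERIV_mult[OF Suc factor_has_field_derivative[OF assms, of N]]
  show ?case by (simp add: algebra_simps)
qed simp

text \<open>A pair combines to the numerator \<open>2 z - (p + q)\<close>, bounded in
  \<open>k\<close>, over the product of the two distances, whose inverse is summable like
  \<open>pair_weight\<close>.\<close>

lemma summable_log_deriv_term:
  assumes "Im z > 0"
  shows "summable (\<lambda>n. log_deriv_term n z)"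
proof -
  define K where "K = 2 + (1 + 2 * (norm z)\<^sup>2) / (Im z)\<^sup>2"
  have K: "K \<ge> 0" by (simp add: K_def)
  have ne: "z \<noteq> of_real x" for x using assms by auto
  have sq: "1 / (norm (z - of_real x))\<^sup>2 \<le> K * (1 / x\<^sup>2)" if "x \<noteq> 0" for x
  proof -
    have "x\<^sup>2 \<le> 1 + x\<^sup>2" by simp
    also have "\<dots> \<le> K * (norm (z - of_real x))\<^sup>2"
      using one_plus_square_le_dist_square[OF assms, of x] by (simp add: K_def norm_minus_commute)
    finally show ?thesis using that ne[of x] by (simp add: field_simps)
  qed
  have le: "norm (log_deriv_term (Suc k) z) \<le> (2 * norm z + pair_bound) * (K * pair_weight k)" for k
  proof -
    define u v where "u = norm (z - of_real (right_zero k))" and "v = norm (z - of_real (left_zero k))"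
    have uv: "u > 0" "v > 0" using ne by (auto simp: u_def v_def)
    have "log_deriv_term (Suc k) z = (2 * z - of_real (right_zero k + left_zero k)) / ((z - of_real (right_zero k)) * (z - of_real (left_zero k)))"
      using ne[of "right_zero k"] ne[of "left_zero k"] by (simp add: log_deriv_term_def field_simps)
    then have "norm (log_deriv_term (Suc k) z) = norm (2 * z - of_real (right_zero k + left_zero k)) * (1 / (u * v))"
      by (simp only: norm_divide norm_mult u_def v_def) simp
    also have "\<dots> \<le> (2 * norm z + pair_bound) * (K * pair_weight k)"
    proof (rule mult_mono)
      have "norm (2 * z - of_real (right_zero k + left_zero k)) \<le> norm (2 * z) + norm (complex_of_real (right_zero k + left_zero k))"
        by (rule norm_triangle_ineq4)
      also have "\<dots> \<le> 2 * norm z + pair_bound" unfolding norm_of_real using pair_sum_bound(1)[of k] by (simp add: norm_mult)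
      finally show "norm (2 * z - of_real (right_zero k + left_zero k)) \<le> 2 * norm z + pair_bound" .
      have "0 \<le> (1 / u - 1 / v)\<^sup>2" by simp
      then have "2 * (1 / (u * v)) \<le> 1 / u\<^sup>2 + 1 / v\<^sup>2" by (simp add: power2_diff power_divide)
      also have "\<dots> \<le> K * (1 / (right_zero k)\<^sup>2) + K * (1 / (left_zero k)\<^sup>2)"
        unfolding u_def v_def by (intro add_mono sq a_nonzero)
      also have "\<dots> = K * pair_weight k" by (simp add: pair_weight_def algebra_simps)
      finally have "2 * (1 / (u * v)) \<le> K * pair_weight k" .
      moreover have "0 \<le> 1 / (u * v)" using uv by simp
      ultimately show "1 / (u * v) \<le> K * pair_weight k" by linarith
    qed (use pair_sum_bound(2) uv in auto)
    finally show ?thesis .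
  qed
  have "summable (\<lambda>k. (2 * norm z + pair_bound) * (K * pair_weight k))" by (intro summable_mult summable_pair_weight)
  then have "summable (\<lambda>k. log_deriv_term (Suc k) z)"
    by (rule summable_comparison_test'[where N = 0]) (rule le)
  then show ?thesis using summable_Suc_iff[of "\<lambda>n. log_deriv_term n z"] by blast
qed

definition log_deriv where "log_deriv z = (\<Sum>n. log_deriv_term n z)"

lemma log_deriv_tendsto: "Im z > 0 \<Longrightarrow> (\<lambda>N. \<Sum>n<N. log_deriv_term n z) \<longlonglongrightarrow> log_deriv z"
  unfolding log_deriv_def by (rule summable_LIMSEQ[OF summable_log_deriv_term])

lemma zero_product_has_field_derivative:
  assumes "Im z > 0"
  shows "(zero_product has_field_derivative zero_product z * log_deriv z) (at z)"
proof -
  have op: "open {z. Im z > 0}" by (rule open_halfspace_Im_gt)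
  then have "\<exists>g'. \<forall>x\<in>{z. Im z > 0}. (zero_product has_field_derivative g' x) (at x) \<and>
      (\<lambda>N. (\<Prod>n<N. 1 + factor_dev n x) * (\<Sum>n<N. log_deriv_term n x)) \<longlonglongrightarrow> g' x"
  proof (rule has_complex_derivative_uniform_sequence)
    show "((\<lambda>z. \<Prod>n<N. 1 + factor_dev n z) has_field_derivative (\<Prod>n<N. 1 + factor_dev n x) * (\<Sum>n<N. log_deriv_term n x)) (at x)"
      if "x \<in> {z. Im z > 0}" for N x
      using that by (intro product_has_field_derivative) simp
    show "\<exists>d>0. cball x d \<subseteq> {z. Im z > 0} \<and> uniform_limit (cball x d) (\<lambda>N z. \<Prod>n<N. 1 + factor_dev n z) zero_product sequentially"
      if x: "x \<in> {z. Im z > 0}" for x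
    proof -
      obtain d where "d > 0" "cball x d \<subseteq> {z. Im z > 0}"
        using open_contains_cball[THEN iffD1, OF op, rule_format, OF x] by auto
      then show ?thesis by (intro exI[of _ d] conjI product_uniform_limit_cball)
    qed
  qed
  then obtain g' where g': "\<And>x. Im x > 0 \<Longrightarrow> (zero_product has_field_derivative g' x) (at x) \<and>
      (\<lambda>N. (\<Prod>n<N. 1 + factor_dev n x) * (\<Sum>n<N. log_deriv_term n x)) \<longlonglongrightarrow> g' x"
    by blast
  have "(\<lambda>N. (\<Prod>n<N. 1 + factor_dev n z) * (\<Sum>n<N. log_deriv_term n z)) \<longlonglongrightarrow> zero_product z * log_deriv z"
    by (intro tendsto_mult product_tendsto log_deriv_tendsto assms)
  then have "g' z = zero_product z * log_deriv z" using g'[OF assms] LIMSEQ_unique by blast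
  then show ?thesis using g'[OF assms] by simp
qed

lemma sum_log_deriv_term: "(\<Sum>n<Suc N. log_deriv_term n z) = (\<Sum>k\<in>{- int N..int N}. 1 / (z - of_real (a k)))"
proof (induction N)
  case (Suc N)
  have "{- int (Suc N)..int (Suc N)} = insert (int (Suc N)) (insert (- int (Suc N)) {- int N..int N})" by auto
  then have "(\<Sum>k\<in>{- int (Suc N)..int (Suc N)}. 1 / (z - of_real (a k)))
     = 1 / (z - of_real (a (int (Suc N)))) + (1 / (z - of_real (a (- int (Suc N)))) + (\<Sum>k\<in>{- int N..int N}. 1 / (z - of_real (a k))))"
    by simp
  also have "\<dots> = (\<Sum>n<Suc N. log_deriv_term n z) + log_deriv_term (Suc N) z"
    unfolding Suc by (simp add: log_deriv_term_def right_zero_def left_zero_def)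
  finally show ?case by simp
qed (simp add: log_deriv_term_def)

text \<open>Each logarithmic derivative is summed in symmetric order, but their difference is
  absolutely summable. The symmetric index blocks eventually contain every finite set, so both ways
  of summation agree.\<close>

lemma log_deriv_difference:
  assumes "Im z > 0" "Im w > 0"
  shows "log_deriv z - log_deriv w = - (2 * pi * \<i>) * (pos_series z - pos_series w)"
proof -
  define D where "D n = 1 / (z - complex_of_real (a n)) - 1 / (w - of_real (a n))" for n
  have "D summable_on UNIV" unfolding D_def
    by (rule abs_summable_summable[OF summable_cauchy_difference[OF assms]])
  then have "(sum D \<longlongrightarrow> infsum D UNIV) (finite_subsets_at_top UNIV)"
    using has_sum_infsum unfolding has_sum_def by blast
  moreover have "filterlim (\<lambda>N. {- int N..int N}) (finite_subsets_at_top UNIV) sequentially"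
    unfolding filterlim_finite_subsets_at_top
  proof (intro allI impI)
    fix X :: "int set" assume X: "finite X \<and> X \<subseteq> UNIV"
    define m where "m = nat (Max (insert 0 (abs ` X)))"
    have m: "\<bar>x\<bar> \<le> int m" if "x \<in> X" for x
    proof -
      have "\<bar>x\<bar> \<le> Max (insert 0 (abs ` X))" using X that by (intro Max_ge) auto
      then show ?thesis unfolding m_def by linarith
    qed
    show "\<forall>\<^sub>F N in sequentially. finite {- int N..int N} \<and> X \<subseteq> {- int N..int N} \<and> {- int N..int N} \<subseteq> UNIV"
      using eventually_ge_at_top[of m]
    proof eventually_elim
      case (elim N)
      have "x \<in> {- int N..int N}" if "x \<in> X" for x using m[OF that] elim by auto
      then show ?case by auto
    qed
  qed
  ultimately have "(\<lambda>N. sum D {- int N..int N}) \<longlonglongrightarrow> infsum D UNIV" by (rule filterlim_compose)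
  moreover have "sum D {- int N..int N} = (\<Sum>n<Suc N. log_deriv_term n z) - (\<Sum>n<Suc N. log_deriv_term n w)" for N
    unfolding sum_log_deriv_term D_def by (rule sum_subtractf)
  moreover have "(\<lambda>N. (\<Sum>n<Suc N. log_deriv_term n z) - (\<Sum>n<Suc N. log_deriv_term n w)) \<longlonglongrightarrow> log_deriv z - log_deriv w"
    by (intro tendsto_diff LIMSEQ_Suc log_deriv_tendsto assms)
  ultimately have "infsum D UNIV = log_deriv z - log_deriv w" using LIMSEQ_unique by simp
  then show ?thesis using cauchy_sum_difference[OF assms] unfolding D_def by simp
qed

text \<open>By the difference identity the same expression has this value at every point of the
  upper half plane; \<open>\<i>\<close> is just a sample point.\<close>

definition exponent where "exponent = log_deriv \<i> + 2 * pi * \<i> * pos_series \<i>"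

lemma log_deriv_eq: "Im z > 0 \<Longrightarrow> log_deriv z = exponent - 2 * pi * \<i> * pos_series z"
  using log_deriv_difference[of z \<i>] unfolding exponent_def by (simp add: algebra_simps)

text \<open>At height \<open>s\<close> above 0 the real part of a pair is \<open>- (p + q)
  (s\<^sup>2 + p q) / ((p\<^sup>2 + s\<^sup>2) (q\<^sup>2 + s\<^sup>2))\<close>, bounded by
  \<open>pair_bound * pair_weight k\<close> for all heights. Each term tends to 0, so dominated
  convergence of series applies.\<close>

lemma Re_log_deriv_tendsto_0: "(\<lambda>m. Re (log_deriv (\<i> * of_real (real (Suc m))))) \<longlonglongrightarrow> 0"
proof -
  define t where "t m k = Re (log_deriv_term k (\<i> * of_real (real (Suc m))))" for m k
  have Re_inv: "Re (1 / (\<i> * of_real y - of_real x)) = - (x / (x\<^sup>2 + y\<^sup>2))" for x y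
    by (simp add: Re_divide)
  have "t m (Suc k) = - (right_zero k / ((right_zero k)\<^sup>2 + (real (Suc m))\<^sup>2)) + - (left_zero k / ((left_zero k)\<^sup>2 + (real (Suc m))\<^sup>2))" for m k
    unfolding t_def log_deriv_term_def nat.case plus_complex.sel Re_inv ..
  note tS = this
  have t0: "t m 0 = - (a 0 / ((a 0)\<^sup>2 + (real (Suc m))\<^sup>2))" for m
    unfolding t_def log_deriv_term_def nat.case Re_inv ..
  have lim: "(\<lambda>m. x / (x\<^sup>2 + (real (Suc m))\<^sup>2)) \<longlonglongrightarrow> 0" for x by real_asymp
  have tlim: "(\<lambda>m. t m k) \<longlonglongrightarrow> 0" for k
  proof (cases k)
    case 0
    then show ?thesis using tendsto_minus[OF lim[of "a 0"]] unfolding 0 t0 by simp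
  next
    case (Suc j)
    then show ?thesis using tendsto_add[OF tendsto_minus[OF lim[of "right_zero j"]] tendsto_minus[OF lim[of "left_zero j"]]]
      unfolding Suc tS by simp
  qed
  have bound: "norm (t m (Suc k)) \<le> pair_bound * pair_weight k" for m k
  proof -
    define y p q where "y = (real (Suc m))\<^sup>2" and "p = right_zero k" and "q = left_zero k"
    have y: "y > 0" by (simp add: y_def)
    have pq: "p \<noteq> 0" "q \<noteq> 0" by (simp_all add: p_def q_def a_nonzero)
    have pos: "p\<^sup>2 + y > 0" "q\<^sup>2 + y > 0" "\<bar>p * q\<bar> + y > 0" using y by (auto intro: add_nonneg_pos)
    have "t m (Suc k) = - ((p + q) * (y + p * q)) / ((p\<^sup>2 + y) * (q\<^sup>2 + y))"
      unfolding tS y_def[symmetric] p_def[symmetric] q_def[symmetric] using pos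
      by (simp add: divide_simps) (simp add: algebra_simps power2_eq_square)
    then have "norm (t m (Suc k)) = \<bar>p + q\<bar> * \<bar>y + p * q\<bar> / ((p\<^sup>2 + y) * (q\<^sup>2 + y))"
      using pos by (simp add: abs_mult)
    also have "\<dots> \<le> pair_bound * (\<bar>p * q\<bar> + y) / ((\<bar>p * q\<bar> + y) * (\<bar>p * q\<bar> + y))"
    proof (rule frac_le)
      have "\<bar>p + q\<bar> \<le> pair_bound" unfolding p_def q_def by (rule pair_sum_bound(1))
      moreover have "\<bar>y + p * q\<bar> \<le> \<bar>p * q\<bar> + y" using y by linarith
      ultimately show "\<bar>p + q\<bar> * \<bar>y + p * q\<bar> \<le> pair_bound * (\<bar>p * q\<bar> + y)"
        using pair_sum_bound(2) by (intro mult_mono) auto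
      \<comment> \<open>This is exactly the difference of the two products to be compared;
        \<open>y\<close> stands for the squared height.\<close>
      have "0 \<le> y * (\<bar>p\<bar> - \<bar>q\<bar>)\<^sup>2" using y by simp
      then show "(\<bar>p * q\<bar> + y) * (\<bar>p * q\<bar> + y) \<le> (p\<^sup>2 + y) * (q\<^sup>2 + y)"
        by (simp add: power2_eq_square algebra_simps abs_mult)
    qed (use pos y pair_sum_bound(2) in auto)
    also have "\<dots> = pair_bound * (1 / (\<bar>p * q\<bar> + y))" using pos by simp
    also have "\<dots> \<le> pair_bound * (1 / \<bar>p * q\<bar>)"
      using pq y pair_sum_bound(2) by (intro mult_left_mono divide_left_mono) auto
    also have "\<dots> \<le> pair_bound * pair_weight k"
      unfolding p_def q_def by (intro mult_left_mono inverse_product_le_pair_weight pair_sum_bound(2))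
    finally show ?thesis .
  qed
  have "(\<lambda>m. \<Sum>k. t m (Suc k)) \<longlonglongrightarrow> (\<Sum>k. 0)"
  proof (rule tannerys_theorem[where a = "\<lambda>k m. t m (Suc k)" and b = "\<lambda>_. 0" and F = sequentially and M = "\<lambda>k. pair_bound * pair_weight k", THEN conjunct2, THEN conjunct2])
    show "(\<lambda>m. t m (Suc k)) \<longlonglongrightarrow> 0" for k by (rule tlim)
    show "\<forall>\<^sub>F (k, m) in at_top \<times>\<^sub>F sequentially. norm (t m (Suc k)) \<le> pair_bound * pair_weight k"
      by (rule always_eventually) (use bound in auto)
    show "summable (\<lambda>k. pair_bound * pair_weight k)" by (rule summable_mult[OF summable_pair_weight])
  qed auto
  then have S: "(\<lambda>m. t m 0 + (\<Sum>k. t m (Suc k))) \<longlonglongrightarrow> 0 + (\<Sum>k. 0)"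
    by (intro tendsto_add tlim)
  have "Re (log_deriv (\<i> * of_real (real (Suc m)))) = t m 0 + (\<Sum>k. t m (Suc k))" for m
  proof -
    have s: "summable (\<lambda>k. log_deriv_term k (\<i> * of_real (real (Suc m))))" by (rule summable_log_deriv_term) simp
    have "Re (log_deriv (\<i> * of_real (real (Suc m)))) = (\<Sum>k. t m k)"
      unfolding log_deriv_def t_def using bounded_linear.suminf[OF bounded_linear_Re s] by simp
    also have "summable (t m)" unfolding t_def by (rule summable_Re[OF s])
    then have "(\<Sum>k. t m k) = t m 0 + (\<Sum>k. t m (Suc k))"
      using suminf_split_head[of "t m"] by simp
    finally show ?thesis .
  qed
  then show ?thesis using S by simp
qed

lemma pos_series_tendsto_0: "(\<lambda>m. pos_series (\<i> * of_real (real (Suc m)))) \<longlonglongrightarrow> 0"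
proof -
  have "(\<lambda>m. \<Sum>\<^sub>\<infinity>\<gamma>\<in>pos_freqs. b \<gamma> * exp (2 * pi * \<i> * complex_of_real \<gamma> * (\<i> * of_real (real (Suc m))))) \<longlonglongrightarrow> (\<Sum>\<^sub>\<infinity>\<gamma>\<in>pos_freqs. 0)"
  proof (rule infsum_dominated_convergence[where Y = UNIV and M = "\<lambda>\<gamma>. norm (b \<gamma>) * exp (- 2 * pi * 1 * \<gamma>)"])
    have n: "norm (b \<gamma> * exp (2 * pi * \<i> * complex_of_real \<gamma> * (\<i> * of_real (real (Suc m))))) = norm (b \<gamma>) * exp (- 2 * pi * \<gamma> * real (Suc m))" for \<gamma> m
      by (simp add: norm_mult norm_exp_eq_Re)
    show "norm (b \<gamma> * exp (2 * pi * \<i> * complex_of_real \<gamma> * (\<i> * of_real (real (Suc m))))) \<le> norm (b \<gamma>) * exp (- 2 * pi * 1 * \<gamma>)"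
      if "\<gamma> \<in> pos_freqs" for \<gamma> m
    proof -
      have "\<gamma> > 0" using that by (simp add: pos_freqs_def)
      then have "2 * pi * \<gamma> * 1 \<le> 2 * pi * \<gamma> * real (Suc m)" by (intro mult_left_mono) auto
      then show ?thesis unfolding n by (intro mult_left_mono) auto
    qed
    show "(\<lambda>\<gamma>. norm (b \<gamma>) * exp (- 2 * pi * 1 * \<gamma>)) summable_on pos_freqs" by (rule summable_b_exp) simp
    show "(\<lambda>m. b \<gamma> * exp (2 * pi * \<i> * complex_of_real \<gamma> * (\<i> * of_real (real (Suc m))))) \<longlonglongrightarrow> 0" if "\<gamma> \<in> pos_freqs" for \<gamma>
    proof (rule tendsto_norm_zero_cancel)
      have g: "\<gamma> > 0" using that by (simp add: pos_freqs_def)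
      have "(\<lambda>m. exp (- 2 * pi * \<gamma> * real (Suc m))) \<longlonglongrightarrow> 0" using g by real_asymp
      then have "(\<lambda>m. norm (b \<gamma>) * exp (- 2 * pi * \<gamma> * real (Suc m))) \<longlonglongrightarrow> norm (b \<gamma>) * 0" by (rule tendsto_mult_left)
      then show "(\<lambda>m. norm (b \<gamma> * exp (2 * pi * \<i> * complex_of_real \<gamma> * (\<i> * of_real (real (Suc m)))))) \<longlonglongrightarrow> 0"
        unfolding n by simp
    qed
  qed auto
  then show ?thesis by (simp add: pos_series_def)
qed

text \<open>The height tends to infinity on the imaginary axis, where the real part of the
  logarithmic derivative and the exponential series both vanish in the limit. A nonzero real part
  would make \<open>exp (exponent * z)\<close> unbounded on horizontal lines.\<close>

lemma Re_exponent: "Re exponent = 0"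
proof -
  have "Re (log_deriv (\<i> * of_real (real (Suc m)))) + Re (2 * pi * \<i> * pos_series (\<i> * of_real (real (Suc m)))) = Re exponent" for m
    using log_deriv_eq[of "\<i> * of_real (real (Suc m))"] by simp
  moreover have "(\<lambda>m. Re (log_deriv (\<i> * of_real (real (Suc m)))) + Re (2 * pi * \<i> * pos_series (\<i> * of_real (real (Suc m))))) \<longlonglongrightarrow> 0 + Re (2 * pi * \<i> * 0)"
    by (intro tendsto_add Re_log_deriv_tendsto_0 tendsto_Re tendsto_mult_left pos_series_tendsto_0)
  ultimately show ?thesis by (simp add: LIMSEQ_const_iff)
qed

subsection \<open>Almost periodicity\<close>

text \<open>Any positive threshold would separate a bounded range, where
  \<open>norm (b \<gamma>)\<close> itself is summable, from a range where dividing by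
  \<open>\<gamma>\<close> is harmless; the value 1 is that of the statement.\<close>

definition low_freqs where "low_freqs = \<Gamma> \<inter> {0<..<1}"
definition high_freqs where "high_freqs = \<Gamma> \<inter> {1..}"

lemma summable_b_low: "(\<lambda>\<gamma>. norm (b \<gamma>)) summable_on low_freqs"
proof -
  have "(\<lambda>\<gamma>. norm (b \<gamma>) * exp (- 2 * pi * 1 * \<gamma>)) summable_on low_freqs"
    by (rule summable_on_subset_banach[OF summable_b_exp]) (auto simp: low_freqs_def pos_freqs_def)
  from summable_on_cmult_right[OF this, of "exp (2 * pi)"] show ?thesis
  proof (rule summable_on_comparison_test)
    fix \<gamma> assume "\<gamma> \<in> low_freqs"
    then have "2 * pi * \<gamma> \<le> 2 * pi * 1" unfolding low_freqs_def by (intro mult_left_mono) auto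
    then have "1 \<le> exp (2 * pi) * exp (- 2 * pi * 1 * \<gamma>)" by (simp add: mult_exp_exp)
    from mult_left_mono[OF this, of "norm (b \<gamma>)"]
    show "norm (b \<gamma>) \<le> exp (2 * pi) * (norm (b \<gamma>) * exp (- 2 * pi * 1 * \<gamma>))" by (simp add: mult_ac)
  qed auto
qed

lemma summable_b_high:
  assumes "y > 0"
  shows "(\<lambda>\<gamma>. norm (b \<gamma>) * exp (- 2 * pi * y * \<gamma>)) summable_on high_freqs"
  by (rule summable_on_subset_banach[OF summable_b_exp[OF assms]]) (auto simp: high_freqs_def pos_freqs_def)

abbreviation freq_exp :: "real \<Rightarrow> complex \<Rightarrow> complex" where
  "freq_exp \<gamma> z \<equiv> exp (2 * pi * \<i> * complex_of_real \<gamma> * z)"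

lemma norm_freq_exp: "norm (freq_exp \<gamma> z) = exp (- 2 * pi * Im z * \<gamma>)"
  by (simp add: norm_exp_eq_Re mult_ac)

lemma freq_exp_derivative: "(freq_exp \<gamma> has_field_derivative (2 * pi * \<i> * of_real \<gamma>) * freq_exp \<gamma> z) (at z)"
  by (auto intro!: derivative_eq_intros)

definition low_series where "low_series z = (\<Sum>\<^sub>\<infinity>\<gamma>\<in>low_freqs. b \<gamma> * (freq_exp \<gamma> z - 1) / complex_of_real \<gamma>)"

text \<open>The subtracted 1 provides a factor \<open>\<gamma>\<close> through
  \<open>norm (exp v - 1) \<le> norm v * exp (norm v)\<close>, which cancels the denominator. The
  price is growth of the bound in \<open>norm z\<close>.\<close>

lemma low_series_term_bound:
  assumes "\<gamma> \<in> low_freqs"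
  shows "norm (b \<gamma> * (freq_exp \<gamma> z - 1) / complex_of_real \<gamma>) \<le> (2 * pi * norm z * exp (2 * pi * norm z)) * norm (b \<gamma>)"
proof -
  have g: "0 < \<gamma>" "\<gamma> < 1" using assms by (auto simp: low_freqs_def)
  define v where "v = 2 * pi * \<i> * complex_of_real \<gamma> * z"
  have nv: "norm v = 2 * pi * norm z * \<gamma>" using g by (simp add: v_def norm_mult)
  have "2 * pi * norm z * \<gamma> \<le> 2 * pi * norm z * 1" using g by (intro mult_left_mono) auto
  then have "norm v * exp (norm v) \<le> (2 * pi * norm z * \<gamma>) * exp (2 * pi * norm z)"
    unfolding nv using g by (intro mult_mono) auto
  then have "norm (exp v - 1) \<le> (2 * pi * norm z * \<gamma>) * exp (2 * pi * norm z)"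
    using norm_exp_minus_1_le[of v] by linarith
  from mult_left_mono[OF this, of "norm (b \<gamma>) / \<gamma>"] g
  have "norm (b \<gamma>) / \<gamma> * norm (exp v - 1) \<le> (2 * pi * norm z * exp (2 * pi * norm z)) * norm (b \<gamma>)"
    by (simp add: mult_ac)
  then show ?thesis using g by (simp add: v_def norm_mult norm_divide)
qed

lemma low_series_summable: "(\<lambda>\<gamma>. norm (b \<gamma> * (freq_exp \<gamma> z - 1) / complex_of_real \<gamma>)) summable_on low_freqs"
  by (rule summable_on_comparison_test[OF summable_on_cmult_right[OF summable_b_low] low_series_term_bound]) auto

lemma low_series_has_field_derivative:
  "(low_series has_field_derivative (\<Sum>\<^sub>\<infinity>\<gamma>\<in>low_freqs. 2 * pi * \<i> * (b \<gamma> * freq_exp \<gamma> z))) (at z)"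
  unfolding low_series_def
proof (rule has_field_derivative_infsum_dominated[where r = 1 and
      M = "\<lambda>\<gamma>. (2 * pi * (norm z + 1) * exp (2 * pi * (norm z + 1))) * norm (b \<gamma>)" and
      M' = "\<lambda>\<gamma>. (2 * pi * exp (2 * pi * norm z)) * norm (b \<gamma>)"])
  fix \<gamma> w assume \<gamma>: "\<gamma> \<in> low_freqs" and w: "w \<in> cball z 1"
  have g: "0 < \<gamma>" "\<gamma> < 1" using \<gamma> by (auto simp: low_freqs_def)
  have "((\<lambda>w. b \<gamma> * (freq_exp \<gamma> w - 1) / complex_of_real \<gamma>) has_field_derivative
     b \<gamma> * ((2 * pi * \<i> * of_real \<gamma>) * freq_exp \<gamma> w - 0) / complex_of_real \<gamma>) (at w)"
    by (intro DERIV_cdivide DERIV_cmult DERIV_diff freq_exp_derivative DERIV_const)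
  then show "((\<lambda>w. b \<gamma> * (freq_exp \<gamma> w - 1) / complex_of_real \<gamma>) has_field_derivative 2 * pi * \<i> * (b \<gamma> * freq_exp \<gamma> w)) (at w)"
    using g by (simp add: mult_ac)
  have "norm (w - z) \<le> 1" using w by (simp add: dist_norm norm_minus_commute)
  then have "norm w \<le> norm z + 1" using norm_triangle_ineq[of "w - z" z] by simp
  then have "(2 * pi * norm w * exp (2 * pi * norm w)) * norm (b \<gamma>) \<le> (2 * pi * (norm z + 1) * exp (2 * pi * (norm z + 1))) * norm (b \<gamma>)"
    by (intro mult_right_mono mult_mono) auto
  then show "norm (b \<gamma> * (freq_exp \<gamma> w - 1) / complex_of_real \<gamma>) \<le> (2 * pi * (norm z + 1) * exp (2 * pi * (norm z + 1))) * norm (b \<gamma>)"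
    using low_series_term_bound[OF \<gamma>, of w] by linarith
next
  fix \<gamma> assume \<gamma>: "\<gamma> \<in> low_freqs"
  have g: "0 < \<gamma>" "\<gamma> < 1" using \<gamma> by (auto simp: low_freqs_def)
  have "- Im z * \<gamma> \<le> norm z * 1" using g abs_Im_le_cmod[of z] by (intro mult_mono) auto
  then have "(2 * pi) * (- Im z * \<gamma>) \<le> (2 * pi) * (norm z * 1)" by (intro mult_left_mono) auto
  then have "exp (- 2 * pi * Im z * \<gamma>) \<le> exp (2 * pi * norm z)" by (simp add: mult.assoc)
  then have "norm (freq_exp \<gamma> z) \<le> exp (2 * pi * norm z)" unfolding norm_freq_exp .
  from mult_left_mono[OF this, of "2 * pi * norm (b \<gamma>)"]
  show "norm (2 * pi * \<i> * (b \<gamma> * freq_exp \<gamma> z)) \<le> (2 * pi * exp (2 * pi * norm z)) * norm (b \<gamma>)"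
    by (simp add: norm_mult mult_ac)
qed (auto intro!: summable_on_cmult_right summable_b_low)

definition high_series where "high_series z = (\<Sum>\<^sub>\<infinity>\<gamma>\<in>high_freqs. b \<gamma> / complex_of_real \<gamma> * freq_exp \<gamma> z)"

lemma high_series_term_bound:
  assumes "\<gamma> \<in> high_freqs"
  shows "norm (b \<gamma> / complex_of_real \<gamma> * freq_exp \<gamma> z) \<le> norm (b \<gamma>) * exp (- 2 * pi * Im z * \<gamma>)"
proof -
  have g: "\<gamma> \<ge> 1" using assms by (simp add: high_freqs_def)
  have "norm (b \<gamma>) / \<gamma> \<le> norm (b \<gamma>) / 1" using g by (intro divide_left_mono) auto
  then have "norm (b \<gamma>) / \<gamma> * norm (freq_exp \<gamma> z) \<le> norm (b \<gamma>) * norm (freq_exp \<gamma> z)" by (intro mult_right_mono) auto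
  then show ?thesis using g unfolding norm_mult norm_divide norm_of_real norm_freq_exp by simp
qed

lemma high_series_summable:
  assumes "Im z > 0"
  shows "(\<lambda>\<gamma>. norm (b \<gamma> / complex_of_real \<gamma> * freq_exp \<gamma> z)) summable_on high_freqs"
  by (rule summable_on_comparison_test[OF summable_b_high[OF assms] high_series_term_bound]) auto

lemma high_series_has_field_derivative:
  assumes "Im z > 0"
  shows "(high_series has_field_derivative (\<Sum>\<^sub>\<infinity>\<gamma>\<in>high_freqs. 2 * pi * \<i> * (b \<gamma> * freq_exp \<gamma> z))) (at z)"
  unfolding high_series_def
\<comment> \<open>This radius keeps the disc above height \<open>Im z / 2\<close>, where the
  exponentials are still summable.\<close>
proof (rule has_field_derivative_infsum_dominated[where r = "Im z / 2" and
      M = "\<lambda>\<gamma>. norm (b \<gamma>) * exp (- 2 * pi * (Im z / 2) * \<gamma>)" and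
      M' = "\<lambda>\<gamma>. 2 * pi * (norm (b \<gamma>) * exp (- 2 * pi * Im z * \<gamma>))"])
  fix \<gamma> w assume \<gamma>: "\<gamma> \<in> high_freqs" and w: "w \<in> cball z (Im z / 2)"
  have g: "\<gamma> \<ge> 1" using \<gamma> by (simp add: high_freqs_def)
  have "((\<lambda>w. b \<gamma> / complex_of_real \<gamma> * freq_exp \<gamma> w) has_field_derivative
     b \<gamma> / complex_of_real \<gamma> * ((2 * pi * \<i> * of_real \<gamma>) * freq_exp \<gamma> w)) (at w)"
    by (intro DERIV_cmult freq_exp_derivative)
  then show "((\<lambda>w. b \<gamma> / complex_of_real \<gamma> * freq_exp \<gamma> w) has_field_derivative 2 * pi * \<i> * (b \<gamma> * freq_exp \<gamma> w)) (at w)"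
    using g by (simp add: mult_ac)
  have "\<bar>Im (z - w)\<bar> \<le> Im z / 2" using abs_Im_le_cmod[of "z - w"] w by (simp add: dist_norm)
  then have "Im z / 2 \<le> Im w" unfolding minus_complex.sel by linarith
  then have "2 * pi * (Im z / 2) * \<gamma> \<le> 2 * pi * Im w * \<gamma>" using g by (intro mult_right_mono mult_left_mono) auto
  then have "norm (b \<gamma>) * exp (- 2 * pi * Im w * \<gamma>) \<le> norm (b \<gamma>) * exp (- 2 * pi * (Im z / 2) * \<gamma>)"
    by (intro mult_left_mono) auto
  then show "norm (b \<gamma> / complex_of_real \<gamma> * freq_exp \<gamma> w) \<le> norm (b \<gamma>) * exp (- 2 * pi * (Im z / 2) * \<gamma>)"
    using high_series_term_bound[OF \<gamma>, of w] by linarith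
next
  fix \<gamma> assume \<gamma>: "\<gamma> \<in> high_freqs"
  have "norm (2 * pi * \<i> * (b \<gamma> * freq_exp \<gamma> z)) = 2 * pi * (norm (b \<gamma>) * norm (freq_exp \<gamma> z))"
    by (simp add: norm_mult)
  then show "norm (2 * pi * \<i> * (b \<gamma> * freq_exp \<gamma> z)) \<le> 2 * pi * (norm (b \<gamma>) * exp (- 2 * pi * Im z * \<gamma>))"
    unfolding norm_freq_exp by simp
next
  show "(\<lambda>\<gamma>. norm (b \<gamma>) * exp (- 2 * pi * (Im z / 2) * \<gamma>)) summable_on high_freqs"
    by (rule summable_b_high) (use assms in simp)
  show "(\<lambda>\<gamma>. 2 * pi * (norm (b \<gamma>) * exp (- 2 * pi * Im z * \<gamma>))) summable_on high_freqs"
    by (rule summable_on_cmult_right[OF summable_b_high[OF assms]])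
qed (use assms in auto)

lemma pos_series_split:
  assumes "Im z > 0"
  shows "(\<Sum>\<^sub>\<infinity>\<gamma>\<in>low_freqs. 2 * pi * \<i> * (b \<gamma> * freq_exp \<gamma> z)) + (\<Sum>\<^sub>\<infinity>\<gamma>\<in>high_freqs. 2 * pi * \<i> * (b \<gamma> * freq_exp \<gamma> z)) = 2 * pi * \<i> * pos_series z"
proof -
  have P: "pos_freqs = low_freqs \<union> high_freqs" "low_freqs \<inter> high_freqs = {}" by (auto simp: pos_freqs_def low_freqs_def high_freqs_def)
  have s: "(\<lambda>\<gamma>. b \<gamma> * freq_exp \<gamma> z) summable_on pos_freqs" by (rule abs_summable_summable[OF pos_series_abs_summable[OF assms]])
  then have "(\<lambda>\<gamma>. b \<gamma> * freq_exp \<gamma> z) summable_on low_freqs" "(\<lambda>\<gamma>. b \<gamma> * freq_exp \<gamma> z) summable_on high_freqs"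
    unfolding P by (auto intro: summable_on_subset_banach)
  then have "pos_series z = (\<Sum>\<^sub>\<infinity>\<gamma>\<in>low_freqs. b \<gamma> * freq_exp \<gamma> z) + (\<Sum>\<^sub>\<infinity>\<gamma>\<in>high_freqs. b \<gamma> * freq_exp \<gamma> z)"
    unfolding pos_series_def P using P(2) by (rule infsum_Un_disjoint)
  then show ?thesis unfolding infsum_cmult_right' by (simp only: distrib_left)
qed

section \<open>The entire function \<open>F\<close> and its explicit form above the real
  axis\<close>

definition corrected_product where "corrected_product z = exp (low_series z) * zero_product z"

lemma low_series_holomorphic: "low_series holomorphic_on UNIV"
  unfolding holomorphic_on_def field_differentiable_def
  by (intro ballI exI, rule has_field_derivative_at_within[OF low_series_has_field_derivative])

lemma corrected_product_holomorphic: "corrected_product holomorphic_on UNIV"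
  unfolding corrected_product_def by (intro holomorphic_intros low_series_holomorphic zero_product_holomorphic)

text \<open>The quotient of the two sides, written as the product \<open>\<Psi>\<close>, has
  derivative 0 on the convex half plane. No logarithm of \<open>zero_product\<close> is taken, so
  its zeros need no attention.\<close>

lemma corrected_product_upper_half_plane:
  obtains C where "\<And>z. Im z > 0 \<Longrightarrow> corrected_product z = C * exp (exponent * z - high_series z)"
proof -
  define \<Psi> where "\<Psi> z = exp (low_series z + high_series z - exponent * z) * zero_product z" for z
  have "(\<Psi> has_field_derivative 0) (at z)" if "Im z > 0" for z
  proof -
    let ?A = "\<Sum>\<^sub>\<infinity>\<gamma>\<in>low_freqs. 2 * pi * \<i> * (b \<gamma> * freq_exp \<gamma> z)"
    let ?B = "\<Sum>\<^sub>\<infinity>\<gamma>\<in>high_freqs. 2 * pi * \<i> * (b \<gamma> * freq_exp \<gamma> z)"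
    have "((\<lambda>z. low_series z + high_series z - exponent * z) has_field_derivative ?A + ?B - exponent * 1) (at z)"
      by (intro DERIV_diff DERIV_add low_series_has_field_derivative high_series_has_field_derivative[OF that] DERIV_cmult DERIV_ident)
    then have "((\<lambda>z. exp (low_series z + high_series z - exponent * z)) has_field_derivative exp (low_series z + high_series z - exponent * z) * (?A + ?B - exponent * 1)) (at z)"
      by (rule DERIV_fun_exp)
    from DERIV_mult[OF this zero_product_has_field_derivative[OF that]]
    have "(\<Psi> has_field_derivative exp (low_series z + high_series z - exponent * z) * (?A + ?B - exponent * 1) * zero_product z + zero_product z * log_deriv z * exp (low_series z + high_series z - exponent * z)) (at z)"
      unfolding \<Psi>_def .
    moreover have "exp (low_series z + high_series z - exponent * z) * (?A + ?B - exponent * 1) * zero_product z + zero_product z * log_deriv z * exp (low_series z + high_series z - exponent * z) = 0"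
      unfolding pos_series_split[OF that] log_deriv_eq[OF that] by (simp add: algebra_simps)
    ultimately show ?thesis by simp
  qed
  then have "\<exists>C. \<forall>z\<in>{z. Im z > 0}. \<Psi> z = C"
    by (intro has_field_derivative_zero_constant convex_halfspace_Im_gt) (auto intro: has_field_derivative_at_within)
  then obtain C where C: "\<And>z. Im z > 0 \<Longrightarrow> \<Psi> z = C" by auto
  show ?thesis
  proof (rule that[of C])
    fix z assume "Im z > 0"
    from C[OF this, symmetric] have "C * exp (exponent * z - high_series z) = zero_product z * (exp (low_series z + high_series z - exponent * z) * exp (exponent * z - high_series z))"
      unfolding \<Psi>_def by (simp only: mult_ac)
    also have "\<dots> = corrected_product z" by (simp add: corrected_product_def mult_exp_exp)
    finally show "corrected_product z = C * exp (exponent * z - high_series z)" by simp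
  qed
qed

lemma norm_high_series_le:
  assumes "Im z > 0"
  shows "norm (high_series z) \<le> (\<Sum>\<^sub>\<infinity>\<gamma>\<in>high_freqs. norm (b \<gamma>) * exp (- 2 * pi * Im z * \<gamma>))"
proof -
  have "norm (high_series z) \<le> (\<Sum>\<^sub>\<infinity>\<gamma>\<in>high_freqs. norm (b \<gamma> / complex_of_real \<gamma> * freq_exp \<gamma> z))"
    unfolding high_series_def by (rule norm_infsum_bound[OF high_series_summable[OF assms]])
  also have "\<dots> \<le> (\<Sum>\<^sub>\<infinity>\<gamma>\<in>high_freqs. norm (b \<gamma>) * exp (- 2 * pi * Im z * \<gamma>))"
    by (rule infsum_mono[OF high_series_summable[OF assms] summable_b_high[OF assms] high_series_term_bound])
  finally show ?thesis .
qed

lemma high_series_shift: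
  assumes "Im z > 0"
  shows "norm (high_series (z + of_real \<tau>) - high_series z)
    \<le> (\<Sum>\<^sub>\<infinity>\<gamma>\<in>high_freqs. (norm (b \<gamma>) * exp (- 2 * pi * Im z * \<gamma>)) * norm (cis (2 * pi * \<gamma> * \<tau>) - 1))"
proof -
  let ?t = "\<lambda>\<gamma> z. b \<gamma> / complex_of_real \<gamma> * freq_exp \<gamma> z"
  let ?c = "\<lambda>\<gamma>. cis (2 * pi * \<gamma> * \<tau>) - 1"
  have im: "Im (z + of_real \<tau>) > 0" using assms by simp
  have "freq_exp \<gamma> (z + of_real \<tau>) = freq_exp \<gamma> z * cis (2 * pi * \<gamma> * \<tau>)" for \<gamma>
    by (simp add: cis_conv_exp exp_add algebra_simps)
  then have eq: "?t \<gamma> (z + of_real \<tau>) - ?t \<gamma> z = ?t \<gamma> z * ?c \<gamma>" for \<gamma>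
    by (simp only: right_diff_distrib mult_1_right mult.assoc)
  have le: "norm (?t \<gamma> z * ?c \<gamma>) \<le> (norm (b \<gamma>) * exp (- 2 * pi * Im z * \<gamma>)) * norm (?c \<gamma>)" if "\<gamma> \<in> high_freqs" for \<gamma>
    unfolding norm_mult[of _ "?c \<gamma>"] by (intro mult_right_mono high_series_term_bound that) simp
  have le2: "(norm (b \<gamma>) * exp (- 2 * pi * Im z * \<gamma>)) * norm (?c \<gamma>) \<le> (norm (b \<gamma>) * exp (- 2 * pi * Im z * \<gamma>)) * 2" for \<gamma>
    by (intro mult_left_mono norm_cis_minus_1_le) simp
  have s2: "(\<lambda>\<gamma>. (norm (b \<gamma>) * exp (- 2 * pi * Im z * \<gamma>)) * norm (?c \<gamma>)) summable_on high_freqs"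
    by (rule summable_on_comparison_test[OF summable_on_cmult_left[OF summable_b_high[OF assms]] le2]) auto
  have s: "(\<lambda>\<gamma>. norm (?t \<gamma> z * ?c \<gamma>)) summable_on high_freqs"
    by (rule summable_on_comparison_test[OF s2 le]) auto
  have "high_series (z + of_real \<tau>) - high_series z = (\<Sum>\<^sub>\<infinity>\<gamma>\<in>high_freqs. ?t \<gamma> (z + of_real \<tau>) - ?t \<gamma> z)"
    unfolding high_series_def
    by (rule infsum_diff[symmetric, OF abs_summable_summable[OF high_series_summable[OF im]] abs_summable_summable[OF high_series_summable[OF assms]]])
  also have "\<dots> = (\<Sum>\<^sub>\<infinity>\<gamma>\<in>high_freqs. ?t \<gamma> z * ?c \<gamma>)" by (simp only: eq)
  also have "norm \<dots> \<le> (\<Sum>\<^sub>\<infinity>\<gamma>\<in>high_freqs. norm (?t \<gamma> z * ?c \<gamma>))"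
    by (rule norm_infsum_bound[OF s])
  also have "\<dots> \<le> (\<Sum>\<^sub>\<infinity>\<gamma>\<in>high_freqs. (norm (b \<gamma>) * exp (- 2 * pi * Im z * \<gamma>)) * norm (?c \<gamma>))"
    by (rule infsum_mono[OF s s2 le])
  finally show ?thesis .
qed

text \<open>All \<open>a n\<close> are real, so a factor at \<open>Complex x u\<close> has squared
  modulus \<open>(1 - x / r)\<^sup>2 + (u / r)\<^sup>2\<close>, which increases with the modulus of
  \<open>u\<close>; the inequality passes to the limit of the products.\<close>

lemma zero_product_vertical_mono:
  assumes "\<bar>y\<bar> \<le> s"
  shows "norm (zero_product (Complex x y)) \<le> norm (zero_product (Complex x s))"
proof -
  have lin: "norm (1 - Complex x y / of_real r) \<le> norm (1 - Complex x s / of_real r)" for r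
  proof -
    have eq: "norm (1 - Complex x u / of_real r) = sqrt ((1 - x / r)\<^sup>2 + (u / r)\<^sup>2)" for u
    proof -
      have "1 - Complex x u / of_real r = Complex (1 - x / r) (- (u / r))"
        by (simp add: complex_eq_iff Re_divide_of_real Im_divide_of_real)
      then show ?thesis by (simp add: cmod_def)
    qed
    have "\<bar>y / r\<bar> \<le> \<bar>s / r\<bar>" using assms by (simp add: divide_right_mono)
    then have "(y / r)\<^sup>2 \<le> (s / r)\<^sup>2" by (simp only: abs_le_square_iff)
    then show ?thesis unfolding eq by simp
  qed
  have fac: "norm (1 + factor_dev n (Complex x y)) \<le> norm (1 + factor_dev n (Complex x s))" for n
    by (cases n) (auto simp only: one_plus_factor_dev norm_mult intro!: mult_mono lin norm_ge_zero)
  have "norm (\<Prod>n<N. 1 + factor_dev n (Complex x y)) \<le> norm (\<Prod>n<N. 1 + factor_dev n (Complex x s))" for N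
    unfolding prod_norm[symmetric] by (intro prod_mono conjI norm_ge_zero fac)
  then show ?thesis
    by (intro LIMSEQ_le[OF tendsto_norm[OF product_tendsto] tendsto_norm[OF product_tendsto]]) auto
qed

text \<open>The low series itself need not be bounded along horizontal lines; its variation over a
  vertical segment is, uniformly in \<open>x\<close>. The factor \<open>4 * pi * s\<close> bounds
  \<open>2 * pi * (s - y)\<close>, and the exponentials at height \<open>s\<close> have modulus at
  most 1.\<close>

lemma low_series_vertical:
  assumes "\<bar>y\<bar> \<le> s"
  shows "norm (low_series (Complex x y) - low_series (Complex x s)) \<le> (\<Sum>\<^sub>\<infinity>\<gamma>\<in>low_freqs. (4 * pi * s * exp (4 * pi * s)) * norm (b \<gamma>))"
proof -
  let ?t = "\<lambda>\<gamma> z. b \<gamma> * (freq_exp \<gamma> z - 1) / complex_of_real \<gamma>"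
  have s0: "s \<ge> 0" "y \<ge> - s" "y \<le> s" using assms by auto
  have le: "norm (?t \<gamma> (Complex x y) - ?t \<gamma> (Complex x s)) \<le> (4 * pi * s * exp (4 * pi * s)) * norm (b \<gamma>)" if "\<gamma> \<in> low_freqs" for \<gamma>
  proof -
    have g: "0 < \<gamma>" "\<gamma> < 1" using that by (auto simp: low_freqs_def)
    define u where "u = 2 * pi * \<gamma> * (s - y)"
    have u: "0 \<le> u" using g s0 by (simp add: u_def)
    have "2 * pi * \<gamma> * (s - y) \<le> 2 * pi * \<gamma> * (2 * s)" using g s0 by (intro mult_left_mono) auto
    then have u1: "u \<le> (4 * pi * s) * \<gamma>" by (simp add: u_def mult_ac)
    have "(4 * pi * s) * \<gamma> \<le> (4 * pi * s) * 1" using g s0 by (intro mult_left_mono) auto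
    then have u2: "u \<le> 4 * pi * s" using u1 by linarith
    have "2 * pi * \<i> * complex_of_real \<gamma> * Complex x y = 2 * pi * \<i> * complex_of_real \<gamma> * Complex x s + of_real u"
      by (simp add: complex_eq_iff u_def algebra_simps)
    then have "freq_exp \<gamma> (Complex x y) = freq_exp \<gamma> (Complex x s) * exp (of_real u)" by (simp only: exp_add)
    then have "?t \<gamma> (Complex x y) - ?t \<gamma> (Complex x s) = b \<gamma> / of_real \<gamma> * (freq_exp \<gamma> (Complex x s) * (exp (of_real u) - 1))"
      using g by (simp add: field_simps)
    then have "norm (?t \<gamma> (Complex x y) - ?t \<gamma> (Complex x s)) = norm (b \<gamma>) / \<gamma> * (norm (freq_exp \<gamma> (Complex x s)) * norm (exp (complex_of_real u) - 1))"
      using g by (simp only: norm_mult norm_divide norm_of_real abs_of_pos)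
    also have "\<dots> \<le> norm (b \<gamma>) / \<gamma> * (1 * ((4 * pi * s) * \<gamma> * exp (4 * pi * s)))"
    proof (intro mult_left_mono mult_mono)
      show "norm (freq_exp \<gamma> (Complex x s)) \<le> 1" unfolding norm_freq_exp using g s0 by simp
      have "norm (exp (complex_of_real u) - 1) \<le> u * exp u" using norm_exp_minus_1_le[of "of_real u"] u by simp
      also have "\<dots> \<le> (4 * pi * s) * \<gamma> * exp (4 * pi * s)" using u u1 u2 s0 g by (intro mult_mono) auto
      finally show "norm (exp (complex_of_real u) - 1) \<le> (4 * pi * s) * \<gamma> * exp (4 * pi * s)" .
    qed (use g in auto)
    also have "\<dots> = (4 * pi * s * exp (4 * pi * s)) * norm (b \<gamma>)" using g by simp
    finally show ?thesis .
  qed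
  have s2: "(\<lambda>\<gamma>. (4 * pi * s * exp (4 * pi * s)) * norm (b \<gamma>)) summable_on low_freqs"
    by (rule summable_on_cmult_right[OF summable_b_low])
  have s1: "(\<lambda>\<gamma>. norm (?t \<gamma> (Complex x y) - ?t \<gamma> (Complex x s))) summable_on low_freqs"
    by (rule summable_on_comparison_test[OF s2 le]) auto
  have eq: "low_series (Complex x y) - low_series (Complex x s) = (\<Sum>\<^sub>\<infinity>\<gamma>\<in>low_freqs. ?t \<gamma> (Complex x y) - ?t \<gamma> (Complex x s))"
    unfolding low_series_def by (rule infsum_diff[symmetric, OF abs_summable_summable[OF low_series_summable] abs_summable_summable[OF low_series_summable]])
  show ?thesis unfolding eq
    by (rule order.trans[OF norm_infsum_bound[OF s1] infsum_mono[OF s1 s2 le]])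
qed

text \<open>Every point of the strip is compared with the point of height \<open>s\<close> on the
  same vertical line: the modulus of the product is largest there, and the exponential of the low
  series changes by a bounded factor. The explicit formula is thus needed only on the upper edge,
  and the lower half plane is covered as well.\<close>

lemma corrected_product_bounded_strip:
  assumes "s > 0"
  obtains B where "B > 0" "\<And>z. \<bar>Im z\<bar> \<le> s \<Longrightarrow> norm (corrected_product z) \<le> B"
proof -
  obtain C where C: "\<And>z. Im z > 0 \<Longrightarrow> corrected_product z = C * exp (exponent * z - high_series z)"
    using corrected_product_upper_half_plane by blast
  define v where "v = (\<Sum>\<^sub>\<infinity>\<gamma>\<in>high_freqs. norm (b \<gamma>) * exp (- 2 * pi * s * \<gamma>))"
  define d where "d = (\<Sum>\<^sub>\<infinity>\<gamma>\<in>low_freqs. (4 * pi * s * exp (4 * pi * s)) * norm (b \<gamma>))"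
  define B where "B = exp d * (norm C * exp (\<bar>Im exponent\<bar> * s + v)) + 1"
  have line: "norm (corrected_product (Complex x s)) \<le> norm C * exp (\<bar>Im exponent\<bar> * s + v)" for x
  proof -
    have "- Im exponent * s \<le> \<bar>Im exponent\<bar> * s" using assms by (intro mult_right_mono) auto
    moreover have "Re (exponent * Complex x s) = - Im exponent * s" using Re_exponent by simp
    moreover have "- Re (high_series (Complex x s)) \<le> v"
      using norm_high_series_le[of "Complex x s"] assms abs_Re_le_cmod[of "high_series (Complex x s)"] unfolding v_def by simp
    ultimately have "Re (exponent * Complex x s - high_series (Complex x s)) \<le> \<bar>Im exponent\<bar> * s + v" unfolding minus_complex.sel by linarith
    then have "norm C * exp (Re (exponent * Complex x s - high_series (Complex x s))) \<le> norm C * exp (\<bar>Im exponent\<bar> * s + v)"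
      by (intro mult_left_mono) auto
    then show ?thesis using C[of "Complex x s"] assms by (simp only: norm_mult norm_exp_eq_Re complex.sel)
  qed
  show ?thesis
  proof (rule that[of B])
    show "B > 0" unfolding B_def by (intro add_nonneg_pos) auto
    fix z assume z: "\<bar>Im z\<bar> \<le> s"
    define x y where "x = Re z" and "y = Im z"
    have zxy: "z = Complex x y" by (simp add: x_def y_def)
    have "exp (low_series z) = exp (low_series (Complex x s)) * exp (low_series z - low_series (Complex x s))" by (simp add: mult_exp_exp)
    moreover have "norm (exp (low_series z - low_series (Complex x s))) \<le> exp d"
    proof -
      have "Re (low_series z - low_series (Complex x s)) \<le> norm (low_series z - low_series (Complex x s))" by (rule complex_Re_le_cmod)
      also have "\<dots> \<le> d" unfolding d_def zxy by (rule low_series_vertical) (use z in \<open>simp add: y_def\<close>)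
      finally show ?thesis by (simp add: norm_exp_eq_Re)
    qed
    ultimately have 1: "norm (exp (low_series z)) \<le> norm (exp (low_series (Complex x s))) * exp d"
      by (simp add: norm_mult mult_left_mono del: norm_exp_eq_Re)
    have 2: "norm (zero_product z) \<le> norm (zero_product (Complex x s))"
      unfolding zxy by (rule zero_product_vertical_mono) (use z in \<open>simp add: y_def\<close>)
    have "norm (corrected_product z) \<le> (norm (exp (low_series (Complex x s))) * exp d) * norm (zero_product (Complex x s))"
      unfolding corrected_product_def norm_mult by (rule mult_mono[OF 1 2]) auto
    also have "\<dots> = exp d * norm (corrected_product (Complex x s))" by (simp only: corrected_product_def norm_mult mult_ac)
    also have "\<dots> \<le> exp d * (norm C * exp (\<bar>Im exponent\<bar> * s + v))" by (intro mult_left_mono line) auto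
    also have "\<dots> \<le> B" by (simp add: B_def)
    finally show "norm (corrected_product z) \<le> B" .
  qed
qed

text \<open>Translation multiplies the value by a rotation, as \<open>exponent\<close> is purely
  imaginary, and by \<open>exp d\<close> with \<open>norm d \<le> \<eta>\<close>. The constant 4 is
  3 from \<open>exp 1 \<le> 3\<close> plus 1 from the rotation.\<close>

lemma corrected_product_shift_line:
  assumes z: "Im z > 0" and \<eta>: "0 < \<eta>" "\<eta> \<le> 1"
    and 1: "(\<Sum>\<^sub>\<infinity>\<gamma>\<in>high_freqs. (norm (b \<gamma>) * exp (- 2 * pi * Im z * \<gamma>)) * norm (cis (2 * pi * \<gamma> * \<tau>) - 1)) < \<eta>"
    and 2: "norm (cis (Im exponent * \<tau>) - 1) < \<eta>"
  shows "norm (corrected_product (z + of_real \<tau>) - corrected_product z) \<le> norm (corrected_product z) * (4 * \<eta>)"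
proof -
  obtain C where C: "\<And>z. Im z > 0 \<Longrightarrow> corrected_product z = C * exp (exponent * z - high_series z)"
    using corrected_product_upper_half_plane by blast
  define d where "d = - (high_series (z + of_real \<tau>) - high_series z)"
  have d: "norm d \<le> \<eta>" using high_series_shift[OF z, of \<tau>] 1 unfolding d_def norm_minus_cancel by linarith
  have exponent: "exponent = \<i> * of_real (Im exponent)" using Re_exponent by (simp add: complex_eq_iff)
  have "exponent * of_real \<tau> = \<i> * of_real (Im exponent * \<tau>)" by (subst exponent) simp
  then have cK: "exp (exponent * of_real \<tau>) = cis (Im exponent * \<tau>)" by (simp only: cis_conv_exp)
  have "corrected_product (z + of_real \<tau>) = C * exp (exponent * (z + of_real \<tau>) - high_series (z + of_real \<tau>))" using z by (intro C) simp
  also have "exponent * (z + of_real \<tau>) - high_series (z + of_real \<tau>) = (exponent * z - high_series z) + (exponent * of_real \<tau> + d)"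
    by (simp add: d_def algebra_simps)
  also have "C * exp \<dots> = corrected_product z * (cis (Im exponent * \<tau>) * exp d)"
    unfolding C[OF z] exp_add cK by (simp add: mult_ac)
  finally have "corrected_product (z + of_real \<tau>) - corrected_product z = corrected_product z * (cis (Im exponent * \<tau>) * (exp d - 1) + (cis (Im exponent * \<tau>) - 1))"
    by (simp add: algebra_simps)
  also have "norm \<dots> \<le> norm (corrected_product z) * (4 * \<eta>)"
    unfolding norm_mult[of "corrected_product z"]
  proof (rule mult_left_mono)
    have "norm (exp d - 1) \<le> norm d * exp (norm d)" by (rule norm_exp_minus_1_le)
    also have "\<dots> \<le> \<eta> * 3"
    proof (intro mult_mono d)
      have "exp (norm d) \<le> exp 1" using d \<eta> by simp
      then show "exp (norm d) \<le> 3" using exp_le by linarith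
    qed (use \<eta> in auto)
    finally have "norm (cis (Im exponent * \<tau>) * (exp d - 1)) \<le> \<eta> * 3" by (simp add: norm_mult)
    then show "norm (cis (Im exponent * \<tau>) * (exp d - 1) + (cis (Im exponent * \<tau>) - 1)) \<le> 4 * \<eta>"
      using 2 norm_triangle_ineq[of "cis (Im exponent * \<tau>) * (exp d - 1)" "cis (Im exponent * \<tau>) - 1"] by linarith
  qed simp
  finally show ?thesis .
qed

lemma corrected_product_almost_periodic: "almost_periodic_entire corrected_product"
  unfolding almost_periodic_entire_def
proof (intro conjI corrected_product_holomorphic allI impI)
  fix \<alpha> \<beta> \<epsilon> :: real assume ab: "\<alpha> \<le> \<beta>" and \<epsilon>: "\<epsilon> > 0"
  \<comment> \<open>The added 1 makes \<open>\<alpha>\<close> strictly larger than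
    \<open>- S\<close>, as the three lines argument requires.\<close>
  define S where "S = max \<bar>\<alpha>\<bar> \<bar>\<beta>\<bar> + 1"
  have S: "S > 0" "- S < \<alpha>" "\<beta> \<le> S" by (auto simp: S_def)
  obtain B where B: "B > 0" "\<And>z. \<bar>Im z\<bar> \<le> S \<Longrightarrow> norm (corrected_product z) \<le> B"
    by (rule corrected_product_bounded_strip[OF S(1)]) blast
  \<comment> \<open>A difference of two values is bounded by \<open>2 * B\<close>, and the target
    \<open>\<epsilon> / 2\<close> leaves room for the strict inequality in the definition of almost
    periodicity.\<close>
  obtain \<eta> where \<eta>: "\<eta> > 0" "\<And>h z. h holomorphic_on UNIV \<Longrightarrow> (\<And>z. \<bar>Im z\<bar> \<le> S \<Longrightarrow> norm (h z) \<le> 2 * B) \<Longrightarrow>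
     (\<And>z. Im z = S \<Longrightarrow> norm (h z) \<le> \<eta>) \<Longrightarrow> \<alpha> \<le> Im z \<Longrightarrow> Im z \<le> S \<Longrightarrow> norm (h z) \<le> \<epsilon> / 2"
    by (rule bounded_strip_small[of "2 * B" "\<epsilon> / 2" S \<alpha>]) (use B \<epsilon> S in auto)
  define \<eta>' where "\<eta>' = min 1 (\<eta> / (4 * B))"
  have \<eta>': "0 < \<eta>'" "\<eta>' \<le> 1" "\<eta>' \<le> \<eta> / (4 * B)" using \<eta>(1) B(1) by (auto simp: \<eta>'_def)
  obtain L where L: "L > 0" "\<And>x0. \<exists>\<tau>\<in>{x0..x0+L}.
      (\<Sum>\<^sub>\<infinity>\<gamma>\<in>high_freqs. (norm (b \<gamma>) * exp (- 2 * pi * S * \<gamma>)) * norm (cis (2 * pi * \<gamma> * \<tau>) - 1)) < \<eta>' \<and>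
      norm (cis (Im exponent * \<tau>) - 1) < \<eta>'"
    using common_almost_periods_weighted[OF summable_b_high[OF S(1)] _ \<eta>'(1), of "\<lambda>\<gamma>. 2 * pi * \<gamma>" "Im exponent"] by auto
  show "\<exists>L>0. \<forall>x0. \<exists>\<tau>\<in>{x0..x0 + L}. \<exists>\<delta><\<epsilon>. \<forall>x y. \<alpha> \<le> y \<longrightarrow> y \<le> \<beta> \<longrightarrow>
       norm (corrected_product (Complex (x + \<tau>) y) - corrected_product (Complex x y)) \<le> \<delta>"
  proof (intro exI[of _ L] conjI L(1) allI)
    fix x0
    obtain \<tau> where \<tau>: "\<tau> \<in> {x0..x0+L}"
      "(\<Sum>\<^sub>\<infinity>\<gamma>\<in>high_freqs. (norm (b \<gamma>) * exp (- 2 * pi * S * \<gamma>)) * norm (cis (2 * pi * \<gamma> * \<tau>) - 1)) < \<eta>'"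
      "norm (cis (Im exponent * \<tau>) - 1) < \<eta>'" using L(2) by blast
    define h where "h z = corrected_product (z + of_real \<tau>) - corrected_product z" for z
    have holh: "h holomorphic_on UNIV"
      unfolding h_def
      by (intro holomorphic_on_diff corrected_product_holomorphic holomorphic_on_compose_gen[OF _ corrected_product_holomorphic, unfolded comp_def])
         (auto intro!: holomorphic_intros)
    have h1: "norm (h z) \<le> 2 * B" if "\<bar>Im z\<bar> \<le> S" for z
      using norm_triangle_ineq4[of "corrected_product (z + of_real \<tau>)" "corrected_product z"] B(2)[of z] B(2)[of "z + of_real \<tau>"] that
      unfolding h_def by simp
    have h2: "norm (h z) \<le> \<eta>" if "Im z = S" for z
    proof -
      have "norm (h z) \<le> norm (corrected_product z) * (4 * \<eta>')"
        unfolding h_def by (rule corrected_product_shift_line[OF _ \<eta>'(1,2)]) (use that S \<tau> in auto)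
      also have "\<dots> \<le> B * (4 * (\<eta> / (4 * B)))"
        using B(2)[of z] that S \<eta>' B(1) by (intro mult_mono) auto
      also have "\<dots> = \<eta>" using B(1) by simp
      finally show ?thesis .
    qed
    show "\<exists>\<tau>\<in>{x0..x0 + L}. \<exists>\<delta><\<epsilon>. \<forall>x y. \<alpha> \<le> y \<longrightarrow> y \<le> \<beta> \<longrightarrow>
       norm (corrected_product (Complex (x + \<tau>) y) - corrected_product (Complex x y)) \<le> \<delta>"
    proof (intro bexI[of _ \<tau>] exI[of _ "\<epsilon> / 2"] conjI allI impI \<tau>(1))
      fix x y assume y: "\<alpha> \<le> y" "y \<le> \<beta>"
      have "norm (h (Complex x y)) \<le> \<epsilon> / 2"
        by (rule \<eta>(2)[OF holh h1 h2]) (use y S in auto)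
      moreover have "Complex x y + of_real \<tau> = Complex (x + \<tau>) y" by (simp add: complex_eq_iff)
      ultimately show "norm (corrected_product (Complex (x + \<tau>) y) - corrected_product (Complex x y)) \<le> \<epsilon> / 2" by (simp add: h_def)
    qed (use \<epsilon> in auto)
  qed
qed

end

theorem theorem2:
  fixes \<Lambda> \<Gamma> :: "real set" and c :: "real \<Rightarrow> nat" and b :: "real \<Rightarrow> complex"
    and a :: "int \<Rightarrow> real"
  assumes loc_fin: "\<And>R. finite (\<Lambda> \<inter> {-R..R})"
    and c_pos: "\<And>x. x \<in> \<Lambda> \<Longrightarrow> c x > 0"
    and mu_temp: "tempered_discrete \<Lambda> (\<lambda>x. of_nat (c x))"
    and Gamma_countable: "countable \<Gamma>"
    and absmuhat_temp: "tempered_discrete \<Gamma> (\<lambda>x. complex_of_real (norm (b x)))"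
    and fourier_eq: "\<And>\<phi>. schwartz \<phi> \<Longrightarrow>
        pair_discrete \<Lambda> (\<lambda>x. of_nat (c x)) (fourier \<phi>) = pair_discrete \<Gamma> b \<phi>"
    and a_mono: "\<And>n. a n \<le> a (n + 1)"
    and a_range: "range a = \<Lambda>"
    and a_mult: "\<And>x. x \<in> \<Lambda> \<Longrightarrow> card {n. a n = x} = c x"
    and zero_notin: "0 \<notin> range a"
  shows "\<exists>f. (\<forall>z. (\<lambda>N. (1 - z / complex_of_real (a 0)) *
                  (\<Prod>n\<in>{1..N}. (1 - z / complex_of_real (a (int n))) *
                                  (1 - z / complex_of_real (a (- int n)))))
                \<longlonglongrightarrow> f z) \<and>
             almost_periodic_entire
               (\<lambda>z. exp (\<Sum>\<^sub>\<infinity>\<gamma>\<in>\<Gamma> \<inter> {0<..<1}.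
                        b \<gamma> * (exp (2 * pi * \<i> * complex_of_real \<gamma> * z) - 1) / complex_of_real \<gamma>)
                    * f z)"
proof -
  interpret integer_fourier_measure \<Lambda> \<Gamma> c b a
    by (rule integer_fourier_measure.intro
        [OF c_pos mu_temp absmuhat_temp fourier_eq a_mono a_range a_mult zero_notin])
  show ?thesis
  proof (intro exI[of _ zero_product] conjI allI)
    fix z
    show "(\<lambda>N. (1 - z / complex_of_real (a 0)) *
                  (\<Prod>n\<in>{1..N}. (1 - z / complex_of_real (a (int n))) *
                                  (1 - z / complex_of_real (a (- int n))))) \<longlonglongrightarrow> zero_product z"
      \<comment> \<open>\<open>N\<close> pairs correspond to \<open>Suc N\<close> factors, because
        index 0 holds the unpaired one.\<close>
      using LIMSEQ_Suc[OF product_tendsto[of z]] unfolding partial_product_eq .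
    show "almost_periodic_entire
               (\<lambda>z. exp (\<Sum>\<^sub>\<infinity>\<gamma>\<in>\<Gamma> \<inter> {0<..<1}.
                        b \<gamma> * (exp (2 * pi * \<i> * complex_of_real \<gamma> * z) - 1) / complex_of_real \<gamma>)
                    * zero_product z)"
      using corrected_product_almost_periodic unfolding corrected_product_def low_series_def low_freqs_def .
  qed
qed

end
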